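(* Let $(M,H)$ be a quaternionic contact manifold of dimension $4n+3$, with the bundle $P_1$, its canonical coframing, the curvature functions $\mathcal S,\mathcal V,\mathcal L,\mathcal M,\mathcal C,\mathcal H,\mathcal P,\mathcal Q,\mathcal R$ and the one-forms $\mathcal S^\ast_{\alpha\beta\gamma\delta},\mathcal V^\ast_{\alpha\beta\gamma},\mathcal L^\ast_{\alpha\beta},\mathcal M^\ast_{\alpha\beta},\mathcal C^\ast_\alpha,\mathcal H^\ast_\alpha,\mathcal P^\ast,\mathcal Q^\ast,\mathcal R^\ast$ on $P_1$ described in the context; put $\eta_\pm=\eta_2\pm i\eta_3$. The following identities are satisfied on $P_1$: $$\begin{aligned} d^2\Gamma_{\alpha\beta}=&\ \pi^\sigma_{\bar\delta}\mathcal S^\ast_{\alpha\beta\gamma\sigma}\wedge\theta^\gamma\wedge\theta^{\bar\delta}+\mathcal V^\ast_{\alpha\beta\gamma}\wedge\theta^\gamma\wedge\eta_1+\pi^{\bar\mu}_\alpha\pi^{\bar\nu}_\beta\mathcal V^\ast_{\bar\mu\bar\nu\bar\gamma}\wedge\theta^{\bar\gamma}\wedge\eta_1-i\pi^\sigma_{\bar\gamma}\mathcal V^\ast_{\alpha\beta\sigma}\wedge\theta^{\bar\gamma}\wedge\eta_+\\ &+i\pi^{\bar\mu}_\alpha\pi^{\bar\nu}_\beta\pi^{\bar\xi}_\gamma\mathcal V^\ast_{\bar\mu\bar\nu\bar\xi}\wedge\theta^\gamma\wedge\eta_--i\mathcal L^\ast_{\alpha\beta}\wedge\eta_+\wedge\eta_-+\mathcal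 M^\ast_{\alpha\beta}\wedge\eta_1\wedge\eta_++\pi^{\bar\mu}_\alpha\pi^{\bar\nu}_\beta\mathcal M^\ast_{\bar\mu\bar\nu}\wedge\eta_1\wedge\eta_-=0; \end{aligned}$$ $$\begin{aligned} d^2\phi_\alpha=&-i\pi^\nu_{\bar\gamma}\mathcal V^\ast_{\alpha\beta\nu}\wedge\theta^\beta\wedge\theta^{\bar\gamma}+\pi^{\bar\mu}_\alpha\mathcal L^\ast_{\bar\mu\bar\beta}\wedge\theta^{\bar\beta}\wedge\eta_1+\mathcal M^\ast_{\alpha\beta}\wedge\theta^\beta\wedge\eta_1-i\pi^\nu_{\bar\beta}\mathcal M^\ast_{\alpha\nu}\wedge\theta^{\bar\beta}\wedge\eta_+\\ &+i\mathcal L^\ast_{\alpha\beta}\wedge\theta^\beta\wedge\eta_--\mathcal C^\ast_\alpha\wedge\eta_+\wedge\eta_-+i\pi^{\bar\mu}_\alpha\mathcal C^\ast_{\bar\mu}\wedge\eta_1\wedge\eta_-+\mathcal H^\ast_\alpha\wedge\eta_1\wedge\eta_+=0; \end{aligned}$$ $$\begin{aligned} d^2\psi_1=&\ 4\pi^\mu_{\bar\gamma}\mathcal L^\ast_{\beta\mu}\wedge\theta^\beta\wedge\theta^{\bar\gamma}+4\mathcal C^\ast_\beta\wedge\theta^\beta\wedge\eta_1+4\mathcal C^\ast_{\bar\gamma}\wedge\theta^{\bar\gamma}\wedge\eta_1+4i\pi^{\bar\mu}_\beta\mathcal C^\ast_{\bar\mu}\wedge\theta^\beta\wedge\eta_-\\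 &-4i\pi^\mu_{\bar\gamma}\mathcal C^\ast_\mu\wedge\theta^{\bar\gamma}\wedge\eta_++\mathcal P^\ast\wedge\eta_1\wedge\eta_++\overline{\mathcal P^\ast}\wedge\eta_1\wedge\eta_-+i\mathcal R^\ast\wedge\eta_+\wedge\eta_-=0; \end{aligned}$$ $$\begin{aligned} d^2(\psi_2+i\psi_3)=&\ 4i\pi^{\bar\mu}_\beta\mathcal M^\ast_{\bar\mu\bar\gamma}\wedge\theta^\beta\wedge\theta^{\bar\gamma}+4i\pi^{\bar\mu}_\beta\mathcal C^\ast_{\bar\mu}\wedge\theta^\beta\wedge\eta_1-4\mathcal H^\ast_{\bar\gamma}\wedge\theta^{\bar\gamma}\wedge\eta_1-4\mathcal C^\ast_{\bar\gamma}\wedge\theta^{\bar\gamma}\wedge\eta_+\\ &-4i\pi^{\bar\mu}_\beta\mathcal H^\ast_{\bar\mu}\wedge\theta^\beta\wedge\eta_--i\mathcal R^\ast\wedge\eta_1\wedge\eta_++\overline{\mathcal Q^\ast}\wedge\eta_1\wedge\eta_--\overline{\mathcal P^\ast}\wedge\eta_+\wedge\eta_-=0. \end{aligned}$$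
   Context: Index conventions. $n\ge1$. Small Greek indices run over $1,\dots,2n$; $s,t$ over $1,2,3$; repeated indices are summed. Constants: fix signs $\varepsilon_\alpha\in\{\pm1\}$ with $\varepsilon_{\alpha+n}=\varepsilon_\alpha$ (all $+1$ in the positive definite case); $g_{\alpha\bar\beta}=g_{\bar\beta\alpha}=\varepsilon_\alpha\delta_{\alpha\beta}$; $\pi_{\alpha\beta}=\varepsilon_\alpha$ if $\beta=\alpha+n$, $-\varepsilon_\alpha$ if $\alpha=\beta+n$, $0$ otherwise. $g^{\alpha\bar\beta}=g^{\bar\beta\alpha}$ is the inverse of $g_{\alpha\bar\beta}$; indices are raised and lowered with $g$. The array obtained by interchanging barred and unbarred indices is the complex conjugate array (e.g. $\pi_{\bar\alpha\bar\beta}=\overline{\pi_{\alpha\beta}}$, $\mathcal V^\ast_{\bar\alpha\bar\beta\bar\gamma}=\overline{\mathcal V^\ast_{\alpha\beta\gamma}}$, $\phi^{\bar\alpha}=\overline{\phi^\alpha}$). For two-index arrays $B^\alpha_\beta=g^{\alpha\bar\sigma}B_{\beta\bar\sigma}$ (lower index first); thus $\pi^{\bar\sigma}_\alpha=g^{\bar\sigma\tau}\pi_{\alpha\tau}$, $\pi^\sigma_{\bar\alpha}=\overline{\pi^{\bar\sigma}_\alpha}$, $\pi^{\alpha\beta}=g^{\alpha\bar\sigma}g^{\beta\bar\tau}\pi_{\bar\sigma\bar\tau}$, $U_{\beta\bar\sigma}=g_{\alpha\bar\sigma}U^\alpha_\beta$, $\phi_\alpha=g_{\alpha\bar\sigma}\phi^{\bar\sigma}$,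 $\theta_\alpha=g_{\alpha\bar\sigma}\theta^{\bar\sigma}$, $\theta_{\bar\alpha}=g_{\bar\alpha\sigma}\theta^\sigma$, $\mathcal C^\alpha=g^{\alpha\bar\sigma}\mathcal C_{\bar\sigma}$, $\mathcal H^{\bar\alpha}=g^{\bar\alpha\sigma}\mathcal H_\sigma$. One has $\pi^\alpha_{\bar\sigma}\pi^{\bar\sigma}_\beta=-\delta^\alpha_\beta$. $(\mathfrak jT)_{\alpha_1\dots\alpha_k}=\pi^{\bar\sigma_1}_{\alpha_1}\cdots\pi^{\bar\sigma_k}_{\alpha_k}T_{\bar\sigma_1\dots\bar\sigma_k}$. $Sp(n)$: arrays $U^\alpha_\beta$ with $g_{\sigma\bar\tau}U^\sigma_\alpha U^{\bar\tau}_{\bar\beta}=g_{\alpha\bar\beta}$, $\pi_{\sigma\tau}U^\sigma_\alpha U^\tau_\beta=\pi_{\alpha\beta}$. $(a\wedge b)(u,v)=a(u)b(v)-a(v)b(u)$ for one-forms. Quaternionic contact (qc) manifolds. $(M,H)$, $\dim M=4n+3$, $H$ a codimension-three distribution, is qc if around each point there are one-forms $\hat\eta_1,\hat\eta_2,\hat\eta_3$ with common kernel $H$, a non-degenerate inner product $\hat g$ on $H$ (with the signature of the constants $g_{\alpha\bar\beta}$) and endomorphisms $\hat I_s$ of $H$ with $\hat I_s^2=-\mathrm{id}_H$, $\hat I_1\hat I_2=-\hat I_2\hat I_1=\hat I_3$, $d\hat\eta_s(X,Y)=2\hat g(\hat I_sX,Y)$ for $X,Y\in H$. Standing assumption (automatic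 if $\dim M>7$, assumed if $\dim M=7$): there exist Reeb vector fields $\hat\xi_s$ with $\hat\eta_s(\hat\xi_t)=\delta_{st}$, $d\hat\eta_s(\hat\xi_t,X)=-d\hat\eta_t(\hat\xi_s,X)$ for $X\in H$. $P_o$. Two such local triples are related by $\tilde\eta_s=\mu a_{ts}\hat\eta_t$ with $\mu>0$, $(a_{st})\in SO(3)$ (in indefinite signature the triples are taken in one class so related). They are the local sections of a principal bundle $\pi_o:P_o\to M$ with group $\mathbb R^+\times SO(3)$, carrying the tautological one-forms $\eta_s=\mu a_{ts}\pi_o^*\hat\eta_t$. A form on $P_o$ is semibasic if its contraction with every vector tangent to the fibres of $\pi_o$ vanishes. $P_1$. Consider local coframings $(\eta_s,\theta^\alpha,\theta^{\bar\alpha},\varphi_0,\varphi_s)$ of the complexified $TP_o$, with $\theta^\alpha$ semibasic complex and $\varphi_0,\varphi_s$ real one-forms, such that $$\begin{aligned} d\eta_1&=-\varphi_0\wedge\eta_1-\varphi_2\wedge\eta_3+\varphi_3\wedge\eta_2+2ig_{\alpha\bar\beta}\theta^\alpha\wedge\theta^{\bar\beta},\\ d\eta_2&=-\varphi_0\wedge\eta_2-\varphi_3\wedge\eta_1+\varphi_1\wedge\eta_3+\pi_{\alpha\beta}\theta^\alpha\wedge\theta^\beta+\pi_{\bar\alpha\bar\beta}\theta^{\bar\alpha}\wedge\theta^{\bar\beta},\\ d\eta_3&=-\varphi_0\wedge\eta_3-\varphi_1\wedge\eta_2+\varphi_2\wedge\eta_1-i\pi_{\alpha\beta}\theta^\alpha\wedge\theta^\beta+i\pi_{\bar\alpha\bar\beta}\theta^{\bar\alpha}\wedge\theta^{\bar\beta}.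 \end{aligned}\qquad(\mathrm{SE})$$ They exist near each point and any two are related by $\tilde\theta^\alpha=U^\alpha_\beta\theta^\beta+ir^\alpha\eta_1+\pi^\alpha_{\bar\sigma}r^{\bar\sigma}(\eta_2+i\eta_3)$, $\tilde\varphi_0=\varphi_0+2U_{\beta\bar\sigma}r^{\bar\sigma}\theta^\beta+2U_{\bar\beta\sigma}r^\sigma\theta^{\bar\beta}+\lambda_s\eta_s$, $\tilde\varphi_1=\varphi_1-2iU_{\beta\bar\sigma}r^{\bar\sigma}\theta^\beta+2iU_{\bar\beta\sigma}r^\sigma\theta^{\bar\beta}+2r_\sigma r^\sigma\eta_1-\lambda_3\eta_2+\lambda_2\eta_3$, $\tilde\varphi_2=\varphi_2-2\pi_{\sigma\tau}U^\sigma_\beta r^\tau\theta^\beta-2\pi_{\bar\sigma\bar\tau}U^{\bar\sigma}_{\bar\beta}r^{\bar\tau}\theta^{\bar\beta}+\lambda_3\eta_1+2r_\sigma r^\sigma\eta_2-\lambda_1\eta_3$, $\tilde\varphi_3=\varphi_3+2i\pi_{\sigma\tau}U^\sigma_\beta r^\tau\theta^\beta-2i\pi_{\bar\sigma\bar\tau}U^{\bar\sigma}_{\bar\beta}r^{\bar\tau}\theta^{\bar\beta}-\lambda_2\eta_1+\lambda_1\eta_2+2r_\sigma r^\sigma\eta_3$, with $(U^\alpha_\beta)\in Sp(n)$, $r^\alpha$ complex, $\lambda_s$ real. They are the local sections of a principal bundle $\pi_1:P_1\to P_o$ (a subbundle of the coframe bundle of $P_o$). The tautological forms on $P_1$, denoted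 by the same letters, satisfy (SE) on $P_1$. Canonical coframing. On $P_1$ there are unique complex one-forms $\Gamma_{\alpha\beta},\phi^\alpha$ and real one-forms $\psi_s$ with $\Gamma_{\alpha\beta}=\Gamma_{\beta\alpha}$, $(\mathfrak j\Gamma)_{\alpha\beta}=\Gamma_{\alpha\beta}$ and $$\begin{aligned} d\theta^\alpha&=-i\phi^\alpha\wedge\eta_1-\pi^\alpha_{\bar\sigma}\phi^{\bar\sigma}\wedge\eta_+-\pi^{\alpha\sigma}\Gamma_{\sigma\beta}\wedge\theta^\beta-\tfrac12(\varphi_0+i\varphi_1)\wedge\theta^\alpha-\tfrac12\pi^\alpha_{\bar\beta}(\varphi_2+i\varphi_3)\wedge\theta^{\bar\beta},\\ d\varphi_0&=-\psi_s\wedge\eta_s-2\phi_\beta\wedge\theta^\beta-2\phi_{\bar\beta}\wedge\theta^{\bar\beta},\\ d\varphi_1&=-\varphi_2\wedge\varphi_3-\psi_2\wedge\eta_3+\psi_3\wedge\eta_2+2i\phi_\beta\wedge\theta^\beta-2i\phi_{\bar\beta}\wedge\theta^{\bar\beta},\\ d\varphi_2&=-\varphi_3\wedge\varphi_1-\psi_3\wedge\eta_1+\psi_1\wedge\eta_3-2\pi_{\sigma\beta}\phi^\sigma\wedge\theta^\beta-2\pi_{\bar\sigma\bar\beta}\phi^{\bar\sigma}\wedge\theta^{\bar\beta},\\ d\varphi_3&=-\varphi_1\wedge\varphi_2-\psi_1\wedge\eta_2+\psi_2\wedge\eta_1+2i\pi_{\sigma\beta}\phi^\sigma\wedge\theta^\beta-2i\pi_{\bar\sigma\bar\beta}\phi^{\bar\sigma}\wedge\theta^{\bar\beta}.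 \end{aligned}$$ Curvature functions. $\mathcal S_{\alpha\beta\gamma\delta},\mathcal V_{\alpha\beta\gamma},\mathcal L_{\alpha\beta},\mathcal M_{\alpha\beta}$ (totally symmetric), $\mathcal C_\alpha,\mathcal H_\alpha,\mathcal P,\mathcal Q,\mathcal R$ are the unique complex functions on $P_1$ with $\mathfrak j\mathcal S=\mathcal S$, $\mathfrak j\mathcal L=\mathcal L$, $\overline{\mathcal R}=\mathcal R$ and $$\begin{aligned} d\Gamma_{\alpha\beta}=&-\pi^{\sigma\tau}\Gamma_{\alpha\sigma}\wedge\Gamma_{\tau\beta}+2\pi^{\bar\sigma}_\alpha(\phi_\beta\wedge\theta_{\bar\sigma}-\phi_{\bar\sigma}\wedge\theta_\beta)+2\pi^{\bar\sigma}_\beta(\phi_\alpha\wedge\theta_{\bar\sigma}-\phi_{\bar\sigma}\wedge\theta_\alpha)+\pi^\sigma_{\bar\delta}\mathcal S_{\alpha\beta\gamma\sigma}\theta^\gamma\wedge\theta^{\bar\delta}\\ &+(\mathcal V_{\alpha\beta\gamma}\theta^\gamma+\pi^{\bar\sigma}_\alpha\pi^{\bar\tau}_\beta\mathcal V_{\bar\sigma\bar\tau\bar\gamma}\theta^{\bar\gamma})\wedge\eta_1-i\pi^\sigma_{\bar\gamma}\mathcal V_{\alpha\beta\sigma}\theta^{\bar\gamma}\wedge\eta_++i(\mathfrak j\mathcal V)_{\alpha\beta\gamma}\theta^\gamma\wedge\eta_-\\ &-i\mathcal L_{\alpha\beta}\eta_+\wedge\eta_-+\mathcal M_{\alpha\beta}\eta_1\wedge\eta_++(\mathfrak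 j\mathcal M)_{\alpha\beta}\eta_1\wedge\eta_-,\\ d\phi_\alpha=&\ \tfrac12(\varphi_0+i\varphi_1)\wedge\phi_\alpha+\tfrac12\pi_{\alpha\gamma}(\varphi_2-i\varphi_3)\wedge\phi^\gamma-\pi^{\bar\sigma}_\alpha\Gamma_{\bar\sigma\bar\gamma}\wedge\phi^{\bar\gamma}-\tfrac i2\psi_1\wedge\theta_\alpha-\tfrac12\pi_{\alpha\gamma}(\psi_2-i\psi_3)\wedge\theta^\gamma\\ &-i\pi^\sigma_{\bar\delta}\mathcal V_{\alpha\gamma\sigma}\theta^\gamma\wedge\theta^{\bar\delta}+\mathcal M_{\alpha\gamma}\theta^\gamma\wedge\eta_1+\pi^{\bar\sigma}_\alpha\mathcal L_{\bar\sigma\bar\gamma}\theta^{\bar\gamma}\wedge\eta_1+i\mathcal L_{\alpha\gamma}\theta^\gamma\wedge\eta_--i\pi^\sigma_{\bar\gamma}\mathcal M_{\alpha\sigma}\theta^{\bar\gamma}\wedge\eta_+\\ &-\mathcal C_\alpha\eta_+\wedge\eta_-+\mathcal H_\alpha\eta_1\wedge\eta_++i\pi_{\alpha\sigma}\mathcal C^\sigma\eta_1\wedge\eta_-,\\ d\psi_1=&\ \varphi_0\wedge\psi_1-\varphi_2\wedge\psi_3+\varphi_3\wedge\psi_2-4i\phi_\gamma\wedge\phi^\gamma+4\pi^\sigma_{\bar\delta}\mathcal L_{\gamma\sigma}\theta^\gamma\wedge\theta^{\bar\delta}+4\mathcal C_\gamma\theta^\gamma\wedge\eta_1+4\mathcal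 C_{\bar\gamma}\theta^{\bar\gamma}\wedge\eta_1\\ &-4i\pi_{\bar\gamma\bar\sigma}\mathcal C^{\bar\sigma}\theta^{\bar\gamma}\wedge\eta_++4i\pi_{\gamma\sigma}\mathcal C^\sigma\theta^\gamma\wedge\eta_-+\mathcal P\eta_1\wedge\eta_++\overline{\mathcal P}\eta_1\wedge\eta_-+i\mathcal R\eta_+\wedge\eta_-,\\ d\psi_2+i\,d\psi_3=&\ (\varphi_0-i\varphi_1)\wedge(\psi_2+i\psi_3)+i(\varphi_2+i\varphi_3)\wedge\psi_1+4\pi_{\gamma\delta}\phi^\gamma\wedge\phi^\delta+4i\pi^{\bar\sigma}_\gamma\mathcal M_{\bar\sigma\bar\delta}\theta^\gamma\wedge\theta^{\bar\delta}\\ &+4i\pi^{\bar\sigma}_\gamma\mathcal C_{\bar\sigma}\theta^\gamma\wedge\eta_1-4\mathcal H_{\bar\gamma}\theta^{\bar\gamma}\wedge\eta_1-4\mathcal C_{\bar\gamma}\theta^{\bar\gamma}\wedge\eta_+-4i\pi^{\bar\sigma}_\gamma\mathcal H_{\bar\sigma}\theta^\gamma\wedge\eta_-\\ &-i\mathcal R\eta_1\wedge\eta_++\overline{\mathcal Q}\eta_1\wedge\eta_--\overline{\mathcal P}\eta_+\wedge\eta_-. \end{aligned}$$ Starred forms. $\mathcal S^\ast_{\alpha\beta\gamma\delta}=d\mathcal S_{\alpha\beta\gamma\delta}-\tilde{\mathcal S}^\ast_{\alpha\beta\gamma\delta}$, and similarly $\mathcal V^\ast=d\mathcal V-\tilde{\mathcal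 V}^\ast$, $\mathcal L^\ast=d\mathcal L-\tilde{\mathcal L}^\ast$, $\mathcal M^\ast=d\mathcal M-\tilde{\mathcal M}^\ast$, $\mathcal C^\ast=d\mathcal C-\tilde{\mathcal C}^\ast$, $\mathcal H^\ast=d\mathcal H-\tilde{\mathcal H}^\ast$, $\mathcal R^\ast=d\mathcal R-\tilde{\mathcal R}^\ast$, $\mathcal P^\ast=d\mathcal P-\tilde{\mathcal P}^\ast$, $\mathcal Q^\ast=d\mathcal Q-\tilde{\mathcal Q}^\ast$ (with the same indices), where $$\begin{aligned} \tilde{\mathcal S}^\ast_{\alpha\beta\gamma\delta}=&\ \pi^{\tau\nu}\Gamma_{\nu\alpha}\mathcal S_{\tau\beta\gamma\delta}+\pi^{\tau\nu}\Gamma_{\nu\beta}\mathcal S_{\alpha\tau\gamma\delta}+\pi^{\tau\nu}\Gamma_{\nu\gamma}\mathcal S_{\alpha\beta\tau\delta}+\pi^{\tau\nu}\Gamma_{\nu\delta}\mathcal S_{\alpha\beta\gamma\tau}+\varphi_0\mathcal S_{\alpha\beta\gamma\delta}\\ &+2i(\pi_{\alpha\tau}\mathcal V_{\delta\beta\gamma}+\pi_{\beta\tau}\mathcal V_{\alpha\gamma\delta}+\pi_{\gamma\tau}\mathcal V_{\alpha\beta\delta}+\pi_{\delta\tau}\mathcal V_{\alpha\beta\gamma})\theta^\tau\\ &+2i\big(g_{\alpha\bar\tau}(\mathfrak j\mathcal V)_{\delta\beta\gamma}+g_{\beta\bar\tau}(\mathfrak j\mathcal V)_{\alpha\delta\gamma}+g_{\gamma\bar\tau}(\mathfrak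 j\mathcal V)_{\alpha\beta\delta}+g_{\delta\bar\tau}(\mathfrak j\mathcal V)_{\alpha\beta\gamma}\big)\theta^{\bar\tau},\\ \tilde{\mathcal V}^\ast_{\alpha\beta\gamma}=&\ \pi^{\tau\nu}\Gamma_{\nu\alpha}\mathcal V_{\tau\beta\gamma}+\pi^{\tau\nu}\Gamma_{\nu\beta}\mathcal V_{\alpha\tau\gamma}+\pi^{\tau\nu}\Gamma_{\nu\gamma}\mathcal V_{\alpha\beta\tau}-i\pi^\sigma_{\bar\tau}\phi^{\bar\tau}\mathcal S_{\alpha\beta\gamma\sigma}+\tfrac12(3\varphi_0+i\varphi_1)\mathcal V_{\alpha\beta\gamma}-\tfrac12(\varphi_2-i\varphi_3)(\mathfrak j\mathcal V)_{\alpha\beta\gamma}\\ &-2(\pi_{\alpha\tau}\mathcal M_{\beta\gamma}+\pi_{\beta\tau}\mathcal M_{\alpha\gamma}+\pi_{\gamma\tau}\mathcal M_{\alpha\beta})\theta^\tau-2(g_{\alpha\bar\tau}\mathcal L_{\beta\gamma}+g_{\beta\bar\tau}\mathcal L_{\alpha\gamma}+g_{\gamma\bar\tau}\mathcal L_{\alpha\beta})\theta^{\bar\tau},\\ \tilde{\mathcal L}^\ast_{\alpha\beta}=&\ \pi^{\tau\sigma}\Gamma_{\sigma\alpha}\mathcal L_{\tau\beta}+\pi^{\tau\sigma}\Gamma_{\sigma\beta}\mathcal L_{\alpha\tau}+2\varphi_0\mathcal L_{\alpha\beta}+\tfrac12(\varphi_2+i\varphi_3)\mathcal M_{\alpha\beta}+\tfrac12(\varphi_2-i\varphi_3)(\mathfrak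 j\mathcal M)_{\alpha\beta}+\phi^\sigma\mathcal V_{\alpha\beta\sigma}\\ &+\pi^{\bar\mu}_\alpha\pi^{\bar\nu}_\beta\phi^{\bar\sigma}\mathcal V_{\bar\mu\bar\nu\bar\sigma}+2i(\pi_{\alpha\tau}\mathcal C_\beta+\pi_{\beta\tau}\mathcal C_\alpha)\theta^\tau+2i(g_{\alpha\bar\tau}\pi^{\bar\sigma}_\beta\mathcal C_{\bar\sigma}+g_{\beta\bar\tau}\pi^{\bar\sigma}_\alpha\mathcal C_{\bar\sigma})\theta^{\bar\tau},\\ \tilde{\mathcal M}^\ast_{\alpha\beta}=&\ \pi^{\tau\sigma}\Gamma_{\sigma\alpha}\mathcal M_{\tau\beta}+\pi^{\tau\sigma}\Gamma_{\sigma\beta}\mathcal M_{\alpha\tau}+(2\varphi_0+i\varphi_1)\mathcal M_{\alpha\beta}-(\varphi_2-i\varphi_3)\mathcal L_{\alpha\beta}-2\pi^\sigma_{\bar\tau}\phi^{\bar\tau}\mathcal V_{\alpha\beta\sigma}\\ &-2(\pi_{\alpha\tau}\mathcal H_\beta+\pi_{\beta\tau}\mathcal H_\alpha)\theta^\tau+2i(g_{\alpha\bar\tau}\mathcal C_\beta+g_{\beta\bar\tau}\mathcal C_\alpha)\theta^{\bar\tau},\\ \tilde{\mathcal C}^\ast_\alpha=&\ \pi^{\tau\sigma}\Gamma_{\sigma\alpha}\mathcal C_\tau+\tfrac12(5\varphi_0+i\varphi_1)\mathcal C_\alpha-\pi^{\bar\sigma}_\alpha(\varphi_2-i\varphi_3)\mathcal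 C_{\bar\sigma}-2i\pi^\sigma_{\bar\tau}\phi^{\bar\tau}\mathcal L_{\alpha\sigma}+i\phi^\tau\mathcal M_{\alpha\tau}+\tfrac i2(\varphi_2+i\varphi_3)\mathcal H_\alpha\\ &-\tfrac12\pi_{\alpha\tau}\mathcal P\theta^\tau+\tfrac12g_{\alpha\bar\tau}\mathcal R\theta^{\bar\tau},\\ \tilde{\mathcal H}^\ast_\alpha=&\ \pi^{\tau\sigma}\Gamma_{\sigma\alpha}\mathcal H_\tau+\tfrac12(5\varphi_0+3i\varphi_1)\mathcal H_\alpha+\tfrac{3i}2(\varphi_2-i\varphi_3)\mathcal C_\alpha-3\pi^\sigma_{\bar\tau}\phi^{\bar\tau}\mathcal M_{\alpha\sigma}+\tfrac12\pi_{\alpha\tau}\mathcal Q\theta^\tau+\tfrac i2g_{\alpha\bar\tau}\mathcal P\theta^{\bar\tau},\\ \tilde{\mathcal R}^\ast=&\ 3\varphi_0\mathcal R-(\varphi_2+i\varphi_3)\mathcal P-(\varphi_2-i\varphi_3)\overline{\mathcal P}-8\phi^\tau\mathcal C_\tau-8\phi^{\bar\tau}\mathcal C_{\bar\tau},\\ \tilde{\mathcal P}^\ast=&\ (3\varphi_0+i\varphi_1)\mathcal P-\tfrac i2(\varphi_2+i\varphi_3)\mathcal Q+\tfrac32(\varphi_2-i\varphi_3)\mathcal R+4i\phi^\tau\mathcal H_\tau-12\pi_{\bar\tau\bar\sigma}\phi^{\bar\tau}\mathcal C^{\bar\sigma},\\ \tilde{\mathcal Q}^\ast=&\ (3\varphi_0+2i\varphi_1)\mathcal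 Q-2i(\varphi_2-i\varphi_3)\mathcal P+16\pi_{\bar\tau\bar\sigma}\phi^{\bar\tau}\mathcal H^{\bar\sigma}. \end{aligned}$$ *)

theory Defs
  imports "HOL-Analysis.Analysis" "HOL-Library.Function_Algebras"
begin

section \<open>Smooth manifolds, forms and exterior derivative\<close>

fun Ck_on :: "nat \<Rightarrow> ('a::real_normed_vector \<Rightarrow> 'b::real_normed_vector) \<Rightarrow> 'a set \<Rightarrow> bool" where
  "Ck_on 0 f S \<longleftrightarrow> continuous_on S f"
| "Ck_on (Suc k) f S \<longleftrightarrow> (\<forall>x\<in>S. f differentiable (at x)) \<and>
     (\<forall>v. Ck_on k (\<lambda>x. frechet_derivative f (at x) v) S)"

text \<open>Only used on open subsets of Euclidean spaces.\<close>

definition smooth_on :: "('a::real_normed_vector \<Rightarrow> 'b::real_normed_vector) \<Rightarrow> 'a set \<Rightarrow> bool" where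
  "smooth_on f S \<longleftrightarrow> (\<forall>k. Ck_on k f S)"

type_synonym ('x, 'v) chart = "'x set \<times> ('x \<Rightarrow> 'v)"
type_synonym ('x, 'v) form1 = "'x \<Rightarrow> 'v \<Rightarrow> complex"
type_synonym ('x, 'v) form2 = "'x \<Rightarrow> 'v \<Rightarrow> 'v \<Rightarrow> complex"
type_synonym ('x, 'v) form3 = "'x \<Rightarrow> 'v \<Rightarrow> 'v \<Rightarrow> 'v \<Rightarrow> complex"

definition cinv :: "('x, 'v) chart \<Rightarrow> 'v \<Rightarrow> 'x" where
  "cinv c = inv_into (fst c) (snd c)"

text \<open>A smooth atlas on the whole type \<open>'x\<close>, modelled on the Euclidean space \<open>'v\<close>.\<close>

definition smooth_manifold ::
    "('x::{t2_space, second_countable_topology}, 'v::euclidean_space) chart set \<Rightarrow> bool" where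
  "smooth_manifold X \<longleftrightarrow>
     (\<Union>c\<in>X. fst c) = UNIV \<and>
     (\<forall>c\<in>X. open (fst c) \<and> open (snd c ` fst c) \<and>
        homeomorphism (fst c) (snd c ` fst c) (snd c) (cinv c)) \<and>
     (\<forall>c\<in>X. \<forall>d\<in>X. smooth_on (snd d \<circ> cinv c) (snd c ` (fst c \<inter> fst d)))"

text \<open>
  The tangent space at \<open>p\<close> is identified with the model space \<open>'v\<close> by means of one chosen chart
  \<open>chart_at X p\<close> around \<open>p\<close>. So \<open>\<omega> p v\<close> is the value of the form \<open>\<omega>\<close> on the tangent vector at \<open>p\<close>
  with components \<open>v\<close> in \<open>chart_at X p\<close>. Since the chosen chart jumps with \<open>p\<close>, smoothness and
  differentiation refer to the representation of a form in a fixed chart (\<open>rep1\<close>, \<open>rep2\<close>).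
\<close>

definition chart_at :: "('x, 'v) chart set \<Rightarrow> 'x \<Rightarrow> ('x, 'v) chart" where
  "chart_at X p = (SOME c. c \<in> X \<and> p \<in> fst c)"

definition from_chart ::
    "('x, 'v::euclidean_space) chart set \<Rightarrow> ('x, 'v) chart \<Rightarrow> 'x \<Rightarrow> 'v \<Rightarrow> 'v" where
  "from_chart X c p = frechet_derivative (snd (chart_at X p) \<circ> cinv c) (at (snd c p))"

definition to_chart ::
    "('x, 'v::euclidean_space) chart set \<Rightarrow> ('x, 'v) chart \<Rightarrow> 'x \<Rightarrow> 'v \<Rightarrow> 'v" where
  "to_chart X c p = frechet_derivative (snd c \<circ> cinv (chart_at X p)) (at (snd (chart_at X p) p))"

definition rep1 :: "('x, 'v::euclidean_space) chart set \<Rightarrow> ('x, 'v) chart \<Rightarrow>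
    ('x \<Rightarrow> 'v \<Rightarrow> 'b) \<Rightarrow> 'v \<Rightarrow> 'v \<Rightarrow> 'b" where
  "rep1 X c \<omega> x v = (let p = cinv c x in \<omega> p (from_chart X c p v))"

definition rep2 :: "('x, 'v::euclidean_space) chart set \<Rightarrow> ('x, 'v) chart \<Rightarrow>
    ('x \<Rightarrow> 'v \<Rightarrow> 'v \<Rightarrow> 'b) \<Rightarrow> 'v \<Rightarrow> 'v \<Rightarrow> 'v \<Rightarrow> 'b" where
  "rep2 X c \<omega> x u v = (let p = cinv c x in \<omega> p (from_chart X c p u) (from_chart X c p v))"

definition smooth_fun :: "('x, 'v::euclidean_space) chart set \<Rightarrow> 'x set \<Rightarrow>
    ('x \<Rightarrow> 'b::real_normed_vector) \<Rightarrow> bool" where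
  "smooth_fun X W f \<longleftrightarrow> (\<forall>c\<in>X. smooth_on (f \<circ> cinv c) (snd c ` (fst c \<inter> W)))"

definition smooth_vfield :: "('x, 'v::euclidean_space) chart set \<Rightarrow> 'x set \<Rightarrow>
    ('x \<Rightarrow> 'v) \<Rightarrow> bool" where
  "smooth_vfield X W \<xi> \<longleftrightarrow>
     (\<forall>c\<in>X. smooth_on (\<lambda>x. to_chart X c (cinv c x) (\<xi> (cinv c x))) (snd c ` (fst c \<inter> W)))"

definition smooth_form1 :: "('x, 'v::euclidean_space) chart set \<Rightarrow> 'x set \<Rightarrow>
    ('x \<Rightarrow> 'v \<Rightarrow> 'b::real_normed_vector) \<Rightarrow> bool" where
  "smooth_form1 X W \<omega> \<longleftrightarrow> (\<forall>p\<in>W. linear (\<omega> p)) \<and>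
     (\<forall>c\<in>X. \<forall>v. smooth_on (\<lambda>x. rep1 X c \<omega> x v) (snd c ` (fst c \<inter> W)))"

definition smooth_map :: "('x::topological_space, 'v::euclidean_space) chart set \<Rightarrow>
    ('y::topological_space, 'w::euclidean_space) chart set \<Rightarrow> ('x \<Rightarrow> 'y) \<Rightarrow> bool" where
  "smooth_map X Y f \<longleftrightarrow> continuous_on UNIV f \<and>
     (\<forall>c\<in>X. \<forall>d\<in>Y. smooth_on (snd d \<circ> f \<circ> cinv c) (snd c ` (fst c \<inter> f -` fst d)))"

definition tangent_map :: "('x, 'v::euclidean_space) chart set \<Rightarrow>
    ('y, 'w::euclidean_space) chart set \<Rightarrow> ('x \<Rightarrow> 'y) \<Rightarrow> 'x \<Rightarrow> 'v \<Rightarrow> 'w" where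
  "tangent_map X Y f p = frechet_derivative (snd (chart_at Y (f p)) \<circ> f \<circ> cinv (chart_at X p))
     (at (snd (chart_at X p) p))"

definition pullback1 :: "('x, 'v::euclidean_space) chart set \<Rightarrow>
    ('y, 'w::euclidean_space) chart set \<Rightarrow> ('x \<Rightarrow> 'y) \<Rightarrow> ('y \<Rightarrow> 'w \<Rightarrow> 'b) \<Rightarrow> 'x \<Rightarrow> 'v \<Rightarrow> 'b" where
  "pullback1 X Y f \<omega> p v = \<omega> (f p) (tangent_map X Y f p v)"

text \<open>The exterior derivatives of functions, one-forms and two-forms and the exterior products of a
  one-form with a one-form (\<open>\<sqinter>\<^sub>1\<close>) and with a two-form (\<open>\<sqinter>\<^sub>2\<close>) are normalised without factors, so
  that a product of three one-forms is written \<open>a \<sqinter>\<^sub>2 b \<sqinter>\<^sub>1 c\<close> and has determinants as values.\<close>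

definition d0 :: "('x, 'v::euclidean_space) chart set \<Rightarrow> ('x \<Rightarrow> 'b::real_normed_vector) \<Rightarrow>
    'x \<Rightarrow> 'v \<Rightarrow> 'b" where
  "d0 X f p v = (let c = chart_at X p in frechet_derivative (f \<circ> cinv c) (at (snd c p)) v)"

definition d1 :: "('x, 'v::euclidean_space) chart set \<Rightarrow> ('x \<Rightarrow> 'v \<Rightarrow> 'b::real_normed_vector) \<Rightarrow>
    'x \<Rightarrow> 'v \<Rightarrow> 'v \<Rightarrow> 'b" where
  "d1 X \<omega> p u v = (let c = chart_at X p in
     frechet_derivative (\<lambda>x. rep1 X c \<omega> x v) (at (snd c p)) u
     - frechet_derivative (\<lambda>x. rep1 X c \<omega> x u) (at (snd c p)) v)"

definition d2 :: "('x, 'v::euclidean_space) chart set \<Rightarrow>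
    ('x \<Rightarrow> 'v \<Rightarrow> 'v \<Rightarrow> 'b::real_normed_vector) \<Rightarrow> 'x \<Rightarrow> 'v \<Rightarrow> 'v \<Rightarrow> 'v \<Rightarrow> 'b" where
  "d2 X \<omega> p u v w = (let c = chart_at X p in
     frechet_derivative (\<lambda>x. rep2 X c \<omega> x v w) (at (snd c p)) u
     - frechet_derivative (\<lambda>x. rep2 X c \<omega> x u w) (at (snd c p)) v
     + frechet_derivative (\<lambda>x. rep2 X c \<omega> x u v) (at (snd c p)) w)"

definition wedge :: "('x, 'v) form1 \<Rightarrow> ('x, 'v) form1 \<Rightarrow> ('x, 'v) form2"
    (infixr "\<sqinter>\<^sub>1" 70) where
  "(a \<sqinter>\<^sub>1 b) p u v = a p u * b p v - a p v * b p u"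

definition wedge3 :: "('x, 'v) form1 \<Rightarrow> ('x, 'v) form2 \<Rightarrow> ('x, 'v) form3"
    (infixr "\<sqinter>\<^sub>2" 70) where
  "(a \<sqinter>\<^sub>2 B) p u v w = a p u * B p v w - a p v * B p u w + a p w * B p u v"

definition cscale :: "complex \<Rightarrow> ('x, 'v) form1 \<Rightarrow> ('x, 'v) form1" (infixr "\<cdot>" 75) where
  "(z \<cdot> \<omega>) p v = z * \<omega> p v"

definition fscale :: "('x \<Rightarrow> complex) \<Rightarrow> ('x, 'v) form1 \<Rightarrow> ('x, 'v) form1" (infixr "\<odot>" 75) where
  "(f \<odot> \<omega>) p v = f p * \<omega> p v"

definition cj :: "('x, 'v) form1 \<Rightarrow> ('x, 'v) form1" where
  "cj \<omega> p v = cnj (\<omega> p v)"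

definition real_form :: "'x set \<Rightarrow> ('x, 'v) form1 \<Rightarrow> bool" where
  "real_form W \<omega> \<longleftrightarrow> (\<forall>p\<in>W. \<forall>v. \<omega> p v \<in> \<real>)"

text \<open>Summation over all values of the indices; all index types are finite.\<close>

abbreviation index_sum :: "('i \<Rightarrow> 'b::comm_monoid_add) \<Rightarrow> 'b" (binder "\<Sum>\<^sub>*" 10) where
  "index_sum f \<equiv> sum f UNIV"


section \<open>The constant arrays\<close>

text \<open>
  With \<open>CARD('n) = n\<close>, small Greek indices range over \<open>'n + 'n\<close>: \<open>Inl i\<close> stands for \<open>\<alpha> \<le> n\<close>, and
  \<open>Inr i\<close> for \<open>\<alpha> + n\<close>. Indices \<open>s, t\<close> range over the type \<open>3\<close>, with elements \<open>1, 2, 3\<close>. A barred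
  array is always written as the complex conjugate of the unbarred one.
\<close>

definition sign_constants :: "('n::finite + 'n \<Rightarrow> real) \<Rightarrow> bool" where
  "sign_constants \<epsilon> \<longleftrightarrow> (\<forall>\<alpha>. \<epsilon> \<alpha> \<in> {1, -1}) \<and> (\<forall>i. \<epsilon> (Inr i) = \<epsilon> (Inl i))"

record ('x, 'v, 'i) adapted =
  eta :: "3 \<Rightarrow> ('x, 'v) form1"
  theta :: "'i \<Rightarrow> ('x, 'v) form1"
  varphi0 :: "('x, 'v) form1"
  varphi :: "3 \<Rightarrow> ('x, 'v) form1"

text \<open>\<open>phi F \<alpha>\<close> is the form with upper index \<open>\<alpha>\<close>.\<close>

record ('x, 'v, 'i) canonical = "('x, 'v, 'i) adapted" +
  Gam :: "'i \<Rightarrow> 'i \<Rightarrow> ('x, 'v) form1"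
  phi :: "'i \<Rightarrow> ('x, 'v) form1"
  psi :: "3 \<Rightarrow> ('x, 'v) form1"

record ('x, 'i) curvature =
  cS :: "'i \<Rightarrow> 'i \<Rightarrow> 'i \<Rightarrow> 'i \<Rightarrow> 'x \<Rightarrow> complex"
  cV :: "'i \<Rightarrow> 'i \<Rightarrow> 'i \<Rightarrow> 'x \<Rightarrow> complex"
  cL :: "'i \<Rightarrow> 'i \<Rightarrow> 'x \<Rightarrow> complex"
  cM :: "'i \<Rightarrow> 'i \<Rightarrow> 'x \<Rightarrow> complex"
  cC :: "'i \<Rightarrow> 'x \<Rightarrow> complex"
  cH :: "'i \<Rightarrow> 'x \<Rightarrow> complex"
  cP :: "'x \<Rightarrow> complex"
  cQ :: "'x \<Rightarrow> complex"
  cR :: "'x \<Rightarrow> complex"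

definition etap :: "('x, 'v, 'i, 'z) adapted_scheme \<Rightarrow> ('x, 'v) form1" where
  "etap F = eta F 2 + \<i> \<cdot> eta F 3"

definition etam :: "('x, 'v, 'i, 'z) adapted_scheme \<Rightarrow> ('x, 'v) form1" where
  "etam F = eta F 2 - \<i> \<cdot> eta F 3"

abbreviation thetab :: "('x, 'v, 'i, 'z) adapted_scheme \<Rightarrow> 'i \<Rightarrow> ('x, 'v) form1" where
  "thetab F \<alpha> \<equiv> cj (theta F \<alpha>)"

abbreviation phib :: "('x, 'v, 'i, 'z) canonical_scheme \<Rightarrow> 'i \<Rightarrow> ('x, 'v) form1" where
  "phib F \<alpha> \<equiv> cj (phi F \<alpha>)"

abbreviation Gamb :: "('x, 'v, 'i, 'z) canonical_scheme \<Rightarrow> 'i \<Rightarrow> 'i \<Rightarrow> ('x, 'v) form1" where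
  "Gamb F \<alpha> \<beta> \<equiv> cj (Gam F \<alpha> \<beta>)"

context
  fixes \<epsilon> :: "'n::finite + 'n \<Rightarrow> real"
begin

text \<open>\<open>gl \<alpha> \<beta>\<close> and \<open>gu \<alpha> \<beta>\<close>: the metric with lower, respectively upper, indices \<open>\<alpha>\<close>, barred \<open>\<beta>\<close>.\<close>

definition gl :: "'n + 'n \<Rightarrow> 'n + 'n \<Rightarrow> complex" where
  "gl \<alpha> \<beta> = (if \<alpha> = \<beta> then of_real (\<epsilon> \<alpha>) else 0)"

definition gu :: "'n + 'n \<Rightarrow> 'n + 'n \<Rightarrow> complex" where
  "gu \<alpha> \<beta> = (if \<alpha> = \<beta> then inverse (of_real (\<epsilon> \<alpha>)) else 0)"

text \<open>\<open>pdd \<alpha> \<beta>\<close>: both indices lower and unbarred.\<close>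

definition pdd :: "'n + 'n \<Rightarrow> 'n + 'n \<Rightarrow> complex" where
  "pdd \<alpha> \<beta> = (case (\<alpha>, \<beta>) of
      (Inl i, Inr j) \<Rightarrow> if j = i then of_real (\<epsilon> \<alpha>) else 0
    | (Inr i, Inl j) \<Rightarrow> if i = j then - of_real (\<epsilon> \<alpha>) else 0
    | _ \<Rightarrow> 0)"

text \<open>\<open>pbd \<sigma> \<alpha>\<close>: upper barred \<open>\<sigma>\<close>, lower unbarred \<open>\<alpha>\<close>; \<open>pub \<sigma> \<alpha>\<close>: upper unbarred \<open>\<sigma>\<close>, lower
  barred \<open>\<alpha>\<close>; \<open>puu \<alpha> \<beta>\<close>: both indices upper and unbarred.\<close>

definition pbd :: "'n + 'n \<Rightarrow> 'n + 'n \<Rightarrow> complex" where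
  "pbd \<sigma> \<alpha> = (\<Sum>\<^sub>*\<tau>. gu \<tau> \<sigma> * pdd \<alpha> \<tau>)"

definition pub :: "'n + 'n \<Rightarrow> 'n + 'n \<Rightarrow> complex" where
  "pub \<sigma> \<alpha> = cnj (pbd \<sigma> \<alpha>)"

definition puu :: "'n + 'n \<Rightarrow> 'n + 'n \<Rightarrow> complex" where
  "puu \<alpha> \<beta> = (\<Sum>\<^sub>*\<sigma> \<tau>. gu \<alpha> \<sigma> * gu \<beta> \<tau> * cnj (pdd \<sigma> \<tau>))"

text \<open>\<open>Sp(n)\<close>; here \<open>U \<alpha> \<beta>\<close> has \<open>\<alpha>\<close> as upper and \<open>\<beta>\<close> as lower index.\<close>

definition Sp :: "('n + 'n \<Rightarrow> 'n + 'n \<Rightarrow> complex) set" where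
  "Sp = {U. (\<forall>\<alpha> \<beta>. (\<Sum>\<^sub>*\<sigma> \<tau>. gl \<sigma> \<tau> * U \<sigma> \<alpha> * cnj (U \<tau> \<beta>)) = gl \<alpha> \<beta>) \<and>
            (\<forall>\<alpha> \<beta>. (\<Sum>\<^sub>*\<sigma> \<tau>. pdd \<sigma> \<tau> * U \<sigma> \<alpha> * U \<tau> \<beta>) = pdd \<alpha> \<beta>)}"

definition j2 :: "('n + 'n \<Rightarrow> 'n + 'n \<Rightarrow> 'x \<Rightarrow> complex) \<Rightarrow> 'n + 'n \<Rightarrow> 'n + 'n \<Rightarrow> 'x \<Rightarrow> complex" where
  "j2 T \<alpha> \<beta> p = (\<Sum>\<^sub>*\<mu> \<nu>. pbd \<mu> \<alpha> * pbd \<nu> \<beta> * cnj (T \<mu> \<nu> p))"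

definition j3 :: "('n + 'n \<Rightarrow> 'n + 'n \<Rightarrow> 'n + 'n \<Rightarrow> 'x \<Rightarrow> complex) \<Rightarrow>
    'n + 'n \<Rightarrow> 'n + 'n \<Rightarrow> 'n + 'n \<Rightarrow> 'x \<Rightarrow> complex" where
  "j3 T \<alpha> \<beta> \<gamma> p = (\<Sum>\<^sub>*\<mu> \<nu> \<xi>. pbd \<mu> \<alpha> * pbd \<nu> \<beta> * pbd \<xi> \<gamma> * cnj (T \<mu> \<nu> \<xi> p))"

definition j4 :: "('n + 'n \<Rightarrow> 'n + 'n \<Rightarrow> 'n + 'n \<Rightarrow> 'n + 'n \<Rightarrow> 'x \<Rightarrow> complex) \<Rightarrow>
    'n + 'n \<Rightarrow> 'n + 'n \<Rightarrow> 'n + 'n \<Rightarrow> 'n + 'n \<Rightarrow> 'x \<Rightarrow> complex" where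
  "j4 T \<alpha> \<beta> \<gamma> \<delta> p =
     (\<Sum>\<^sub>*\<mu> \<nu> \<xi> \<zeta>. pbd \<mu> \<alpha> * pbd \<nu> \<beta> * pbd \<xi> \<gamma> * pbd \<zeta> \<delta> * cnj (T \<mu> \<nu> \<xi> \<zeta> p))"

text \<open>Lowered and raised indices: \<open>phil\<close>, \<open>thl\<close> have a lower unbarred index, \<open>Cup\<close> an upper unbarred
  and \<open>Hupb\<close> an upper barred one.\<close>

definition phil :: "('x, 'v, 'n + 'n, 'z) canonical_scheme \<Rightarrow> 'n + 'n \<Rightarrow> ('x, 'v) form1" where
  "phil F \<alpha> = (\<Sum>\<^sub>*\<sigma>. gl \<alpha> \<sigma> \<cdot> phib F \<sigma>)"

definition thl :: "('x, 'v, 'n + 'n, 'z) adapted_scheme \<Rightarrow> 'n + 'n \<Rightarrow> ('x, 'v) form1" where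
  "thl F \<alpha> = (\<Sum>\<^sub>*\<sigma>. gl \<alpha> \<sigma> \<cdot> thetab F \<sigma>)"

definition Cup :: "('x, 'n + 'n) curvature \<Rightarrow> 'n + 'n \<Rightarrow> 'x \<Rightarrow> complex" where
  "Cup K \<alpha> p = (\<Sum>\<^sub>*\<sigma>. gu \<alpha> \<sigma> * cnj (cC K \<sigma> p))"

definition Hupb :: "('x, 'n + 'n) curvature \<Rightarrow> 'n + 'n \<Rightarrow> 'x \<Rightarrow> complex" where
  "Hupb K \<alpha> p = (\<Sum>\<^sub>*\<sigma>. gu \<sigma> \<alpha> * cH K \<sigma> p)"


section \<open>Quaternionic contact manifolds\<close>

text \<open>
  \<open>g p\<close> and \<open>I s p\<close> matter only on \<open>H p\<close>. Their smoothness need not be required, since they are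
  determined algebraically by the restrictions of the \<open>d\<eta>\<^sub>s\<close> to \<open>H\<close>. The family \<open>e\<close> is an orthonormal
  basis of \<open>H p\<close> that contains two vectors of sign \<open>\<epsilon> \<alpha>\<close> for each \<open>\<alpha>\<close>, one for the real and
  one for the imaginary part of a complex coordinate.
\<close>

definition qc_triple :: "('m::{t2_space, second_countable_topology}, 'e::euclidean_space) chart set \<Rightarrow>
    ('m \<Rightarrow> 'e set) \<Rightarrow> 'm set \<Rightarrow> (3 \<Rightarrow> 'm \<Rightarrow> 'e \<Rightarrow> real) \<Rightarrow> bool" where
  "qc_triple A H V \<eta> \<longleftrightarrow> open V \<and> (\<forall>s. smooth_form1 A V (\<eta> s)) \<and>
     (\<forall>p\<in>V. H p = {v. \<forall>s. \<eta> s p v = 0}) \<and>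
     (\<exists>(g :: 'm \<Rightarrow> 'e \<Rightarrow> 'e \<Rightarrow> real) (I :: 3 \<Rightarrow> 'm \<Rightarrow> 'e \<Rightarrow> 'e). \<forall>p\<in>V.
        bilinear (g p) \<and> (\<forall>x\<in>H p. \<forall>y\<in>H p. g p x y = g p y x) \<and>
        (\<forall>x\<in>H p. (\<forall>y\<in>H p. g p x y = 0) \<longrightarrow> x = 0) \<and>
        (\<exists>e :: 'n + 'n \<Rightarrow> bool \<Rightarrow> 'e. (\<forall>\<alpha> k. e \<alpha> k \<in> H p) \<and>
           (\<forall>\<alpha> \<beta> k l. g p (e \<alpha> k) (e \<beta> l) = (if \<alpha> = \<beta> \<and> k = l then \<epsilon> \<alpha> else 0)) \<and>
           span (range (\<lambda>(\<alpha>, k). e \<alpha> k)) = H p) \<and>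
        (\<forall>s. linear (I s p) \<and> I s p ` H p \<subseteq> H p \<and> (\<forall>x\<in>H p. I s p (I s p x) = - x)) \<and>
        (\<forall>x\<in>H p. I 1 p (I 2 p x) = I 3 p x \<and> I 2 p (I 1 p x) = - I 3 p x) \<and>
        (\<forall>s. \<forall>x\<in>H p. \<forall>y\<in>H p. d1 A (\<eta> s) p x y = 2 * g p (I s p x) y))"

definition has_Reeb :: "('m::{t2_space, second_countable_topology}, 'e::euclidean_space) chart set \<Rightarrow>
    ('m \<Rightarrow> 'e set) \<Rightarrow> 'm set \<Rightarrow> (3 \<Rightarrow> 'm \<Rightarrow> 'e \<Rightarrow> real) \<Rightarrow> bool" where
  "has_Reeb A H V \<eta> \<longleftrightarrow> (\<exists>\<xi> :: 3 \<Rightarrow> 'm \<Rightarrow> 'e. (\<forall>s. smooth_vfield A V (\<xi> s)) \<and>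
     (\<forall>p\<in>V. \<forall>s t. \<eta> s p (\<xi> t p) = (if s = t then 1 else 0) \<and>
        (\<forall>x\<in>H p. d1 A (\<eta> s) p (\<xi> t p) x = - d1 A (\<eta> t) p (\<xi> s p) x)))"

definition related_triples :: "('m::{t2_space, second_countable_topology}, 'e::euclidean_space) chart set \<Rightarrow>
    'm set \<times> (3 \<Rightarrow> 'm \<Rightarrow> 'e \<Rightarrow> real) \<Rightarrow> 'm set \<times> (3 \<Rightarrow> 'm \<Rightarrow> 'e \<Rightarrow> real) \<Rightarrow> bool" where
  "related_triples A S T \<longleftrightarrow> (\<exists>(\<mu> :: 'm \<Rightarrow> real) (a :: 'm \<Rightarrow> real^3^3).
     smooth_fun A (fst S \<inter> fst T) \<mu> \<and> smooth_fun A (fst S \<inter> fst T) a \<and>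
     (\<forall>p\<in>fst S \<inter> fst T. \<mu> p > 0 \<and> rotation_matrix (a p) \<and>
        (\<forall>s v. snd T s p v = \<mu> p * (\<Sum>\<^sub>*t. a p $ t $ s * snd S t p v))))"

text \<open>
  \<open>\<T>\<close> is the maximal class of mutually related local triples that defines the bundle \<open>P\<^sub>o\<close>. If
  \<open>\<epsilon> = 1\<close>, any two local triples are related, so that \<open>\<T>\<close> consists of all of them and is determined
  by \<open>H\<close>; in indefinite signature it is a choice.
\<close>

definition qc_manifold :: "('m::{t2_space, second_countable_topology}, 'e::euclidean_space) chart set \<Rightarrow>
    ('m \<Rightarrow> 'e set) \<Rightarrow> ('m set \<times> (3 \<Rightarrow> 'm \<Rightarrow> 'e \<Rightarrow> real)) set \<Rightarrow> bool" where
  "qc_manifold A H \<T> \<longleftrightarrow> smooth_manifold A \<and> DIM('e) = 4 * CARD('n) + 3 \<and>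
     (\<forall>p. subspace (H p) \<and> dim (H p) + 3 = DIM('e)) \<and>
     (\<forall>T\<in>\<T>. qc_triple A H (fst T) (snd T) \<and> has_Reeb A H (fst T) (snd T)) \<and>
     (\<Union>T\<in>\<T>. fst T) = UNIV \<and>
     (\<forall>S\<in>\<T>. \<forall>T\<in>\<T>. related_triples A S T) \<and>
     (\<forall>T. qc_triple A H (fst T) (snd T) \<and> has_Reeb A H (fst T) (snd T) \<and>
          (\<forall>S\<in>\<T>. related_triples A S T) \<longrightarrow> T \<in> \<T>)"


section \<open>The bundles \<open>P\<^sub>o\<close> and \<open>P\<^sub>1\<close>\<close>

text \<open>
  \<open>P\<^sub>o\<close> is described by its local trivialisations: every local triple of the class identifies
  \<open>\<pi>\<^sub>o -` V\<close> diffeomorphically (bijectively, smoothly, and with injective differential between equal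
  dimensions) with the product of \<open>V\<close>, the positive reals and \<open>SO(3)\<close>, in such a way that the
  tautological forms are given by the formula for the change of triples. These formulas force
  the transition functions to be left translations, so this is a principal bundle.
\<close>

definition Po_bundle :: "('m::{t2_space, second_countable_topology}, 'e::euclidean_space) chart set \<Rightarrow>
    ('m set \<times> (3 \<Rightarrow> 'm \<Rightarrow> 'e \<Rightarrow> real)) set \<Rightarrow>
    ('p::{t2_space, second_countable_topology}, 'f::euclidean_space) chart set \<Rightarrow>
    ('p \<Rightarrow> 'm) \<Rightarrow> (3 \<Rightarrow> ('p, 'f) form1) \<Rightarrow> bool" where
  "Po_bundle A \<T> B \<pi>\<^sub>o \<eta> \<longleftrightarrow> smooth_manifold B \<and> DIM('f) = DIM('e) + 4 \<and> smooth_map B A \<pi>\<^sub>o \<and>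
     (\<forall>s. smooth_form1 B UNIV (\<eta> s)) \<and>
     (\<forall>(V, \<eta>')\<in>\<T>. \<exists>(\<mu> :: 'p \<Rightarrow> real) (a :: 'p \<Rightarrow> real^3^3).
        smooth_fun B (\<pi>\<^sub>o -` V) \<mu> \<and> smooth_fun B (\<pi>\<^sub>o -` V) a \<and>
        bij_betw (\<lambda>q. (\<pi>\<^sub>o q, \<mu> q, a q)) (\<pi>\<^sub>o -` V) (V \<times> {0<..} \<times> {b. rotation_matrix b}) \<and>
        (\<forall>q\<in>\<pi>\<^sub>o -` V.
           (\<forall>v. tangent_map B A \<pi>\<^sub>o q v = 0 \<and> d0 B \<mu> q v = 0 \<and> d0 B a q v = 0 \<longrightarrow> v = 0) \<and>
           (\<forall>s v. \<eta> s q v =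
              of_real (\<mu> q * (\<Sum>\<^sub>*t. a q $ t $ s * pullback1 B A \<pi>\<^sub>o (\<eta>' t) q v)))))"

definition SE1 :: "('x, 'v, 'n + 'n, 'z) adapted_scheme \<Rightarrow> ('x, 'v) form2" where
  "SE1 F = - (varphi0 F \<sqinter>\<^sub>1 eta F 1) - (varphi F 2 \<sqinter>\<^sub>1 eta F 3) + (varphi F 3 \<sqinter>\<^sub>1 eta F 2)
     + (\<Sum>\<^sub>*\<alpha> \<beta>. (2 * \<i> * gl \<alpha> \<beta>) \<cdot> theta F \<alpha> \<sqinter>\<^sub>1 thetab F \<beta>)"

definition SE2 :: "('x, 'v, 'n + 'n, 'z) adapted_scheme \<Rightarrow> ('x, 'v) form2" where
  "SE2 F = - (varphi0 F \<sqinter>\<^sub>1 eta F 2) - (varphi F 3 \<sqinter>\<^sub>1 eta F 1) + (varphi F 1 \<sqinter>\<^sub>1 eta F 3)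
     + (\<Sum>\<^sub>*\<alpha> \<beta>. pdd \<alpha> \<beta> \<cdot> theta F \<alpha> \<sqinter>\<^sub>1 theta F \<beta>)
     + (\<Sum>\<^sub>*\<alpha> \<beta>. cnj (pdd \<alpha> \<beta>) \<cdot> thetab F \<alpha> \<sqinter>\<^sub>1 thetab F \<beta>)"

definition SE3 :: "('x, 'v, 'n + 'n, 'z) adapted_scheme \<Rightarrow> ('x, 'v) form2" where
  "SE3 F = - (varphi0 F \<sqinter>\<^sub>1 eta F 3) - (varphi F 1 \<sqinter>\<^sub>1 eta F 2) + (varphi F 2 \<sqinter>\<^sub>1 eta F 1)
     - (\<Sum>\<^sub>*\<alpha> \<beta>. (\<i> * pdd \<alpha> \<beta>) \<cdot> theta F \<alpha> \<sqinter>\<^sub>1 theta F \<beta>)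
     + (\<Sum>\<^sub>*\<alpha> \<beta>. (\<i> * cnj (pdd \<alpha> \<beta>)) \<cdot> thetab F \<alpha> \<sqinter>\<^sub>1 thetab F \<beta>)"

definition SE :: "('x, 'v::euclidean_space) chart set \<Rightarrow> 'x set \<Rightarrow>
    ('x, 'v, 'n + 'n, 'z) adapted_scheme \<Rightarrow> bool" where
  "SE X W F \<longleftrightarrow> (\<forall>p\<in>W. d1 X (eta F 1) p = SE1 F p \<and> d1 X (eta F 2) p = SE2 F p \<and>
     d1 X (eta F 3) p = SE3 F p)"

text \<open>The forms of \<open>F\<close> and the conjugates of the \<open>\<theta>\<^sup>\<alpha>\<close> are a complex basis, at \<open>p\<close>, of the dual of the
  complexified tangent space, i.e. of the real-linear maps from the tangent space to \<open>complex\<close>.\<close>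

definition coframe_at :: "'x \<Rightarrow> ('x, 'v::euclidean_space, 'n + 'n) adapted \<Rightarrow> bool" where
  "coframe_at p F \<longleftrightarrow>
     (let comb = \<lambda>a b b' c\<^sub>0 c v. (\<Sum>\<^sub>*s. a s * eta F s p v) + (\<Sum>\<^sub>*\<alpha>. b \<alpha> * theta F \<alpha> p v)
            + (\<Sum>\<^sub>*\<alpha>. b' \<alpha> * thetab F \<alpha> p v) + c\<^sub>0 * varphi0 F p v + (\<Sum>\<^sub>*s. c s * varphi F s p v)
      in (\<forall>a b b' c\<^sub>0 c. (\<forall>v. comb a b b' c\<^sub>0 c v = 0) \<longrightarrow>
            (\<forall>s. a s = 0) \<and> (\<forall>\<alpha>. b \<alpha> = 0) \<and> (\<forall>\<alpha>. b' \<alpha> = 0) \<and> c\<^sub>0 = 0 \<and> (\<forall>s. c s = 0)) \<and>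
         (\<forall>L :: 'v \<Rightarrow> complex. linear L \<longrightarrow> (\<exists>a b b' c\<^sub>0 c. \<forall>v. L v = comb a b b' c\<^sub>0 c v)))"

definition admissible_coframing ::
    "('m::{t2_space, second_countable_topology}, 'e::euclidean_space) chart set \<Rightarrow>
     ('p::{t2_space, second_countable_topology}, 'f::euclidean_space) chart set \<Rightarrow>
     ('p \<Rightarrow> 'm) \<Rightarrow> (3 \<Rightarrow> ('p, 'f) form1) \<Rightarrow> 'p set \<Rightarrow> ('p, 'f, 'n + 'n) adapted \<Rightarrow> bool" where
  "admissible_coframing A B \<pi>\<^sub>o \<eta> W F \<longleftrightarrow> open W \<and> eta F = \<eta> \<and>
     (\<forall>\<alpha>. smooth_form1 B W (theta F \<alpha>)) \<and>
     smooth_form1 B W (varphi0 F) \<and> (\<forall>s. smooth_form1 B W (varphi F s)) \<and>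
     real_form W (varphi0 F) \<and> (\<forall>s. real_form W (varphi F s)) \<and>
     (\<forall>q\<in>W. \<forall>\<alpha> v. tangent_map B A \<pi>\<^sub>o q v = 0 \<longrightarrow> theta F \<alpha> q v = 0) \<and>
     (\<forall>q\<in>W. coframe_at q F) \<and>
     SE B W F"

definition pullback_adapted :: "('x, 'v::euclidean_space) chart set \<Rightarrow>
    ('y, 'w::euclidean_space) chart set \<Rightarrow> ('x \<Rightarrow> 'y) \<Rightarrow>
    ('y, 'w, 'n + 'n) adapted \<Rightarrow> ('x, 'v, 'n + 'n) adapted" where
  "pullback_adapted X Y f F =
     \<lparr> eta = \<lambda>s. pullback1 X Y f (eta F s), theta = \<lambda>\<alpha>. pullback1 X Y f (theta F \<alpha>),
       varphi0 = pullback1 X Y f (varphi0 F), varphi = \<lambda>s. pullback1 X Y f (varphi F s) \<rparr>"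

text \<open>The change of admissible coframing with parameters \<open>U\<close>, \<open>r\<close>, \<open>l\<close>; \<open>Ulow\<close> is \<open>U\<close> with its upper
  index lowered to a barred second index, \<open>rsq\<close> is \<open>r\<^sub>\<sigma> r\<^sup>\<sigma>\<close>.\<close>

definition Ulow :: "('n + 'n \<Rightarrow> 'n + 'n \<Rightarrow> complex) \<Rightarrow> 'n + 'n \<Rightarrow> 'n + 'n \<Rightarrow> complex" where
  "Ulow U \<beta> \<sigma> = (\<Sum>\<^sub>*\<alpha>. gl \<alpha> \<sigma> * U \<alpha> \<beta>)"

definition rsq :: "('n + 'n \<Rightarrow> complex) \<Rightarrow> complex" where
  "rsq r = (\<Sum>\<^sub>*\<sigma> \<tau>. gl \<sigma> \<tau> * cnj (r \<tau>) * r \<sigma>)"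

definition transform :: "('x \<Rightarrow> 'n + 'n \<Rightarrow> 'n + 'n \<Rightarrow> complex) \<Rightarrow> ('x \<Rightarrow> 'n + 'n \<Rightarrow> complex) \<Rightarrow>
    ('x \<Rightarrow> 3 \<Rightarrow> real) \<Rightarrow> ('x, 'v, 'n + 'n) adapted \<Rightarrow> ('x, 'v, 'n + 'n) adapted" where
  "transform U r l F =
     \<lparr> eta = eta F,
       theta = (\<lambda>\<alpha>. (\<Sum>\<^sub>*\<beta>. (\<lambda>p. U p \<alpha> \<beta>) \<odot> theta F \<beta>) + (\<lambda>p. \<i> * r p \<alpha>) \<odot> eta F 1
         + (\<Sum>\<^sub>*\<sigma>. (\<lambda>p. pub \<alpha> \<sigma> * cnj (r p \<sigma>)) \<odot> (eta F 2 + \<i> \<cdot> eta F 3))),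
       varphi0 = varphi0 F
         + (\<Sum>\<^sub>*\<beta> \<sigma>. (\<lambda>p. 2 * Ulow (U p) \<beta> \<sigma> * cnj (r p \<sigma>)) \<odot> theta F \<beta>)
         + (\<Sum>\<^sub>*\<beta> \<sigma>. (\<lambda>p. 2 * cnj (Ulow (U p) \<beta> \<sigma>) * r p \<sigma>) \<odot> thetab F \<beta>)
         + (\<Sum>\<^sub>*s. (\<lambda>p. of_real (l p s)) \<odot> eta F s),
       varphi = (\<lambda>s.
         if s = 1 then varphi F 1
           - (\<Sum>\<^sub>*\<beta> \<sigma>. (\<lambda>p. 2 * \<i> * Ulow (U p) \<beta> \<sigma> * cnj (r p \<sigma>)) \<odot> theta F \<beta>)
           + (\<Sum>\<^sub>*\<beta> \<sigma>. (\<lambda>p. 2 * \<i> * cnj (Ulow (U p) \<beta> \<sigma>) * r p \<sigma>) \<odot> thetab F \<beta>)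
           + (\<lambda>p. 2 * rsq (r p)) \<odot> eta F 1
           - (\<lambda>p. of_real (l p 3)) \<odot> eta F 2 + (\<lambda>p. of_real (l p 2)) \<odot> eta F 3
         else if s = 2 then varphi F 2
           - (\<Sum>\<^sub>*\<beta> \<sigma> \<tau>. (\<lambda>p. 2 * pdd \<sigma> \<tau> * U p \<sigma> \<beta> * r p \<tau>) \<odot> theta F \<beta>)
           - (\<Sum>\<^sub>*\<beta> \<sigma> \<tau>. (\<lambda>p. 2 * cnj (pdd \<sigma> \<tau>) * cnj (U p \<sigma> \<beta>) * cnj (r p \<tau>)) \<odot> thetab F \<beta>)
           + (\<lambda>p. of_real (l p 3)) \<odot> eta F 1
           + (\<lambda>p. 2 * rsq (r p)) \<odot> eta F 2 - (\<lambda>p. of_real (l p 1)) \<odot> eta F 3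
         else varphi F 3
           + (\<Sum>\<^sub>*\<beta> \<sigma> \<tau>. (\<lambda>p. 2 * \<i> * pdd \<sigma> \<tau> * U p \<sigma> \<beta> * r p \<tau>) \<odot> theta F \<beta>)
           - (\<Sum>\<^sub>*\<beta> \<sigma> \<tau>. (\<lambda>p. 2 * \<i> * cnj (pdd \<sigma> \<tau>) * cnj (U p \<sigma> \<beta>) * cnj (r p \<tau>)) \<odot> thetab F \<beta>)
           - (\<lambda>p. of_real (l p 2)) \<odot> eta F 1 + (\<lambda>p. of_real (l p 1)) \<odot> eta F 2
           + (\<lambda>p. 2 * rsq (r p)) \<odot> eta F 3) \<rparr>"

text \<open>
  \<open>P\<^sub>1\<close> is described in the same way: admissible coframings exist near each point of \<open>P\<^sub>o\<close>, and each of
  them, say \<open>E\<close> on \<open>W\<close>, identifies \<open>\<pi>\<^sub>1 -` W\<close> with the product of \<open>W\<close> and the parameters \<open>(U, r, l)\<close>, the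
  point with these parameters being the coframe obtained from \<open>E\<close> by the change of coframing,
  whose components are the values of the tautological forms. \<open>SE C UNIV F\<close> records the
  resulting structure equations of the tautological forms.
\<close>

definition P1_bundle :: "('m::{t2_space, second_countable_topology}, 'e::euclidean_space) chart set \<Rightarrow>
    ('p::{t2_space, second_countable_topology}, 'f::euclidean_space) chart set \<Rightarrow>
    ('p \<Rightarrow> 'm) \<Rightarrow> (3 \<Rightarrow> ('p, 'f) form1) \<Rightarrow>
    ('q::{t2_space, second_countable_topology}, 'h::euclidean_space) chart set \<Rightarrow>
    ('q \<Rightarrow> 'p) \<Rightarrow> ('q, 'h, 'n + 'n, 'z) adapted_scheme \<Rightarrow> bool" where
  "P1_bundle A B \<pi>\<^sub>o \<eta> C \<pi>\<^sub>1 F \<longleftrightarrow> smooth_manifold C \<and>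
     DIM('h) = DIM('f) + CARD('n) * (2 * CARD('n) + 1) + 4 * CARD('n) + 3 \<and>
     smooth_map C B \<pi>\<^sub>1 \<and>
     (\<forall>s. smooth_form1 C UNIV (eta F s)) \<and> (\<forall>\<alpha>. smooth_form1 C UNIV (theta F \<alpha>)) \<and>
     smooth_form1 C UNIV (varphi0 F) \<and> (\<forall>s. smooth_form1 C UNIV (varphi F s)) \<and>
     (\<forall>q. \<exists>W E. q \<in> W \<and> admissible_coframing A B \<pi>\<^sub>o \<eta> W E) \<and>
     (\<forall>W E. admissible_coframing A B \<pi>\<^sub>o \<eta> W E \<longrightarrow>
        (\<exists>(U :: 'q \<Rightarrow> 'n + 'n \<Rightarrow> 'n + 'n \<Rightarrow> complex) (r :: 'q \<Rightarrow> 'n + 'n \<Rightarrow> complex)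
            (l :: 'q \<Rightarrow> 3 \<Rightarrow> real).
           (\<forall>\<alpha> \<beta>. smooth_fun C (\<pi>\<^sub>1 -` W) (\<lambda>e. U e \<alpha> \<beta>)) \<and>
           (\<forall>\<alpha>. smooth_fun C (\<pi>\<^sub>1 -` W) (\<lambda>e. r e \<alpha>)) \<and>
           (\<forall>s. smooth_fun C (\<pi>\<^sub>1 -` W) (\<lambda>e. l e s)) \<and>
           bij_betw (\<lambda>e. (\<pi>\<^sub>1 e, U e, r e, l e)) (\<pi>\<^sub>1 -` W) (W \<times> Sp \<times> UNIV \<times> UNIV) \<and>
           (\<forall>e\<in>\<pi>\<^sub>1 -` W.
              (\<forall>v. tangent_map C B \<pi>\<^sub>1 e v = 0 \<and> (\<forall>\<alpha> \<beta>. d0 C (\<lambda>e. U e \<alpha> \<beta>) e v = 0) \<and>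
                 (\<forall>\<alpha>. d0 C (\<lambda>e. r e \<alpha>) e v = 0) \<and> (\<forall>s. d0 C (\<lambda>e. l e s) e v = 0) \<longrightarrow> v = 0) \<and>
              (let E' = transform U r l (pullback_adapted C B \<pi>\<^sub>1 E) in
                 (\<forall>s. eta F s e = eta E' s e) \<and> (\<forall>\<alpha>. theta F \<alpha> e = theta E' \<alpha> e) \<and>
                 varphi0 F e = varphi0 E' e \<and> (\<forall>s. varphi F s e = varphi E' s e))))) \<and>
     SE C UNIV F"


section \<open>Canonical coframing and curvature\<close>

definition canonical_coframing :: "('x, 'v::euclidean_space) chart set \<Rightarrow>
    ('x, 'v, 'n + 'n) canonical \<Rightarrow> bool" where
  "canonical_coframing X F \<longleftrightarrow>
     (\<forall>\<alpha> \<beta>. smooth_form1 X UNIV (Gam F \<alpha> \<beta>)) \<and> (\<forall>\<alpha>. smooth_form1 X UNIV (phi F \<alpha>)) \<and>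
     (\<forall>s. smooth_form1 X UNIV (psi F s) \<and> real_form UNIV (psi F s)) \<and>
     (\<forall>\<alpha> \<beta>. Gam F \<alpha> \<beta> = Gam F \<beta> \<alpha>) \<and>
     (\<forall>\<alpha> \<beta>. (\<Sum>\<^sub>*\<sigma> \<tau>. (pbd \<sigma> \<alpha> * pbd \<tau> \<beta>) \<cdot> Gamb F \<sigma> \<tau>) = Gam F \<alpha> \<beta>) \<and>
     (\<forall>\<alpha>. d1 X (theta F \<alpha>) =
        - ((\<i> \<cdot> phi F \<alpha>) \<sqinter>\<^sub>1 eta F 1)
        - (\<Sum>\<^sub>*\<sigma>. pub \<alpha> \<sigma> \<cdot> phib F \<sigma> \<sqinter>\<^sub>1 etap F)
        - (\<Sum>\<^sub>*\<sigma> \<beta>. puu \<alpha> \<sigma> \<cdot> Gam F \<sigma> \<beta> \<sqinter>\<^sub>1 theta F \<beta>)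
        - ((1/2) \<cdot> (varphi0 F + \<i> \<cdot> varphi F 1) \<sqinter>\<^sub>1 theta F \<alpha>)
        - (\<Sum>\<^sub>*\<beta>. ((1/2) * pub \<alpha> \<beta>) \<cdot> (varphi F 2 + \<i> \<cdot> varphi F 3) \<sqinter>\<^sub>1 thetab F \<beta>)) \<and>
     d1 X (varphi0 F) =
        - (\<Sum>\<^sub>*s. psi F s \<sqinter>\<^sub>1 eta F s)
        - (\<Sum>\<^sub>*\<beta>. 2 \<cdot> phil F \<beta> \<sqinter>\<^sub>1 theta F \<beta>) - (\<Sum>\<^sub>*\<beta>. 2 \<cdot> cj (phil F \<beta>) \<sqinter>\<^sub>1 thetab F \<beta>) \<and>
     d1 X (varphi F 1) =
        - (varphi F 2 \<sqinter>\<^sub>1 varphi F 3) - (psi F 2 \<sqinter>\<^sub>1 eta F 3) + (psi F 3 \<sqinter>\<^sub>1 eta F 2)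
        + (\<Sum>\<^sub>*\<beta>. (2 * \<i>) \<cdot> phil F \<beta> \<sqinter>\<^sub>1 theta F \<beta>)
        - (\<Sum>\<^sub>*\<beta>. (2 * \<i>) \<cdot> cj (phil F \<beta>) \<sqinter>\<^sub>1 thetab F \<beta>) \<and>
     d1 X (varphi F 2) =
        - (varphi F 3 \<sqinter>\<^sub>1 varphi F 1) - (psi F 3 \<sqinter>\<^sub>1 eta F 1) + (psi F 1 \<sqinter>\<^sub>1 eta F 3)
        - (\<Sum>\<^sub>*\<sigma> \<beta>. (2 * pdd \<sigma> \<beta>) \<cdot> phi F \<sigma> \<sqinter>\<^sub>1 theta F \<beta>)
        - (\<Sum>\<^sub>*\<sigma> \<beta>. (2 * cnj (pdd \<sigma> \<beta>)) \<cdot> phib F \<sigma> \<sqinter>\<^sub>1 thetab F \<beta>) \<and>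
     d1 X (varphi F 3) =
        - (varphi F 1 \<sqinter>\<^sub>1 varphi F 2) - (psi F 1 \<sqinter>\<^sub>1 eta F 2) + (psi F 2 \<sqinter>\<^sub>1 eta F 1)
        + (\<Sum>\<^sub>*\<sigma> \<beta>. (2 * \<i> * pdd \<sigma> \<beta>) \<cdot> phi F \<sigma> \<sqinter>\<^sub>1 theta F \<beta>)
        - (\<Sum>\<^sub>*\<sigma> \<beta>. (2 * \<i> * cnj (pdd \<sigma> \<beta>)) \<cdot> phib F \<sigma> \<sqinter>\<^sub>1 thetab F \<beta>)"

definition dGam_rhs :: "('x, 'v, 'n + 'n) canonical \<Rightarrow> ('x, 'n + 'n) curvature \<Rightarrow>
    'n + 'n \<Rightarrow> 'n + 'n \<Rightarrow> ('x, 'v) form2" where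
  "dGam_rhs F K \<alpha> \<beta> =
     - (\<Sum>\<^sub>*\<sigma> \<tau>. puu \<sigma> \<tau> \<cdot> Gam F \<alpha> \<sigma> \<sqinter>\<^sub>1 Gam F \<tau> \<beta>)
     + (\<Sum>\<^sub>*\<sigma>. ((2 * pbd \<sigma> \<alpha>) \<cdot> phil F \<beta> \<sqinter>\<^sub>1 cj (thl F \<sigma>))
            - ((2 * pbd \<sigma> \<alpha>) \<cdot> cj (phil F \<sigma>) \<sqinter>\<^sub>1 thl F \<beta>))
     + (\<Sum>\<^sub>*\<sigma>. ((2 * pbd \<sigma> \<beta>) \<cdot> phil F \<alpha> \<sqinter>\<^sub>1 cj (thl F \<sigma>))
            - ((2 * pbd \<sigma> \<beta>) \<cdot> cj (phil F \<sigma>) \<sqinter>\<^sub>1 thl F \<alpha>))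
     + (\<Sum>\<^sub>*\<gamma> \<delta> \<sigma>. pub \<sigma> \<delta> \<cdot> cS K \<alpha> \<beta> \<gamma> \<sigma> \<odot> theta F \<gamma> \<sqinter>\<^sub>1 thetab F \<delta>)
     + ((\<Sum>\<^sub>*\<gamma>. cV K \<alpha> \<beta> \<gamma> \<odot> theta F \<gamma>)
        + (\<Sum>\<^sub>*\<sigma> \<tau> \<gamma>. (pbd \<sigma> \<alpha> * pbd \<tau> \<beta>) \<cdot> (\<lambda>p. cnj (cV K \<sigma> \<tau> \<gamma> p)) \<odot> thetab F \<gamma>)) \<sqinter>\<^sub>1 eta F 1
     - (\<Sum>\<^sub>*\<sigma> \<gamma>. (\<i> * pub \<sigma> \<gamma>) \<cdot> cV K \<alpha> \<beta> \<sigma> \<odot> thetab F \<gamma> \<sqinter>\<^sub>1 etap F)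
     + (\<Sum>\<^sub>*\<gamma>. \<i> \<cdot> j3 (cV K) \<alpha> \<beta> \<gamma> \<odot> theta F \<gamma> \<sqinter>\<^sub>1 etam F)
     - (\<i> \<cdot> cL K \<alpha> \<beta> \<odot> etap F \<sqinter>\<^sub>1 etam F)
     + (cM K \<alpha> \<beta> \<odot> eta F 1 \<sqinter>\<^sub>1 etap F)
     + (j2 (cM K) \<alpha> \<beta> \<odot> eta F 1 \<sqinter>\<^sub>1 etam F)"

definition dphil_rhs :: "('x, 'v, 'n + 'n) canonical \<Rightarrow> ('x, 'n + 'n) curvature \<Rightarrow>
    'n + 'n \<Rightarrow> ('x, 'v) form2" where
  "dphil_rhs F K \<alpha> =
     ((1/2) \<cdot> (varphi0 F + \<i> \<cdot> varphi F 1) \<sqinter>\<^sub>1 phil F \<alpha>)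
     + (\<Sum>\<^sub>*\<gamma>. ((1/2) * pdd \<alpha> \<gamma>) \<cdot> (varphi F 2 - \<i> \<cdot> varphi F 3) \<sqinter>\<^sub>1 phi F \<gamma>)
     - (\<Sum>\<^sub>*\<sigma> \<gamma>. pbd \<sigma> \<alpha> \<cdot> Gamb F \<sigma> \<gamma> \<sqinter>\<^sub>1 phib F \<gamma>)
     - ((\<i>/2) \<cdot> psi F 1 \<sqinter>\<^sub>1 thl F \<alpha>)
     - (\<Sum>\<^sub>*\<gamma>. ((1/2) * pdd \<alpha> \<gamma>) \<cdot> (psi F 2 - \<i> \<cdot> psi F 3) \<sqinter>\<^sub>1 theta F \<gamma>)
     - (\<Sum>\<^sub>*\<gamma> \<delta> \<sigma>. (\<i> * pub \<sigma> \<delta>) \<cdot> cV K \<alpha> \<gamma> \<sigma> \<odot> theta F \<gamma> \<sqinter>\<^sub>1 thetab F \<delta>)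
     + (\<Sum>\<^sub>*\<gamma>. cM K \<alpha> \<gamma> \<odot> theta F \<gamma> \<sqinter>\<^sub>1 eta F 1)
     + (\<Sum>\<^sub>*\<sigma> \<gamma>. pbd \<sigma> \<alpha> \<cdot> (\<lambda>p. cnj (cL K \<sigma> \<gamma> p)) \<odot> thetab F \<gamma> \<sqinter>\<^sub>1 eta F 1)
     + (\<Sum>\<^sub>*\<gamma>. \<i> \<cdot> cL K \<alpha> \<gamma> \<odot> theta F \<gamma> \<sqinter>\<^sub>1 etam F)
     - (\<Sum>\<^sub>*\<sigma> \<gamma>. (\<i> * pub \<sigma> \<gamma>) \<cdot> cM K \<alpha> \<sigma> \<odot> thetab F \<gamma> \<sqinter>\<^sub>1 etap F)
     - (cC K \<alpha> \<odot> etap F \<sqinter>\<^sub>1 etam F)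
     + (cH K \<alpha> \<odot> eta F 1 \<sqinter>\<^sub>1 etap F)
     + (\<Sum>\<^sub>*\<sigma>. (\<i> * pdd \<alpha> \<sigma>) \<cdot> Cup K \<sigma> \<odot> eta F 1 \<sqinter>\<^sub>1 etam F)"

definition dpsi1_rhs :: "('x, 'v, 'n + 'n) canonical \<Rightarrow> ('x, 'n + 'n) curvature \<Rightarrow>
    ('x, 'v) form2" where
  "dpsi1_rhs F K =
     (varphi0 F \<sqinter>\<^sub>1 psi F 1) - (varphi F 2 \<sqinter>\<^sub>1 psi F 3) + (varphi F 3 \<sqinter>\<^sub>1 psi F 2)
     - (\<Sum>\<^sub>*\<gamma>. (4 * \<i>) \<cdot> phil F \<gamma> \<sqinter>\<^sub>1 phi F \<gamma>)
     + (\<Sum>\<^sub>*\<gamma> \<delta> \<sigma>. (4 * pub \<sigma> \<delta>) \<cdot> cL K \<gamma> \<sigma> \<odot> theta F \<gamma> \<sqinter>\<^sub>1 thetab F \<delta>)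
     + (\<Sum>\<^sub>*\<gamma>. 4 \<cdot> cC K \<gamma> \<odot> theta F \<gamma> \<sqinter>\<^sub>1 eta F 1)
     + (\<Sum>\<^sub>*\<gamma>. 4 \<cdot> (\<lambda>p. cnj (cC K \<gamma> p)) \<odot> thetab F \<gamma> \<sqinter>\<^sub>1 eta F 1)
     - (\<Sum>\<^sub>*\<gamma> \<sigma>. (4 * \<i> * cnj (pdd \<gamma> \<sigma>)) \<cdot> (\<lambda>p. cnj (Cup K \<sigma> p)) \<odot> thetab F \<gamma> \<sqinter>\<^sub>1 etap F)
     + (\<Sum>\<^sub>*\<gamma> \<sigma>. (4 * \<i> * pdd \<gamma> \<sigma>) \<cdot> Cup K \<sigma> \<odot> theta F \<gamma> \<sqinter>\<^sub>1 etam F)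
     + (cP K \<odot> eta F 1 \<sqinter>\<^sub>1 etap F)
     + ((\<lambda>p. cnj (cP K p)) \<odot> eta F 1 \<sqinter>\<^sub>1 etam F)
     + (\<i> \<cdot> cR K \<odot> etap F \<sqinter>\<^sub>1 etam F)"

definition dpsi23_rhs :: "('x, 'v, 'n + 'n) canonical \<Rightarrow> ('x, 'n + 'n) curvature \<Rightarrow>
    ('x, 'v) form2" where
  "dpsi23_rhs F K =
     ((varphi0 F - \<i> \<cdot> varphi F 1) \<sqinter>\<^sub>1 (psi F 2 + \<i> \<cdot> psi F 3))
     + (\<i> \<cdot> (varphi F 2 + \<i> \<cdot> varphi F 3) \<sqinter>\<^sub>1 psi F 1)
     + (\<Sum>\<^sub>*\<gamma> \<delta>. (4 * pdd \<gamma> \<delta>) \<cdot> phi F \<gamma> \<sqinter>\<^sub>1 phi F \<delta>)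
     + (\<Sum>\<^sub>*\<gamma> \<delta> \<sigma>. (4 * \<i> * pbd \<sigma> \<gamma>) \<cdot> (\<lambda>p. cnj (cM K \<sigma> \<delta> p)) \<odot> theta F \<gamma> \<sqinter>\<^sub>1 thetab F \<delta>)
     + (\<Sum>\<^sub>*\<gamma> \<sigma>. (4 * \<i> * pbd \<sigma> \<gamma>) \<cdot> (\<lambda>p. cnj (cC K \<sigma> p)) \<odot> theta F \<gamma> \<sqinter>\<^sub>1 eta F 1)
     - (\<Sum>\<^sub>*\<gamma>. 4 \<cdot> (\<lambda>p. cnj (cH K \<gamma> p)) \<odot> thetab F \<gamma> \<sqinter>\<^sub>1 eta F 1)
     - (\<Sum>\<^sub>*\<gamma>. 4 \<cdot> (\<lambda>p. cnj (cC K \<gamma> p)) \<odot> thetab F \<gamma> \<sqinter>\<^sub>1 etap F)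
     - (\<Sum>\<^sub>*\<gamma> \<sigma>. (4 * \<i> * pbd \<sigma> \<gamma>) \<cdot> (\<lambda>p. cnj (cH K \<sigma> p)) \<odot> theta F \<gamma> \<sqinter>\<^sub>1 etam F)
     - (\<i> \<cdot> cR K \<odot> eta F 1 \<sqinter>\<^sub>1 etap F)
     + ((\<lambda>p. cnj (cQ K p)) \<odot> eta F 1 \<sqinter>\<^sub>1 etam F)
     - ((\<lambda>p. cnj (cP K p)) \<odot> etap F \<sqinter>\<^sub>1 etam F)"

text \<open>Total symmetry is expressed by invariance under adjacent transpositions.\<close>

definition curvature_functions :: "('x, 'v::euclidean_space) chart set \<Rightarrow>
    ('x, 'v, 'n + 'n) canonical \<Rightarrow> ('x, 'n + 'n) curvature \<Rightarrow> bool" where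
  "curvature_functions X F K \<longleftrightarrow>
     (\<forall>\<alpha> \<beta> \<gamma> \<delta>. smooth_fun X UNIV (cS K \<alpha> \<beta> \<gamma> \<delta>)) \<and> (\<forall>\<alpha> \<beta> \<gamma>. smooth_fun X UNIV (cV K \<alpha> \<beta> \<gamma>)) \<and>
     (\<forall>\<alpha> \<beta>. smooth_fun X UNIV (cL K \<alpha> \<beta>)) \<and> (\<forall>\<alpha> \<beta>. smooth_fun X UNIV (cM K \<alpha> \<beta>)) \<and>
     (\<forall>\<alpha>. smooth_fun X UNIV (cC K \<alpha>)) \<and> (\<forall>\<alpha>. smooth_fun X UNIV (cH K \<alpha>)) \<and>
     smooth_fun X UNIV (cP K) \<and> smooth_fun X UNIV (cQ K) \<and> smooth_fun X UNIV (cR K) \<and>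
     (\<forall>\<alpha> \<beta> \<gamma> \<delta>. cS K \<alpha> \<beta> \<gamma> \<delta> = cS K \<beta> \<alpha> \<gamma> \<delta> \<and> cS K \<alpha> \<beta> \<gamma> \<delta> = cS K \<alpha> \<gamma> \<beta> \<delta> \<and>
        cS K \<alpha> \<beta> \<gamma> \<delta> = cS K \<alpha> \<beta> \<delta> \<gamma>) \<and>
     (\<forall>\<alpha> \<beta> \<gamma>. cV K \<alpha> \<beta> \<gamma> = cV K \<beta> \<alpha> \<gamma> \<and> cV K \<alpha> \<beta> \<gamma> = cV K \<alpha> \<gamma> \<beta>) \<and>
     (\<forall>\<alpha> \<beta>. cL K \<alpha> \<beta> = cL K \<beta> \<alpha>) \<and> (\<forall>\<alpha> \<beta>. cM K \<alpha> \<beta> = cM K \<beta> \<alpha>) \<and>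
     j4 (cS K) = cS K \<and> j2 (cL K) = cL K \<and> (\<forall>p. cnj (cR K p) = cR K p) \<and>
     (\<forall>\<alpha> \<beta>. d1 X (Gam F \<alpha> \<beta>) = dGam_rhs F K \<alpha> \<beta>) \<and>
     (\<forall>\<alpha>. d1 X (phil F \<alpha>) = dphil_rhs F K \<alpha>) \<and>
     d1 X (psi F 1) = dpsi1_rhs F K \<and>
     (\<forall>p u v. d1 X (psi F 2) p u v + \<i> * d1 X (psi F 3) p u v = dpsi23_rhs F K p u v)"


section \<open>The starred one-forms\<close>

definition tildeS :: "('x, 'v, 'n + 'n) canonical \<Rightarrow> ('x, 'n + 'n) curvature \<Rightarrow>
    'n + 'n \<Rightarrow> 'n + 'n \<Rightarrow> 'n + 'n \<Rightarrow> 'n + 'n \<Rightarrow> ('x, 'v) form1" where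
  "tildeS F K \<alpha> \<beta> \<gamma> \<delta> =
     (\<Sum>\<^sub>*\<tau> \<nu>. puu \<tau> \<nu> \<cdot> cS K \<tau> \<beta> \<gamma> \<delta> \<odot> Gam F \<nu> \<alpha>) + (\<Sum>\<^sub>*\<tau> \<nu>. puu \<tau> \<nu> \<cdot> cS K \<alpha> \<tau> \<gamma> \<delta> \<odot> Gam F \<nu> \<beta>)
     + (\<Sum>\<^sub>*\<tau> \<nu>. puu \<tau> \<nu> \<cdot> cS K \<alpha> \<beta> \<tau> \<delta> \<odot> Gam F \<nu> \<gamma>) + (\<Sum>\<^sub>*\<tau> \<nu>. puu \<tau> \<nu> \<cdot> cS K \<alpha> \<beta> \<gamma> \<tau> \<odot> Gam F \<nu> \<delta>)
     + cS K \<alpha> \<beta> \<gamma> \<delta> \<odot> varphi0 F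
     + (\<Sum>\<^sub>*\<tau>. (\<lambda>p. 2 * \<i> * (pdd \<alpha> \<tau> * cV K \<delta> \<beta> \<gamma> p + pdd \<beta> \<tau> * cV K \<alpha> \<gamma> \<delta> p
           + pdd \<gamma> \<tau> * cV K \<alpha> \<beta> \<delta> p + pdd \<delta> \<tau> * cV K \<alpha> \<beta> \<gamma> p)) \<odot> theta F \<tau>)
     + (\<Sum>\<^sub>*\<tau>. (\<lambda>p. 2 * \<i> * (gl \<alpha> \<tau> * j3 (cV K) \<delta> \<beta> \<gamma> p + gl \<beta> \<tau> * j3 (cV K) \<alpha> \<delta> \<gamma> p
           + gl \<gamma> \<tau> * j3 (cV K) \<alpha> \<beta> \<delta> p + gl \<delta> \<tau> * j3 (cV K) \<alpha> \<beta> \<gamma> p)) \<odot> thetab F \<tau>)"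

definition tildeV :: "('x, 'v, 'n + 'n) canonical \<Rightarrow> ('x, 'n + 'n) curvature \<Rightarrow>
    'n + 'n \<Rightarrow> 'n + 'n \<Rightarrow> 'n + 'n \<Rightarrow> ('x, 'v) form1" where
  "tildeV F K \<alpha> \<beta> \<gamma> =
     (\<Sum>\<^sub>*\<tau> \<nu>. puu \<tau> \<nu> \<cdot> cV K \<tau> \<beta> \<gamma> \<odot> Gam F \<nu> \<alpha>) + (\<Sum>\<^sub>*\<tau> \<nu>. puu \<tau> \<nu> \<cdot> cV K \<alpha> \<tau> \<gamma> \<odot> Gam F \<nu> \<beta>)
     + (\<Sum>\<^sub>*\<tau> \<nu>. puu \<tau> \<nu> \<cdot> cV K \<alpha> \<beta> \<tau> \<odot> Gam F \<nu> \<gamma>)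
     - (\<Sum>\<^sub>*\<sigma> \<tau>. (\<i> * pub \<sigma> \<tau>) \<cdot> cS K \<alpha> \<beta> \<gamma> \<sigma> \<odot> phib F \<tau>)
     + (1/2) \<cdot> cV K \<alpha> \<beta> \<gamma> \<odot> (3 \<cdot> varphi0 F + \<i> \<cdot> varphi F 1)
     - (1/2) \<cdot> j3 (cV K) \<alpha> \<beta> \<gamma> \<odot> (varphi F 2 - \<i> \<cdot> varphi F 3)
     - (\<Sum>\<^sub>*\<tau>. (\<lambda>p. 2 * (pdd \<alpha> \<tau> * cM K \<beta> \<gamma> p + pdd \<beta> \<tau> * cM K \<alpha> \<gamma> p + pdd \<gamma> \<tau> * cM K \<alpha> \<beta> p))
           \<odot> theta F \<tau>)
     - (\<Sum>\<^sub>*\<tau>. (\<lambda>p. 2 * (gl \<alpha> \<tau> * cL K \<beta> \<gamma> p + gl \<beta> \<tau> * cL K \<alpha> \<gamma> p + gl \<gamma> \<tau> * cL K \<alpha> \<beta> p))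
           \<odot> thetab F \<tau>)"

definition tildeL :: "('x, 'v, 'n + 'n) canonical \<Rightarrow> ('x, 'n + 'n) curvature \<Rightarrow>
    'n + 'n \<Rightarrow> 'n + 'n \<Rightarrow> ('x, 'v) form1" where
  "tildeL F K \<alpha> \<beta> =
     (\<Sum>\<^sub>*\<tau> \<sigma>. puu \<tau> \<sigma> \<cdot> cL K \<tau> \<beta> \<odot> Gam F \<sigma> \<alpha>) + (\<Sum>\<^sub>*\<tau> \<sigma>. puu \<tau> \<sigma> \<cdot> cL K \<alpha> \<tau> \<odot> Gam F \<sigma> \<beta>)
     + 2 \<cdot> cL K \<alpha> \<beta> \<odot> varphi0 F
     + (1/2) \<cdot> cM K \<alpha> \<beta> \<odot> (varphi F 2 + \<i> \<cdot> varphi F 3)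
     + (1/2) \<cdot> j2 (cM K) \<alpha> \<beta> \<odot> (varphi F 2 - \<i> \<cdot> varphi F 3)
     + (\<Sum>\<^sub>*\<sigma>. cV K \<alpha> \<beta> \<sigma> \<odot> phi F \<sigma>)
     + (\<Sum>\<^sub>*\<mu> \<nu> \<sigma>. (pbd \<mu> \<alpha> * pbd \<nu> \<beta>) \<cdot> (\<lambda>p. cnj (cV K \<mu> \<nu> \<sigma> p)) \<odot> phib F \<sigma>)
     + (\<Sum>\<^sub>*\<tau>. (\<lambda>p. 2 * \<i> * (pdd \<alpha> \<tau> * cC K \<beta> p + pdd \<beta> \<tau> * cC K \<alpha> p)) \<odot> theta F \<tau>)
     + (\<Sum>\<^sub>*\<tau> \<sigma>. (\<lambda>p. 2 * \<i> * (gl \<alpha> \<tau> * pbd \<sigma> \<beta> * cnj (cC K \<sigma> p)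
           + gl \<beta> \<tau> * pbd \<sigma> \<alpha> * cnj (cC K \<sigma> p))) \<odot> thetab F \<tau>)"

definition tildeM :: "('x, 'v, 'n + 'n) canonical \<Rightarrow> ('x, 'n + 'n) curvature \<Rightarrow>
    'n + 'n \<Rightarrow> 'n + 'n \<Rightarrow> ('x, 'v) form1" where
  "tildeM F K \<alpha> \<beta> =
     (\<Sum>\<^sub>*\<tau> \<sigma>. puu \<tau> \<sigma> \<cdot> cM K \<tau> \<beta> \<odot> Gam F \<sigma> \<alpha>) + (\<Sum>\<^sub>*\<tau> \<sigma>. puu \<tau> \<sigma> \<cdot> cM K \<alpha> \<tau> \<odot> Gam F \<sigma> \<beta>)
     + cM K \<alpha> \<beta> \<odot> (2 \<cdot> varphi0 F + \<i> \<cdot> varphi F 1)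
     - cL K \<alpha> \<beta> \<odot> (varphi F 2 - \<i> \<cdot> varphi F 3)
     - (\<Sum>\<^sub>*\<sigma> \<tau>. (2 * pub \<sigma> \<tau>) \<cdot> cV K \<alpha> \<beta> \<sigma> \<odot> phib F \<tau>)
     - (\<Sum>\<^sub>*\<tau>. (\<lambda>p. 2 * (pdd \<alpha> \<tau> * cH K \<beta> p + pdd \<beta> \<tau> * cH K \<alpha> p)) \<odot> theta F \<tau>)
     + (\<Sum>\<^sub>*\<tau>. (\<lambda>p. 2 * \<i> * (gl \<alpha> \<tau> * cC K \<beta> p + gl \<beta> \<tau> * cC K \<alpha> p)) \<odot> thetab F \<tau>)"

definition tildeC :: "('x, 'v, 'n + 'n) canonical \<Rightarrow> ('x, 'n + 'n) curvature \<Rightarrow>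
    'n + 'n \<Rightarrow> ('x, 'v) form1" where
  "tildeC F K \<alpha> =
     (\<Sum>\<^sub>*\<tau> \<sigma>. puu \<tau> \<sigma> \<cdot> cC K \<tau> \<odot> Gam F \<sigma> \<alpha>)
     + (1/2) \<cdot> cC K \<alpha> \<odot> (5 \<cdot> varphi0 F + \<i> \<cdot> varphi F 1)
     - (\<Sum>\<^sub>*\<sigma>. pbd \<sigma> \<alpha> \<cdot> (\<lambda>p. cnj (cC K \<sigma> p)) \<odot> (varphi F 2 - \<i> \<cdot> varphi F 3))
     - (\<Sum>\<^sub>*\<sigma> \<tau>. (2 * \<i> * pub \<sigma> \<tau>) \<cdot> cL K \<alpha> \<sigma> \<odot> phib F \<tau>)
     + (\<Sum>\<^sub>*\<tau>. \<i> \<cdot> cM K \<alpha> \<tau> \<odot> phi F \<tau>)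
     + (\<i>/2) \<cdot> cH K \<alpha> \<odot> (varphi F 2 + \<i> \<cdot> varphi F 3)
     - (\<Sum>\<^sub>*\<tau>. ((1/2) * pdd \<alpha> \<tau>) \<cdot> cP K \<odot> theta F \<tau>)
     + (\<Sum>\<^sub>*\<tau>. ((1/2) * gl \<alpha> \<tau>) \<cdot> cR K \<odot> thetab F \<tau>)"

definition tildeH :: "('x, 'v, 'n + 'n) canonical \<Rightarrow> ('x, 'n + 'n) curvature \<Rightarrow>
    'n + 'n \<Rightarrow> ('x, 'v) form1" where
  "tildeH F K \<alpha> =
     (\<Sum>\<^sub>*\<tau> \<sigma>. puu \<tau> \<sigma> \<cdot> cH K \<tau> \<odot> Gam F \<sigma> \<alpha>)
     + (1/2) \<cdot> cH K \<alpha> \<odot> (5 \<cdot> varphi0 F + (3 * \<i>) \<cdot> varphi F 1)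
     + (3 * \<i> / 2) \<cdot> cC K \<alpha> \<odot> (varphi F 2 - \<i> \<cdot> varphi F 3)
     - (\<Sum>\<^sub>*\<sigma> \<tau>. (3 * pub \<sigma> \<tau>) \<cdot> cM K \<alpha> \<sigma> \<odot> phib F \<tau>)
     + (\<Sum>\<^sub>*\<tau>. ((1/2) * pdd \<alpha> \<tau>) \<cdot> cQ K \<odot> theta F \<tau>)
     + (\<Sum>\<^sub>*\<tau>. ((\<i>/2) * gl \<alpha> \<tau>) \<cdot> cP K \<odot> thetab F \<tau>)"

definition tildeR :: "('x, 'v, 'n + 'n) canonical \<Rightarrow> ('x, 'n + 'n) curvature \<Rightarrow> ('x, 'v) form1" where
  "tildeR F K =
     3 \<cdot> cR K \<odot> varphi0 F
     - cP K \<odot> (varphi F 2 + \<i> \<cdot> varphi F 3)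
     - (\<lambda>p. cnj (cP K p)) \<odot> (varphi F 2 - \<i> \<cdot> varphi F 3)
     - (\<Sum>\<^sub>*\<tau>. 8 \<cdot> cC K \<tau> \<odot> phi F \<tau>)
     - (\<Sum>\<^sub>*\<tau>. 8 \<cdot> (\<lambda>p. cnj (cC K \<tau> p)) \<odot> phib F \<tau>)"

definition tildeP :: "('x, 'v, 'n + 'n) canonical \<Rightarrow> ('x, 'n + 'n) curvature \<Rightarrow> ('x, 'v) form1" where
  "tildeP F K =
     cP K \<odot> (3 \<cdot> varphi0 F + \<i> \<cdot> varphi F 1)
     - (\<i>/2) \<cdot> cQ K \<odot> (varphi F 2 + \<i> \<cdot> varphi F 3)
     + (3/2) \<cdot> cR K \<odot> (varphi F 2 - \<i> \<cdot> varphi F 3)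
     + (\<Sum>\<^sub>*\<tau>. (4 * \<i>) \<cdot> cH K \<tau> \<odot> phi F \<tau>)
     - (\<Sum>\<^sub>*\<tau> \<sigma>. (12 * cnj (pdd \<tau> \<sigma>)) \<cdot> (\<lambda>p. cnj (Cup K \<sigma> p)) \<odot> phib F \<tau>)"

definition tildeQ :: "('x, 'v, 'n + 'n) canonical \<Rightarrow> ('x, 'n + 'n) curvature \<Rightarrow> ('x, 'v) form1" where
  "tildeQ F K =
     cQ K \<odot> (3 \<cdot> varphi0 F + (2 * \<i>) \<cdot> varphi F 1)
     - (2 * \<i>) \<cdot> cP K \<odot> (varphi F 2 - \<i> \<cdot> varphi F 3)
     + (\<Sum>\<^sub>*\<tau> \<sigma>. (16 * cnj (pdd \<tau> \<sigma>)) \<cdot> Hupb K \<sigma> \<odot> phib F \<tau>)"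

definition starS where "starS X F K \<alpha> \<beta> \<gamma> \<delta> = d0 X (cS K \<alpha> \<beta> \<gamma> \<delta>) - tildeS F K \<alpha> \<beta> \<gamma> \<delta>"
definition starV where "starV X F K \<alpha> \<beta> \<gamma> = d0 X (cV K \<alpha> \<beta> \<gamma>) - tildeV F K \<alpha> \<beta> \<gamma>"
definition starL where "starL X F K \<alpha> \<beta> = d0 X (cL K \<alpha> \<beta>) - tildeL F K \<alpha> \<beta>"
definition starM where "starM X F K \<alpha> \<beta> = d0 X (cM K \<alpha> \<beta>) - tildeM F K \<alpha> \<beta>"
definition starC where "starC X F K \<alpha> = d0 X (cC K \<alpha>) - tildeC F K \<alpha>"
definition starH where "starH X F K \<alpha> = d0 X (cH K \<alpha>) - tildeH F K \<alpha>"
definition starR where "starR X F K = d0 X (cR K) - tildeR F K"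
definition starP where "starP X F K = d0 X (cP K) - tildeP F K"
definition starQ where "starQ X F K = d0 X (cQ K) - tildeQ F K"

end

end

theory Submission
  imports Defs
begin

text \<open>
  The canonical coframing is a symmetric matrix \<open>\<Omega>\<close> of one-forms, i.e. a form with values in the
  symplectic algebra of a complex vector space of dimension \<open>2 n + 4\<close>: besides the Greek indices there
  are two indices \<open>1, 2\<close> for an isotropic plane and \<open>1', 2'\<close> for its dual. In the same way the curvature
  functions are the components of one totally symmetric tensor \<open>T\<close> with four indices that vanishes if
  an index is \<open>1\<close> or \<open>2\<close>. All structure equations then become the single equation
  \<open>d\<Omega>\<^sub>P\<^sub>Q = - \<Omega>\<^sub>P\<^sub>R \<and> \<Omega>\<^sup>R\<^sub>Q + T\<^sub>P\<^sub>Q\<^sub>R\<^sub>S E\<^sub>1\<^sup>R \<and> E\<^sub>2\<^sup>S\<close>, where \<open>E\<^sub>a\<^sup>R = \<Omega>\<^sup>R\<^sub>a\<close> for \<open>a = 1, 2\<close>. Differentiating it and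
  using \<open>d\<^sup>2 = 0\<close> gives \<open>(DT)\<^sub>P\<^sub>Q\<^sub>R\<^sub>S \<and> E\<^sub>1\<^sup>R \<and> E\<^sub>2\<^sup>S = 0\<close> for the covariant derivative \<open>DT\<close>. The starred forms
  are the components of \<open>DT\<close>, up to constants and conjugation, and the four identities are the
  components of this equation for \<open>\<Omega>\<^sub>P\<^sub>Q = \<Gamma>\<^sub>\<alpha>\<^sub>\<beta>, \<phi>\<^sub>\<alpha>, \<psi>\<^sub>1, \<psi>\<^sub>2 + i \<psi>\<^sub>3\<close>.
\<close>

section \<open>Symmetry of mixed derivatives and smooth functions\<close>

text \<open>Expanding \<open>d2\<close> of each right-hand side directly would give a mass of
  products whose cancellation shows no pattern. For a symplectic connection with arbitrary index set
  the cubic terms cancel by renaming two summation indices and the others regroup into the covariant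
  derivative. Particular constants then enter at two places only: in checking the structure
  equations and in recognising the starred forms. Complex conjugation becomes a quaternionic
  structure on the index space that exchanges 1 and 2. It ties the columns of \<open>theta\<close>
  and of its conjugate together and cuts the structure equations down to nine blocks. Since R and S
  run only over indices other than 1 and 2, the covariant derivative carries an extra trace term,
  here \<open>varphi0\<close> times \<open>-T\<close>; it is the weight common to all starred forms.
  The vanishing of \<open>d2\<close> on exact forms also needs an argument, because a form at a
  point is read in a chart that jumps with the point.\<close>

lemma mixed_derivatives_commute_real:
  fixes f :: "'a::real_normed_vector \<Rightarrow> real"
  assumes "open S" "x \<in> S"
    and f: "\<And>y. y \<in> S \<Longrightarrow> f differentiable (at y)"
    and fu: "\<And>y. y \<in> S \<Longrightarrow> (\<lambda>y. frechet_derivative f (at y) u) differentiable (at y)"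
    and fv: "\<And>y. y \<in> S \<Longrightarrow> (\<lambda>y. frechet_derivative f (at y) v) differentiable (at y)"
    and cuv: "continuous_on S (\<lambda>y. frechet_derivative (\<lambda>y. frechet_derivative f (at y) u) (at y) v)"
    and cvu: "continuous_on S (\<lambda>y. frechet_derivative (\<lambda>y. frechet_derivative f (at y) v) (at y) u)"
  shows "frechet_derivative (\<lambda>y. frechet_derivative f (at y) u) (at x) v
    = frechet_derivative (\<lambda>y. frechet_derivative f (at y) v) (at x) u"
proof -
  \<comment> \<open>The second difference on the left is symmetric in \<open>u\<close> and
    \<open>v\<close>. Two applications of the mean value theorem turn it into \<open>s * s\<close>
    times a mixed derivative at a nearby point, and the order of differentiation depends on which
    direction is treated first. The vectors are generalised so that the fact serves both
    orders.\<close>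
  have diff_quot: "\<exists>a\<in>{0<..<s}. \<exists>b\<in>{0<..<s}.
      f (x + s *\<^sub>R u + s *\<^sub>R v) - f (x + s *\<^sub>R u) - f (x + s *\<^sub>R v) + f x
      = s * s * frechet_derivative (\<lambda>y. frechet_derivative f (at y) u) (at (x + a *\<^sub>R u + b *\<^sub>R v)) v"
    if s: "s > 0" and box: "\<And>a b. 0 \<le> a \<Longrightarrow> a \<le> s \<Longrightarrow> 0 \<le> b \<Longrightarrow> b \<le> s \<Longrightarrow> x + a *\<^sub>R u + b *\<^sub>R v \<in> S"
      and du: "\<And>y. y \<in> S \<Longrightarrow> (\<lambda>y. frechet_derivative f (at y) u) differentiable (at y)"
    for s :: real and u v :: 'a
  proof -
    let ?\<phi> = "\<lambda>a. f (x + a *\<^sub>R u + s *\<^sub>R v) - f (x + a *\<^sub>R u)"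
    let ?d = "\<lambda>a. frechet_derivative f (at (x + a *\<^sub>R u + s *\<^sub>R v)) u - frechet_derivative f (at (x + a *\<^sub>R u)) u"
    have f': "(f has_derivative frechet_derivative f (at y)) (at y)" if "y \<in> S" for y
      using f[OF that] frechet_derivative_works by blast
    have line: "((\<lambda>a. f (z + a *\<^sub>R w)) has_derivative (\<lambda>h. h * frechet_derivative f (at (z + a *\<^sub>R w)) w)) (at a)"
      if "z + a *\<^sub>R w \<in> S" for z w a
    proof -
      have "((\<lambda>a. z + a *\<^sub>R w) has_derivative (\<lambda>h. h *\<^sub>R w)) (at a)"
        by (auto intro!: derivative_eq_intros)
      from has_derivative_compose[OF this f'[OF that]]
      show ?thesis
        using linear_scale[OF linear_frechet_derivative[OF f[OF that]]] by simp
    qed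
    have "(?\<phi> has_derivative (\<lambda>h. h * ?d a)) (at a)" if "0 \<le> a" "a \<le> s" for a
    proof -
      have eq: "x + a *\<^sub>R u + s *\<^sub>R v = (x + s *\<^sub>R v) + a *\<^sub>R u" for a by (simp add: algebra_simps)
      have 1: "(x + s *\<^sub>R v) + a *\<^sub>R u \<in> S" using box[OF that, of s] s eq by simp
      have 2: "x + a *\<^sub>R u \<in> S" using box[OF that, of 0] s by simp
      show ?thesis
        unfolding eq by (rule has_derivative_eq_rhs[OF has_derivative_diff[OF line[OF 1] line[OF 2]]])
          (simp add: algebra_simps)
    qed
    then have "(?\<phi> has_derivative (\<lambda>h. h * ?d a)) (at a within {0..s})" if "0 \<le> a" "a \<le> s" for a
      using that has_derivative_at_withinI by blast
    from mvt_simple[OF s this] obtain a where a: "a \<in> {0<..<s}"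
      and 1: "?\<phi> s - ?\<phi> 0 = s * ?d a" by auto
    let ?\<psi> = "\<lambda>b. frechet_derivative f (at (x + a *\<^sub>R u + b *\<^sub>R v)) u"
    let ?e = "\<lambda>b. frechet_derivative (\<lambda>y. frechet_derivative f (at y) u) (at (x + a *\<^sub>R u + b *\<^sub>R v)) v"
    have "(?\<psi> has_derivative (\<lambda>h. h * ?e b)) (at b)" if "0 \<le> b" "b \<le> s" for b
    proof -
      have S: "x + a *\<^sub>R u + b *\<^sub>R v \<in> S" using a box that by auto
      have lin: "((\<lambda>b. x + a *\<^sub>R u + b *\<^sub>R v) has_derivative (\<lambda>h. h *\<^sub>R v)) (at b)"
        by (auto intro!: derivative_eq_intros)
      have "((\<lambda>y. frechet_derivative f (at y) u) has_derivative
          frechet_derivative (\<lambda>y. frechet_derivative f (at y) u) (at (x + a *\<^sub>R u + b *\<^sub>R v)))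
          (at (x + a *\<^sub>R u + b *\<^sub>R v))"
        using du[OF S] frechet_derivative_works by blast
      from has_derivative_compose[OF lin this]
      have "((\<lambda>b. frechet_derivative f (at (x + a *\<^sub>R u + b *\<^sub>R v)) u) has_derivative
         (\<lambda>h. frechet_derivative (\<lambda>y. frechet_derivative f (at y) u) (at (x + a *\<^sub>R u + b *\<^sub>R v)) (h *\<^sub>R v))) (at b)"
        .
      then show ?thesis
        using linear_scale[OF linear_frechet_derivative[OF du[OF S]]] by simp
    qed
    then have "(?\<psi> has_derivative (\<lambda>h. h * ?e b)) (at b within {0..s})" if "0 \<le> b" "b \<le> s" for b
      using that has_derivative_at_withinI by blast
    from mvt_simple[OF s this] obtain b where b: "b \<in> {0<..<s}"
      and 2: "?\<psi> s - ?\<psi> 0 = s * ?e b" by auto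
    show ?thesis
    proof (intro bexI)
      show "f (x + s *\<^sub>R u + s *\<^sub>R v) - f (x + s *\<^sub>R u) - f (x + s *\<^sub>R v) + f x = s * s * ?e b"
        using 1 2 by simp
    qed (use a b in auto)
  qed
  let ?U = "\<lambda>y. frechet_derivative (\<lambda>y. frechet_derivative f (at y) u) (at y) v"
  let ?V = "\<lambda>y. frechet_derivative (\<lambda>y. frechet_derivative f (at y) v) (at y) u"
  have "\<bar>?U x - ?V x\<bar> < e" if "e > 0" for e
  proof -
    have cont: "isCont ?U x" "isCont ?V x"
      by (rule continuous_on_interior[OF cuv] continuous_on_interior[OF cvu],
          simp add: interior_open[OF assms(1)] assms(2))+
    have "e/2 > 0" using that by simp
    then obtain d1 where d1: "d1 > 0" "\<And>y. dist y x < d1 \<Longrightarrow> dist (?U y) (?U x) < e/2"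
      using cont(1)[unfolded continuous_at_eps_delta, rule_format, of "e/2"] by blast
    from \<open>e/2 > 0\<close> obtain d2 where d2: "d2 > 0" "\<And>y. dist y x < d2 \<Longrightarrow> dist (?V y) (?V x) < e/2"
      using cont(2)[unfolded continuous_at_eps_delta, rule_format, of "e/2"] by blast
    note d = d1(1) d2(1) d1(2) d2(2)
    obtain d3 where d3: "d3 > 0" "ball x d3 \<subseteq> S"
      using assms(1,2) open_contains_ball by blast
    define d where "d = min d1 (min d2 d3)"
    \<comment> \<open>The summand 1 keeps the denominator positive when both vectors vanish, and the
      factor 2 leaves room for the strict inequality in \<open>box\<close>.\<close>
    define s where "s = d / (2 * (norm u + norm v + 1))"
    have nn: "norm u + norm v + 1 > 0" using norm_ge_zero[of u] norm_ge_zero[of v] by linarith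
    have dpos: "d > 0" using d d3 by (simp add: d_def)
    have s: "s > 0" using dpos nn unfolding s_def by (intro divide_pos_pos) auto
    have box: "dist (x + a *\<^sub>R u + b *\<^sub>R v) x < d" if "0 \<le> a" "a \<le> s" "0 \<le> b" "b \<le> s" for a b
    proof -
      have "dist (x + a *\<^sub>R u + b *\<^sub>R v) x = norm (a *\<^sub>R u + b *\<^sub>R v)"
        by (simp add: dist_norm algebra_simps)
      also have "\<dots> \<le> a * norm u + b * norm v"
        using norm_triangle_ineq[of "a *\<^sub>R u" "b *\<^sub>R v"] that by simp
      also have "\<dots> \<le> s * norm u + s * norm v" 
        using that by (intro add_mono mult_right_mono) auto
      also have "\<dots> \<le> s * (norm u + norm v + 1)" using s by (simp add: algebra_simps)
      also have "\<dots> = d / 2" using nn unfolding s_def by (simp add: field_simps)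
      also have "\<dots> < d" using dpos by simp
      finally show ?thesis .
    qed
    have boxS: "x + a *\<^sub>R u + b *\<^sub>R v \<in> S" if "0 \<le> a" "a \<le> s" "0 \<le> b" "b \<le> s" for a b
      using box[OF that] d3(2) by (force simp: d_def dist_commute)
    from diff_quot[OF s boxS fu] obtain a b where ab: "a\<in>{0<..<s}" "b\<in>{0<..<s}"
      "f (x + s *\<^sub>R u + s *\<^sub>R v) - f (x + s *\<^sub>R u) - f (x + s *\<^sub>R v) + f x = s * s * ?U (x + a *\<^sub>R u + b *\<^sub>R v)"
      by blast
    have boxS': "x + a *\<^sub>R v + b *\<^sub>R u \<in> S" if "0 \<le> a" "a \<le> s" "0 \<le> b" "b \<le> s" for a b
      using boxS[OF that(3,4,1,2)] by (simp add: algebra_simps)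
    from diff_quot[OF s boxS' fv] obtain b' a' where ab': "a'\<in>{0<..<s}" "b'\<in>{0<..<s}"
      "f (x + s *\<^sub>R v + s *\<^sub>R u) - f (x + s *\<^sub>R v) - f (x + s *\<^sub>R u) + f x = s * s * ?V (x + b' *\<^sub>R v + a' *\<^sub>R u)"
      by blast
    have "s * s * ?U (x + a *\<^sub>R u + b *\<^sub>R v) = s * s * ?V (x + a' *\<^sub>R u + b' *\<^sub>R v)"
      using ab(3) ab'(3) by (simp add: algebra_simps)
    then have "?U (x + a *\<^sub>R u + b *\<^sub>R v) = ?V (x + a' *\<^sub>R u + b' *\<^sub>R v)"
      using s by simp
    moreover have "dist (?U (x + a *\<^sub>R u + b *\<^sub>R v)) (?U x) < e/2"
      using ab box[of a b] by (intro d(3)) (auto simp: d_def)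
    moreover have "dist (?V (x + a' *\<^sub>R u + b' *\<^sub>R v)) (?V x) < e/2"
      using ab' box[of a' b'] by (intro d(4)) (auto simp: d_def)
    ultimately show ?thesis
      unfolding dist_real_def by linarith
  qed
  \<comment> \<open>If the difference were nonzero, its absolute value could serve as
    \<open>e\<close> and would be smaller than itself.\<close>
  from this[of "\<bar>?U x - ?V x\<bar>"] show ?thesis by auto
qed

section \<open>Linear operations on differentiable and smooth functions\<close>

lemma frechet_derivative_bounded_linear:
  assumes "bounded_linear L" "f differentiable (at x)"
  shows "frechet_derivative (\<lambda>x. L (f x)) (at x) = (\<lambda>v. L (frechet_derivative f (at x) v))"
proof (rule frechet_derivative_at[symmetric])
  show "((\<lambda>x. L (f x)) has_derivative (\<lambda>v. L (frechet_derivative f (at x) v))) (at x)"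
    using assms frechet_derivative_works by (blast intro: bounded_linear.has_derivative)
qed

lemma frechet_derivative_plus_fun:
  assumes "f differentiable (at x)" "g differentiable (at x)"
  shows "frechet_derivative (\<lambda>x. f x + g x) (at x)
    = (\<lambda>v. frechet_derivative f (at x) v + frechet_derivative g (at x) v)"
proof (rule frechet_derivative_at[symmetric])
  show "((\<lambda>x. f x + g x) has_derivative
      (\<lambda>v. frechet_derivative f (at x) v + frechet_derivative g (at x) v)) (at x)"
    using assms frechet_derivative_works by (blast intro: has_derivative_add)
qed

lemma differentiable_cong_open:
  assumes "open S" "x \<in> S" "\<And>y. y \<in> S \<Longrightarrow> f y = g y"
  shows "f differentiable (at x) \<longleftrightarrow> g differentiable (at x)"
proof -
  have "(f has_derivative f') (at x) \<longleftrightarrow> (g has_derivative f') (at x)" for f'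
    by (intro iffI; erule has_derivative_transform_within_open[OF _ assms(1,2)]; simp add: assms(3))
  then show ?thesis by (simp add: differentiable_def)
qed

lemma frechet_derivative_cong_open:
  assumes "open S" "x \<in> S" "\<And>y. y \<in> S \<Longrightarrow> f y = g y"
  shows "frechet_derivative f (at x) = frechet_derivative g (at x)"
proof -
  have "(f has_derivative f') (at x) \<longleftrightarrow> (g has_derivative f') (at x)" for f'
    by (intro iffI; erule has_derivative_transform_within_open[OF _ assms(1,2)]; simp add: assms(3))
  then show ?thesis by (simp add: frechet_derivative_def)
qed

text \<open>\<open>Ck_on\<close> speaks of derivatives of total functions, so agreement on
  \<open>S\<close> is inherited by the derivatives because \<open>S\<close> is open. The functions
  are generalised in the induction, which passes to their directional derivatives.\<close>

lemma Ck_on_cong: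
  assumes "open S" "\<And>x. x \<in> S \<Longrightarrow> f x = g x"
  shows "Ck_on k f S \<longleftrightarrow> Ck_on k g S"
  using assms(2)
proof (induction k arbitrary: f g)
  case 0
  then show ?case by (auto intro!: continuous_on_cong)
next
  case (Suc k)
  have 1: "frechet_derivative f (at x) = frechet_derivative g (at x)" if "x \<in> S" for x
    using frechet_derivative_cong_open[OF assms(1) that, of f g] Suc.prems by blast
  have 2: "f differentiable (at x) \<longleftrightarrow> g differentiable (at x)" if "x \<in> S" for x
    using differentiable_cong_open[OF assms(1) that, of f g] Suc.prems by blast
  have "Ck_on k (\<lambda>x. frechet_derivative f (at x) v) S
    \<longleftrightarrow> Ck_on k (\<lambda>x. frechet_derivative g (at x) v) S" for v
    by (rule Suc.IH) (simp add: 1)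
  then show ?case using 2 by auto
qed

lemma Ck_on_bounded_linear:
  assumes "open S" "bounded_linear L" "Ck_on k f S"
  shows "Ck_on k (\<lambda>x. L (f x)) S"
  using assms(3)
proof (induction k arbitrary: f)
  case 0
  then show ?case
    using assms(2) by (auto intro: bounded_linear.continuous_on)
next
  case (Suc k)
  have *: "f differentiable (at x)" if "x \<in> S" for x using Suc that by simp
  have "(\<lambda>x. L (f x)) differentiable (at x)" if "x \<in> S" for x
    using *[OF that] bounded_linear.has_derivative[OF assms(2)] unfolding differentiable_def by blast
  moreover have "Ck_on k (\<lambda>x. frechet_derivative (\<lambda>x. L (f x)) (at x) v) S" for v
  proof -
    have "Ck_on k (\<lambda>x. L (frechet_derivative f (at x) v)) S"
      using Suc by simp
    then show ?thesis
      by (subst Ck_on_cong[OF assms(1)]) (auto simp: frechet_derivative_bounded_linear[OF assms(2) *])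
  qed
  ultimately show ?case by simp
qed

lemma Ck_on_plus:
  assumes "open S" "Ck_on k f S" "Ck_on k g S"
  shows "Ck_on k (\<lambda>x. f x + g x) S"
  using assms(2,3)
proof (induction k arbitrary: f g)
  case 0
  then show ?case by (auto intro: continuous_on_add)
next
  case (Suc k)
  have *: "f differentiable (at x)" "g differentiable (at x)" if "x \<in> S" for x using Suc that by auto
  have "Ck_on k (\<lambda>x. frechet_derivative (\<lambda>x. f x + g x) (at x) v) S" for v
  proof -
    have "Ck_on k (\<lambda>x. frechet_derivative f (at x) v + frechet_derivative g (at x) v) S"
      using Suc by simp
    then show ?thesis
      by (subst Ck_on_cong[OF assms(1)]) (auto simp: frechet_derivative_plus_fun *)
  qed
  then show ?case using * by simp
qed

lemma smooth_on_bounded_linear: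
  "open S \<Longrightarrow> bounded_linear L \<Longrightarrow> smooth_on f S \<Longrightarrow> smooth_on (\<lambda>x. L (f x)) S"
  by (simp add: smooth_on_def Ck_on_bounded_linear)

lemma smooth_on_plus:
  "open S \<Longrightarrow> smooth_on f S \<Longrightarrow> smooth_on g S \<Longrightarrow> smooth_on (\<lambda>x. f x + g x) S"
  by (simp add: smooth_on_def Ck_on_plus)

lemma smooth_on_differentiable: "smooth_on f S \<Longrightarrow> x \<in> S \<Longrightarrow> f differentiable (at x)"
  unfolding smooth_on_def by (metis Ck_on.simps(2))

lemma smooth_on_frechet_derivative:
  "smooth_on f S \<Longrightarrow> smooth_on (\<lambda>x. frechet_derivative f (at x) v) S"
  unfolding smooth_on_def by (metis Ck_on.simps(2))

lemma smooth_on_continuous: "smooth_on f S \<Longrightarrow> continuous_on S f"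
  unfolding smooth_on_def by (metis Ck_on.simps(1))

text \<open>The mean value argument needs real values, so the two vectors are compared along each
  basis vector.\<close>

lemma mixed_derivatives_commute:
  fixes f :: "'a::real_normed_vector \<Rightarrow> 'b::euclidean_space"
  assumes "open S" "x \<in> S" "smooth_on f S"
  shows "frechet_derivative (\<lambda>y. frechet_derivative f (at y) u) (at x) v
    = frechet_derivative (\<lambda>y. frechet_derivative f (at y) v) (at x) u"
proof (rule euclidean_eqI)
  fix b :: 'b assume "b \<in> Basis"
  have bl: "bounded_linear (\<lambda>z::'b. z \<bullet> b)" by (rule bounded_linear_inner_left)
  define g where "g = (\<lambda>x. f x \<bullet> b)"
  have g: "smooth_on g S"
    unfolding g_def by (rule smooth_on_bounded_linear[OF assms(1) bl assms(3)])
  have 1: "frechet_derivative g (at y) w = frechet_derivative f (at y) w \<bullet> b" if "y \<in> S" for y w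
    unfolding g_def
    using frechet_derivative_bounded_linear[OF bl smooth_on_differentiable[OF assms(3) that]] by simp
  have 2: "frechet_derivative (\<lambda>y. frechet_derivative g (at y) w) (at x) w'
    = frechet_derivative (\<lambda>y. frechet_derivative f (at y) w) (at x) w' \<bullet> b" for w w'
  proof -
    have "frechet_derivative (\<lambda>y. frechet_derivative g (at y) w) (at x)
        = frechet_derivative (\<lambda>y. frechet_derivative f (at y) w \<bullet> b) (at x)"
      by (rule frechet_derivative_cong_open[OF assms(1,2) 1])
    then show ?thesis
      using frechet_derivative_bounded_linear[OF bl
        smooth_on_differentiable[OF smooth_on_frechet_derivative[OF assms(3)] assms(2)]] by simp
  qed
  show "frechet_derivative (\<lambda>y. frechet_derivative f (at y) u) (at x) v \<bullet> b =
         frechet_derivative (\<lambda>y. frechet_derivative f (at y) v) (at x) u \<bullet> b"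
    unfolding 2[symmetric]
    using g by (intro mixed_derivatives_commute_real[OF assms(1,2)])
      (auto intro: smooth_on_differentiable smooth_on_frechet_derivative smooth_on_continuous)
qed

section \<open>The exterior derivative on a manifold\<close>

locale manifold =
  fixes X :: "('x::{t2_space, second_countable_topology}, 'v::euclidean_space) chart set"
  assumes manifold: "smooth_manifold X"
begin

abbreviation base_chart ("\<kappa>") where "\<kappa> \<equiv> chart_at X"

abbreviation trans :: "('x, 'v) chart \<Rightarrow> ('x, 'v) chart \<Rightarrow> 'v \<Rightarrow> 'v" where
  "trans c d \<equiv> snd d \<circ> cinv c"

lemma chart_at: "\<kappa> p \<in> X" "p \<in> fst (\<kappa> p)"
proof -
  have "\<exists>c. c \<in> X \<and> p \<in> fst c"
    using manifold unfolding smooth_manifold_def by blast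
  then have "\<kappa> p \<in> X \<and> p \<in> fst (\<kappa> p)"
    unfolding chart_at_def by (rule someI_ex)
  then show "\<kappa> p \<in> X" "p \<in> fst (\<kappa> p)" by auto
qed

lemma chart_homeo:
  assumes "c \<in> X"
  shows "homeomorphism (fst c) (snd c ` fst c) (snd c) (cinv c)"
  using manifold assms unfolding smooth_manifold_def by blast

lemma cinv_chart [simp]: "c \<in> X \<Longrightarrow> p \<in> fst c \<Longrightarrow> cinv c (snd c p) = p"
  using chart_homeo by (simp add: homeomorphism_def)

lemma open_chart_image:
  assumes "c \<in> X" "d \<in> X"
  shows "open (snd c ` (fst c \<inter> fst d))"
proof -
  have o: "open (fst c)" "open (fst d)" "open (snd c ` fst c)"
    using manifold assms unfolding smooth_manifold_def by blast+
  have "openin (top_of_set (fst c)) (fst c \<inter> fst d)"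
    using o by (auto simp: openin_open)
  then have "openin (top_of_set (snd c ` fst c)) (snd c ` (fst c \<inter> fst d))"
    using homeomorphism_imp_open_map[OF chart_homeo[OF assms(1)]] by blast
  then show ?thesis
    using o(3) openin_open_trans by blast
qed

lemma open_chart_range: "c \<in> X \<Longrightarrow> open (snd c ` fst c)"
  using open_chart_image[of c c] by simp

lemma smooth_trans:
  "c \<in> X \<Longrightarrow> d \<in> X \<Longrightarrow> smooth_on (trans c d) (snd c ` (fst c \<inter> fst d))"
  using manifold unfolding smooth_manifold_def by blast

lemma trans_differentiable:
  "c \<in> X \<Longrightarrow> d \<in> X \<Longrightarrow> p \<in> fst c \<Longrightarrow> p \<in> fst d \<Longrightarrow> trans c d differentiable (at (snd c p))"
  using smooth_on_differentiable[OF smooth_trans] by blast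

text \<open>The transition from \<open>c\<close> to the base chart at \<open>p\<close> factors
  through \<open>d\<close> near \<open>p\<close>; this is the chain rule for that
  factorisation.\<close>

lemma from_chart_trans:
  assumes "c \<in> X" "d \<in> X" "p \<in> fst c" "p \<in> fst d"
  shows "from_chart X c p v = from_chart X d p (frechet_derivative (trans c d) (at (snd c p)) v)"
proof -
  let ?e = "\<kappa> p"
  have "frechet_derivative (trans c ?e) (at (snd c p))
    = frechet_derivative (trans d ?e \<circ> trans c d) (at (snd c p))"
    using assms by (intro frechet_derivative_cong_open[OF open_chart_image[OF assms(1,2)]]) auto
  also have "\<dots> = frechet_derivative (trans d ?e) (at (trans c d (snd c p)))
      \<circ> frechet_derivative (trans c d) (at (snd c p))"
  proof (rule frechet_derivative_compose)
    show "trans c d differentiable (at (snd c p))" by (rule trans_differentiable[OF assms])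
    show "trans d ?e differentiable (at (trans c d (snd c p)))"
      using trans_differentiable[OF assms(2) chart_at(1) assms(4) chart_at(2)] assms by simp
  qed
  finally show ?thesis
    using assms by (simp add: from_chart_def)
qed

lemma from_chart_base [simp]: "from_chart X (\<kappa> p) p v = v"
proof -
  have "frechet_derivative (trans (\<kappa> p) (\<kappa> p)) (at (snd (\<kappa> p) p)) = frechet_derivative (\<lambda>x. x) (at (snd (\<kappa> p) p))"
    using chart_at by (intro frechet_derivative_cong_open[OF open_chart_range]) auto
  then show ?thesis by (simp add: from_chart_def)
qed

lemma linear_from_chart: "c \<in> X \<Longrightarrow> p \<in> fst c \<Longrightarrow> linear (from_chart X c p)"
  unfolding from_chart_def
  by (rule linear_frechet_derivative[OF trans_differentiable[OF _ chart_at(1) _ chart_at(2)]])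

text \<open>The pullback law for components. The base chart, which may differ at each point, cancels
  from it, and what is left is smooth in the point.\<close>

lemma rep1_trans:
  assumes "c \<in> X" "d \<in> X" "x \<in> snd c ` (fst c \<inter> fst d)"
  shows "rep1 X c \<omega> x v = rep1 X d \<omega> (trans c d x) (frechet_derivative (trans c d) (at x) v)"
  using assms from_chart_trans[OF assms(1,2)] by (auto simp: rep1_def Let_def)

lemma rep1_base [simp]: "rep1 X (\<kappa> p) \<omega> (snd (\<kappa> p) p) v = \<omega> p v"
  by (simp add: rep1_def chart_at Let_def)

lemma rep2_base [simp]: "rep2 X (\<kappa> p) B (snd (\<kappa> p) p) u v = B p u v"
  by (simp add: rep2_def chart_at Let_def)

lemma linear_rep1:
  assumes "smooth_form1 X UNIV \<omega>" "c \<in> X" "x \<in> snd c ` fst c"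
  shows "linear (rep1 X c \<omega> x)"
proof -
  have 1: "linear (\<omega> p)" for p using assms(1) by (simp add: smooth_form1_def)
  have 2: "linear (from_chart X c (cinv c x))"
    using assms by (auto intro: linear_from_chart)
  have "rep1 X c \<omega> x = \<omega> (cinv c x) \<circ> from_chart X c (cinv c x)"
    by (simp add: fun_eq_iff rep1_def Let_def)
  with linear_compose[OF 2 1] show ?thesis by (simp only:)
qed

lemma smooth_rep1:
  assumes "smooth_form1 X UNIV \<omega>" "c \<in> X"
  shows "smooth_on (\<lambda>x. rep1 X c \<omega> x v) (snd c ` fst c)"
  using assms by (auto simp: smooth_form1_def)

text \<open>Naturality of \<^const>\<open>d1\<close>: the terms with second derivatives of the transition map cancel.\<close>

lemma rep2_d1:
  fixes \<omega> :: "('x, 'v) form1"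
  assumes \<omega>: "smooth_form1 X UNIV \<omega>" and c: "c \<in> X" and x: "x \<in> snd c ` fst c"
  shows "rep2 X c (d1 X \<omega>) x u v =
    frechet_derivative (\<lambda>y. rep1 X c \<omega> y v) (at x) u - frechet_derivative (\<lambda>y. rep1 X c \<omega> y u) (at x) v"
proof -
  define p where "p = cinv c x"
  define d where "d = \<kappa> p"
  define S where "S = snd c ` (fst c \<inter> fst d)"
  define \<tau> where "\<tau> = trans c d"
  define D where "D = frechet_derivative \<tau> (at x)"
  have p: "p \<in> fst c" "p \<in> fst d" "snd c p = x"
    using x c chart_at by (auto simp: p_def d_def)
  have d: "d \<in> X" using chart_at by (simp add: d_def)
  have S: "open S" "x \<in> S" using open_chart_image[OF c d] p by (auto simp: S_def)
  have \<tau>x: "\<tau> x = snd d p" by (simp add: \<tau>_def p_def)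
  have \<tau>: "smooth_on \<tau> S" unfolding \<tau>_def S_def by (rule smooth_trans[OF c d])
  have \<tau>': "(\<tau> has_derivative D) (at x)"
    unfolding D_def using smooth_on_differentiable[OF \<tau> S(2)] frechet_derivative_works by blast
  define r where "r = (\<lambda>w. frechet_derivative (\<lambda>y. rep1 X d \<omega> y w) (at (\<tau> x)))"
  have \<tau>xd: "\<tau> x \<in> snd d ` fst d" using p \<tau>x by auto
  have lin: "linear (rep1 X d \<omega> (\<tau> x))" by (rule linear_rep1[OF \<omega> d \<tau>xd])
  have r: "((\<lambda>y. rep1 X d \<omega> y w) has_derivative r w) (at (\<tau> x))" for w
    unfolding r_def frechet_derivative_works[symmetric]
    by (rule smooth_on_differentiable[OF smooth_rep1[OF \<omega> d] \<tau>xd])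
  \<comment> \<open>After a change of chart the form is evaluated on a vector that itself moves with
    the point. Expanding this vector in a basis makes the value a finite sum of products, to which
    the product rule applies.\<close>
  have euc: "L w = (\<Sum>b\<in>Basis. (w \<bullet> b) *\<^sub>R L b)" if "linear L" for L :: "'v \<Rightarrow> complex" and w
  proof -
    have "L w = L (\<Sum>b\<in>Basis. (w \<bullet> b) *\<^sub>R b)" by (simp add: euclidean_representation)
    then show ?thesis using that by (simp only: linear_sum linear_scale o_def)
  qed
  have r_lin: "r w h = (\<Sum>b\<in>Basis. (w \<bullet> b) *\<^sub>R r b h)" for w h
  proof -
    have "((\<lambda>y. \<Sum>b\<in>Basis. (w \<bullet> b) *\<^sub>R rep1 X d \<omega> y b) has_derivative
        (\<lambda>h. \<Sum>b\<in>Basis. (w \<bullet> b) *\<^sub>R r b h)) (at (\<tau> x))"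
      by (intro has_derivative_sum has_derivative_scaleR_right r)
    then have "((\<lambda>y. rep1 X d \<omega> y w) has_derivative
        (\<lambda>h. \<Sum>b\<in>Basis. (w \<bullet> b) *\<^sub>R r b h)) (at (\<tau> x))"
      by (rule has_derivative_transform_within_open[OF _ open_chart_range[OF d] \<tau>xd])
        (rule euc[OF linear_rep1[OF \<omega> d], symmetric])
    from has_derivative_unique[OF r this] show ?thesis by (rule fun_cong)
  qed
  \<comment> \<open>The first summand is symmetric in \<open>w\<close> and \<open>h\<close> by the
    equality of mixed derivatives, hence disappears from the antisymmetrised expression; the second
    one is what \<open>d1\<close> computes in the base chart.\<close>
  have key: "frechet_derivative (\<lambda>y. rep1 X c \<omega> y w) (at x) h
    = rep1 X d \<omega> (\<tau> x) (frechet_derivative (\<lambda>y. frechet_derivative \<tau> (at y) w) (at x) h)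
      + r (D w) (D h)" for w h
  proof -
    define T where "T = frechet_derivative (\<lambda>y. frechet_derivative \<tau> (at y) w) (at x)"
    have T: "((\<lambda>y. frechet_derivative \<tau> (at y) w) has_derivative T) (at x)"
      unfolding T_def frechet_derivative_works[symmetric]
      by (rule smooth_on_differentiable[OF smooth_on_frechet_derivative[OF \<tau>] S(2)])
    have "((\<lambda>y. \<Sum>b\<in>Basis. (frechet_derivative \<tau> (at y) w \<bullet> b) *\<^sub>R rep1 X d \<omega> (\<tau> y) b) has_derivative
        (\<lambda>h. \<Sum>b\<in>Basis. (frechet_derivative \<tau> (at x) w \<bullet> b) *\<^sub>R r b (D h)
            + (T h \<bullet> b) *\<^sub>R rep1 X d \<omega> (\<tau> x) b)) (at x)"
      by (intro has_derivative_sum has_derivative_scaleR has_derivative_inner_left T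
          has_derivative_compose[OF \<tau>' r])
    then have "((\<lambda>y. rep1 X c \<omega> y w) has_derivative
        (\<lambda>h. \<Sum>b\<in>Basis. (D w \<bullet> b) *\<^sub>R r b (D h)
            + (T h \<bullet> b) *\<^sub>R rep1 X d \<omega> (\<tau> x) b)) (at x)"
      unfolding D_def[symmetric]
    proof (rule has_derivative_transform_within_open[OF _ S])
      fix y assume y: "y \<in> S"
      then have "\<tau> y \<in> snd d ` fst d" using c by (auto simp: S_def \<tau>_def)
      from euc[OF linear_rep1[OF \<omega> d this], symmetric]
      have "(\<Sum>b\<in>Basis. (frechet_derivative \<tau> (at y) w \<bullet> b) *\<^sub>R rep1 X d \<omega> (\<tau> y) b)
        = rep1 X d \<omega> (\<tau> y) (frechet_derivative \<tau> (at y) w)" .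
      also have "\<dots> = rep1 X c \<omega> y w"
        using rep1_trans[OF c d, of y \<omega> w] y by (simp add: S_def \<tau>_def)
      finally show "(\<Sum>b\<in>Basis. (frechet_derivative \<tau> (at y) w \<bullet> b) *\<^sub>R rep1 X d \<omega> (\<tau> y) b)
        = rep1 X c \<omega> y w" .
    qed
    from fun_cong[OF frechet_derivative_at[OF this, symmetric], of h]
    show ?thesis
      unfolding T_def[symmetric] r_lin[of "D w" "D h"] euc[OF lin, of "T h"]
      by (simp only: sum.distrib add.commute)
  qed
  have "rep2 X c (d1 X \<omega>) x u v = d1 X \<omega> p (D u) (D v)"
    by (simp add: rep2_def p_def[symmetric] Let_def from_chart_def p(3) d_def[symmetric] \<tau>_def[symmetric] D_def)
  also have "\<dots> = r (D v) (D u) - r (D u) (D v)"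
    by (simp add: d1_def d_def[symmetric] r_def \<tau>x Let_def)
  finally show ?thesis
    unfolding key using mixed_derivatives_commute[OF S \<tau>, of u v] by simp
qed

text \<open>By \<open>rep2_d1\<close> the form \<open>d1 X \<omega>\<close> is an antisymmetrised
  derivative on the whole domain of the base chart at \<open>p\<close>, not only at \<open>p\<close>
  itself. It can therefore be differentiated again there, and the second derivatives cancel in
  pairs.\<close>

theorem d2_d1:
  fixes \<omega> :: "('x, 'v) form1"
  assumes \<omega>: "smooth_form1 X UNIV \<omega>"
  shows "d2 X (d1 X \<omega>) = 0"
proof (intro ext)
  fix p u v w
  define c where "c = \<kappa> p"
  define x where "x = snd c p"
  define S where "S = snd c ` fst c"
  define g where "g = (\<lambda>v y. rep1 X c \<omega> y v)"
  have c: "c \<in> X" "p \<in> fst c" using chart_at by (auto simp: c_def)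
  have S: "open S" "x \<in> S" using open_chart_range c by (auto simp: S_def x_def)
  have g: "smooth_on (g v) S" for v using smooth_rep1[OF \<omega> c(1)] by (simp add: g_def S_def)
  let ?D = "\<lambda>v u. frechet_derivative (\<lambda>y. frechet_derivative (g v) (at y) u) (at x)"
  have sym: "?D a b e = ?D a e b" for a b e
    using mixed_derivatives_commute[OF S g] by blast
  have dg: "(\<lambda>y. frechet_derivative (g a) (at y) b) differentiable (at x)" for a b
    by (rule smooth_on_differentiable[OF smooth_on_frechet_derivative[OF g] S(2)])
  have "frechet_derivative (\<lambda>y. rep2 X c (d1 X \<omega>) y a b) (at x) e = ?D b a e - ?D a b e" for a b e
  proof -
    have "frechet_derivative (\<lambda>y. rep2 X c (d1 X \<omega>) y a b) (at x)
      = frechet_derivative (\<lambda>y. frechet_derivative (g b) (at y) a - frechet_derivative (g a) (at y) b) (at x)"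
      by (rule frechet_derivative_cong_open[OF S])
        (simp add: rep2_d1[OF \<omega> c(1)] S_def g_def)
    also have "\<dots> = (\<lambda>e. ?D b a e - ?D a b e)"
      using dg by (intro frechet_derivative_at[symmetric] has_derivative_diff)
        (auto simp: frechet_derivative_works[symmetric])
    finally show ?thesis by simp
  qed
  then show "d2 X (d1 X \<omega>) p u v w = 0 p u v w"
    by (simp add: d2_def c_def[symmetric] x_def[symmetric] Let_def sym)
qed

end

section \<open>Linear operations on forms and the product rule\<close>

lemma sum_fun_apply: "(\<Sum>i\<in>I. f i) x = (\<Sum>i\<in>I. f i x)"
  by (induction I rule: infinite_finite_induct) auto

lemma bounded_linear_mult_complex: "bounded_linear (\<lambda>x::complex. z * x)"
  by (rule bounded_linear_mult_right)

context manifold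
begin

lemma smooth_form1_plus:
  assumes "smooth_form1 X UNIV a" "smooth_form1 X UNIV b"
  shows "smooth_form1 X UNIV (a + b)"
proof -
  have "linear ((a + b) p)" for p
    using assms linear_compose_add[of "a p" "b p"] by (simp add: smooth_form1_def plus_fun_def)
  moreover have "rep1 X c (a + b) x v = rep1 X c a x v + rep1 X c b x v" for c x v
    by (simp add: rep1_def Let_def)
  ultimately show ?thesis
    using assms by (auto simp: smooth_form1_def intro!: smooth_on_plus open_chart_range)
qed

lemma smooth_form1_cscale:
  assumes "smooth_form1 X UNIV a"
  shows "smooth_form1 X UNIV (z \<cdot> a)"
proof -
  have "(z \<cdot> a) p = (\<lambda>x. z * x) \<circ> a p" for p by (simp add: fun_eq_iff cscale_def)
  then have "linear ((z \<cdot> a) p)" for p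
    using assms linear_compose[of "a p" "\<lambda>x. z * x"] bounded_linear_mult_complex[of z]
    by (simp add: smooth_form1_def bounded_linear.linear)
  moreover have "rep1 X c (z \<cdot> a) x v = z * rep1 X c a x v" for c x v
    by (simp add: rep1_def Let_def cscale_def)
  ultimately show ?thesis
    using assms smooth_on_bounded_linear[OF open_chart_range bounded_linear_mult_complex[of z]]
    by (simp add: smooth_form1_def)
qed

lemma smooth_form1_cj:
  assumes "smooth_form1 X UNIV a"
  shows "smooth_form1 X UNIV (cj a)"
proof -
  have "cj a p = cnj \<circ> a p" for p by (simp add: fun_eq_iff cj_def)
  then have "linear (cj a p)" for p
    using assms linear_compose[of "a p" cnj] bounded_linear_cnj
    by (simp add: smooth_form1_def bounded_linear.linear)
  moreover have "rep1 X c (cj a) x v = cnj (rep1 X c a x v)" for c x v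
    by (simp add: rep1_def Let_def cj_def)
  ultimately show ?thesis
    using assms smooth_on_bounded_linear[OF open_chart_range bounded_linear_cnj]
    by (simp add: smooth_form1_def)
qed

text \<open>At a point, \<open>d1\<close> looks only at the first derivative in the base chart
  there. This weak condition passes to multiples by smooth functions through the product rule, so
  smoothness of such products need not be established.\<close>

definition diff_form1 :: "('x, 'v) form1 \<Rightarrow> bool" where
  "diff_form1 a \<longleftrightarrow> (\<forall>p v. (\<lambda>x. rep1 X (\<kappa> p) a x v) differentiable (at (snd (\<kappa> p) p)))"

lemma smooth_imp_diff_form1: "smooth_form1 X UNIV a \<Longrightarrow> diff_form1 a"
  unfolding diff_form1_def
  using smooth_on_differentiable[OF smooth_rep1[OF _ chart_at(1)]] chart_at(2) by blast

lemma smooth_fun_differentiable: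
  assumes "smooth_fun X UNIV f"
  shows "(f \<circ> cinv (\<kappa> p)) differentiable (at (snd (\<kappa> p) p))"
  using assms chart_at[of p] by (auto simp: smooth_fun_def intro: smooth_on_differentiable)

lemma d1_plus:
  assumes "diff_form1 a" "diff_form1 b"
  shows "d1 X (a + b) = d1 X a + d1 X b"
proof -
  have "rep1 X c (a + b) x v = rep1 X c a x v + rep1 X c b x v" for c x v
    by (simp add: rep1_def Let_def)
  then show ?thesis
    using assms by (simp add: fun_eq_iff d1_def Let_def diff_form1_def frechet_derivative_plus_fun)
qed

lemma d1_cscale:
  assumes "diff_form1 a"
  shows "d1 X (z \<cdot> a) p u v = z * d1 X a p u v"
proof -
  have "rep1 X c (z \<cdot> a) x v = z * rep1 X c a x v" for c x v
    by (simp add: rep1_def Let_def cscale_def)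
  then show ?thesis
    using assms by (simp add: fun_eq_iff d1_def Let_def diff_form1_def right_diff_distrib
      frechet_derivative_bounded_linear[OF bounded_linear_mult_complex[of z]])
qed

lemma d1_cj:
  assumes "diff_form1 a"
  shows "d1 X (cj a) p u v = cnj (d1 X a p u v)"
proof -
  have "rep1 X c (cj a) x v = cnj (rep1 X c a x v)" for c x v
    by (simp add: rep1_def Let_def cj_def)
  then show ?thesis
    using assms by (simp add: fun_eq_iff d1_def Let_def diff_form1_def
      frechet_derivative_bounded_linear[OF bounded_linear_cnj])
qed

lemma rep1_fscale: "rep1 X c (f \<odot> a) x v = (f \<circ> cinv c) x * rep1 X c a x v"
  by (simp add: rep1_def Let_def fscale_def)

lemma fscale_has_derivative:
  assumes "smooth_fun X UNIV f" "diff_form1 a"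
  shows "((\<lambda>x. rep1 X (\<kappa> p) (f \<odot> a) x v) has_derivative
    (\<lambda>u. f p * frechet_derivative (\<lambda>x. rep1 X (\<kappa> p) a x v) (at (snd (\<kappa> p) p)) u + d0 X f p u * a p v))
      (at (snd (\<kappa> p) p))"
proof -
  have 1: "((f \<circ> cinv (\<kappa> p)) has_derivative d0 X f p) (at (snd (\<kappa> p) p))"
    using smooth_fun_differentiable[OF assms(1)]
    by (simp add: d0_def[abs_def] Let_def frechet_derivative_works[symmetric])
  have 2: "((\<lambda>x. rep1 X (\<kappa> p) a x v) has_derivative
      frechet_derivative (\<lambda>x. rep1 X (\<kappa> p) a x v) (at (snd (\<kappa> p) p))) (at (snd (\<kappa> p) p))"
    using assms(2) by (simp add: diff_form1_def frechet_derivative_works[symmetric])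
  show ?thesis
    unfolding rep1_fscale using has_derivative_mult[OF 1 2] by (simp add: chart_at)
qed

lemma diff_form1_fscale: "smooth_fun X UNIV f \<Longrightarrow> diff_form1 a \<Longrightarrow> diff_form1 (f \<odot> a)"
  unfolding diff_form1_def differentiable_def
  using fscale_has_derivative[unfolded diff_form1_def differentiable_def] by blast

lemma d1_fscale:
  assumes "smooth_fun X UNIV f" "diff_form1 a"
  shows "d1 X (f \<odot> a) p u v = (d0 X f \<sqinter>\<^sub>1 a) p u v + f p * d1 X a p u v"
  unfolding d1_def Let_def wedge_def
    frechet_derivative_at[OF fscale_has_derivative[OF assms], symmetric]
  by (simp add: algebra_simps)

lemma diff_form1_cscale: "diff_form1 a \<Longrightarrow> diff_form1 (z \<cdot> a)"
proof -
  assume a: "diff_form1 a"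
  have "rep1 X c (z \<cdot> a) x v = z * rep1 X c a x v" for c x v
    by (simp add: rep1_def Let_def cscale_def)
  then show ?thesis using a by (simp add: diff_form1_def)
qed

text \<open>The rule d(a b) = (da) b - a (db) for wedge products. A two-form commutes with a
  one-form, so (da) b is written with \<open>b\<close> on the left, as
  \<open>\<sqinter>\<^sub>2\<close> requires. The sum is treated as a whole, which avoids a separate
  notion of differentiability for two-forms.\<close>

theorem d2_sum_wedge:
  fixes a b :: "'i \<Rightarrow> ('x, 'v) form1"
  assumes "\<And>i. i \<in> I \<Longrightarrow> diff_form1 (a i)" "\<And>i. i \<in> I \<Longrightarrow> diff_form1 (b i)"
  shows "d2 X (\<Sum>i\<in>I. a i \<sqinter>\<^sub>1 b i) p u v w
    = (\<Sum>i\<in>I. (b i \<sqinter>\<^sub>2 d1 X (a i)) p u v w - (a i \<sqinter>\<^sub>2 d1 X (b i)) p u v w)"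
proof -
  let ?c = "\<kappa> p" and ?x = "snd (\<kappa> p) p"
  let ?D = "\<lambda>a v. frechet_derivative (\<lambda>x. rep1 X ?c a x v) (at ?x)"
  have a': "((\<lambda>x. rep1 X ?c (a i) x v) has_derivative ?D (a i) v) (at ?x)" if "i \<in> I" for i v
    using assms(1)[OF that] by (simp add: diff_form1_def frechet_derivative_works[symmetric])
  have b': "((\<lambda>x. rep1 X ?c (b i) x v) has_derivative ?D (b i) v) (at ?x)" if "i \<in> I" for i v
    using assms(2)[OF that] by (simp add: diff_form1_def frechet_derivative_works[symmetric])
  have "frechet_derivative (\<lambda>x. rep2 X ?c (\<Sum>i\<in>I. a i \<sqinter>\<^sub>1 b i) x v w) (at ?x) u
    = (\<Sum>i\<in>I. a i p v * ?D (b i) w u + ?D (a i) v u * b i p w - (a i p w * ?D (b i) v u + ?D (a i) w u * b i p v))"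
    for u v w
  proof -
    have "((\<lambda>x. \<Sum>i\<in>I. rep1 X ?c (a i) x v * rep1 X ?c (b i) x w - rep1 X ?c (a i) x w * rep1 X ?c (b i) x v)
      has_derivative (\<lambda>u. \<Sum>i\<in>I. rep1 X ?c (a i) ?x v * ?D (b i) w u + ?D (a i) v u * rep1 X ?c (b i) ?x w
       - (rep1 X ?c (a i) ?x w * ?D (b i) v u + ?D (a i) w u * rep1 X ?c (b i) ?x v))) (at ?x)"
      by (intro has_derivative_sum has_derivative_diff has_derivative_mult a' b')
    moreover have "rep2 X ?c (\<Sum>i\<in>I. a i \<sqinter>\<^sub>1 b i) x v w
      = (\<Sum>i\<in>I. rep1 X ?c (a i) x v * rep1 X ?c (b i) x w - rep1 X ?c (a i) x w * rep1 X ?c (b i) x v)" for x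
      by (simp add: rep2_def rep1_def Let_def wedge_def sum_fun_apply)
    ultimately show ?thesis
      by (simp add: frechet_derivative_at[symmetric])
  qed
  then show ?thesis
    unfolding d2_def Let_def
    by (simp add: wedge3_def d1_def Let_def sum.distrib[symmetric] sum_subtractf[symmetric])
      (simp add: algebra_simps)
qed

end

section \<open>The Bianchi identity of a symplectic Cartan connection\<close>

lemma (in manifold) d0_cnj:
  fixes f :: "'x \<Rightarrow> complex"
  assumes "smooth_fun X UNIV f"
  shows "d0 X (\<lambda>p. z * cnj (f p)) p u = z * cnj (d0 X f p u)"
proof -
  have bl: "bounded_linear (\<lambda>x. z * cnj x)"
    by (rule bounded_linear_compose[OF bounded_linear_mult_complex bounded_linear_cnj])
  show ?thesis
    using frechet_derivative_bounded_linear[OF bl smooth_fun_differentiable[OF assms]]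
    by (simp add: d0_def Let_def o_def)
qed

lemma wedge3_rotate: "(a \<sqinter>\<^sub>2 b \<sqinter>\<^sub>1 c) p u v w = (b \<sqinter>\<^sub>2 c \<sqinter>\<^sub>1 a) p u v w"
  by (simp add: wedge3_def wedge_def algebra_simps)

lemma wedge3_swap: "(a \<sqinter>\<^sub>2 b \<sqinter>\<^sub>1 c) p u v w = - (b \<sqinter>\<^sub>2 a \<sqinter>\<^sub>1 c) p u v w"
  by (simp add: wedge3_def wedge_def algebra_simps)

lemma wedge3_sum:
  assumes "\<And>x y. B p x y = (\<Sum>i\<in>I. c i * (b i \<sqinter>\<^sub>1 e i) p x y)"
  shows "(a \<sqinter>\<^sub>2 B) p u v w = (\<Sum>i\<in>I. c i * (a \<sqinter>\<^sub>2 b i \<sqinter>\<^sub>1 e i) p u v w)"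
  unfolding wedge3_def assms sum_distrib_left sum_subtractf[symmetric] sum.distrib[symmetric]
  by (rule sum.cong) (simp_all add: algebra_simps)

lemma wedge3_cong: "(\<And>x y. B p x y = B' p x y) \<Longrightarrow> (a \<sqinter>\<^sub>2 B) p u v w = (a \<sqinter>\<^sub>2 B') p u v w"
  by (simp add: wedge3_def)

lemma wedge3_add_right: "(a \<sqinter>\<^sub>2 (B + B')) p u v w = (a \<sqinter>\<^sub>2 B) p u v w + (a \<sqinter>\<^sub>2 B') p u v w"
  by (simp add: wedge3_def algebra_simps)

lemma wedge_cscale: "(z \<cdot> a \<sqinter>\<^sub>1 b) p u v = z * (a \<sqinter>\<^sub>1 b) p u v"
  by (simp add: wedge_def cscale_def algebra_simps)

lemma wedge_fscale: "(f \<odot> a \<sqinter>\<^sub>1 b) p u v = f p * (a \<sqinter>\<^sub>1 b) p u v"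
  by (simp add: wedge_def fscale_def algebra_simps)

text \<open>The index type of the family of products in \<open>second_Bianchi\<close>: single
  indices for the quadratic terms of the structure equation, pairs for its curvature terms.\<close>

lemma sum_UNIV_sum_prod:
  fixes f :: "'a::finite + 'b::finite \<times> 'c::finite \<Rightarrow> 'd::comm_monoid_add"
  shows "(\<Sum>\<^sub>*i. f i) = (\<Sum>\<^sub>*R. f (Inl R)) + (\<Sum>\<^sub>*R S. f (Inr (R, S)))"
proof -
  have "(\<Sum>\<^sub>*i. f i) = (\<Sum>\<^sub>*R. f (Inl R)) + (\<Sum>\<^sub>*x. f (Inr x))"
    unfolding UNIV_Plus_UNIV[symmetric] by (subst sum.Plus) (auto simp: o_def)
  also have "(\<Sum>\<^sub>*x. f (Inr x)) = (\<Sum>\<^sub>*R S. f (Inr (R, S)))"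
    by (simp add: sum.cartesian_product case_prod_unfold)
  finally show ?thesis .
qed

lemma sum_symm_alt_eq_0:
  fixes T t :: "'a \<Rightarrow> 'a \<Rightarrow> complex"
  assumes "\<And>R S. T R S = T S R" "\<And>R S. t R S = - t S R"
  shows "(\<Sum>R\<in>I. \<Sum>S\<in>I. T R S * t R S) = 0"
proof -
  have "(\<Sum>R\<in>I. \<Sum>S\<in>I. T R S * t R S) = (\<Sum>S\<in>I. \<Sum>R\<in>I. T R S * t R S)"
    by (rule sum.swap)
  also have "\<dots> = - (\<Sum>S\<in>I. \<Sum>R\<in>I. T S R * t S R)"
    unfolding sum_negf[symmetric]
  proof (intro sum.cong refl)
    fix R S show "T R S * t R S = - (T S R * t S R)"
      using assms(1)[of R S] assms(2)[of R S] by simp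
  qed
  finally show ?thesis by simp
qed

text \<open>\<open>st P\<close> is the index dual to \<open>P\<close>, and \<open>j P\<close> is the
  only nonzero entry in row \<open>P\<close> of the inverse symplectic form, so that
  \<open>j (st P) = - j P\<close> is its skewness. Matrices that are symmetric with both indices
  lowered are those of the symplectic algebra. Vanishing of \<open>T\<close> is demanded in the
  leading slot and reaches the other slots by symmetry.\<close>

locale sp_connection = manifold X
  for X :: "('x::{t2_space, second_countable_topology}, 'v::euclidean_space) chart set" +
  fixes \<Omega> :: "'w::finite \<Rightarrow> 'w \<Rightarrow> ('x, 'v) form1"
    and T :: "'w \<Rightarrow> 'w \<Rightarrow> 'w \<Rightarrow> 'w \<Rightarrow> 'x \<Rightarrow> complex"
    and st :: "'w \<Rightarrow> 'w" and j :: "'w \<Rightarrow> complex" and o1 o2 :: 'w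
  assumes st_st [simp]: "st (st P) = P"
    and j_st [simp]: "j (st P) = - j P"
    and \<Omega>_sym: "\<Omega> P Q = \<Omega> Q P"
    and \<Omega>_smooth: "smooth_form1 X UNIV (\<Omega> P Q)"
    and T_smooth: "smooth_fun X UNIV (T P Q R S)"
    and T_sym: "T P Q R S = T Q P R S" "T P Q R S = T P R Q S" "T P Q R S = T P Q S R"
    and T_zero: "T o1 Q R S p = 0" "T o2 Q R S p = 0"
    and o12: "o1 \<noteq> o2"
begin

definition con :: "'w \<Rightarrow> 'w \<Rightarrow> ('x, 'v) form1" where
  "con R U = j R \<cdot> \<Omega> (st R) U"

definition curv :: "'w \<Rightarrow> 'w \<Rightarrow> ('x, 'v) form2" where
  "curv P Q p u v = (\<Sum>\<^sub>*R S. T P Q R S p * (con R o1 \<sqinter>\<^sub>1 con S o2) p u v)"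

definition structure_eq :: "'w \<Rightarrow> 'w \<Rightarrow> bool" where
  "structure_eq P Q \<longleftrightarrow> (\<forall>p u v. d1 X (\<Omega> P Q) p u v =
     - (\<Sum>\<^sub>*R. j R * (\<Omega> P R \<sqinter>\<^sub>1 \<Omega> (st R) Q) p u v) + curv P Q p u v)"

text \<open>The last summand is the trace of the connection on the plane of \<open>o1\<close>,
  \<open>o2\<close>. It stems from the terms of d(\<open>con R o1\<close>) and
  d(\<open>con S o2\<close>) that run through this plane, and it appears explicitly because the
  Bianchi identity sums only over the indices outside the plane.\<close>

definition DT :: "'w \<Rightarrow> 'w \<Rightarrow> 'w \<Rightarrow> 'w \<Rightarrow> ('x, 'v) form1" where
  "DT P Q R S p u = d0 X (T P Q R S) p u
     - (\<Sum>\<^sub>*U. T U Q R S p * con U P p u) - (\<Sum>\<^sub>*U. T P U R S p * con U Q p u)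
     - (\<Sum>\<^sub>*U. T P Q U S p * con U R p u) - (\<Sum>\<^sub>*U. T P Q R U p * con U S p u)
     + T P Q R S p * (con o1 o1 p u + con o2 o2 p u)"

lemma T_zeros:
  assumes "a \<in> {o1, o2}"
  shows "T a Q R S p = 0" "T P a R S p = 0" "T P Q a S p = 0" "T P Q R a p = 0"
  using assms T_zero T_sym by (metis insertE singletonD)+

lemma T_sym34: "T P Q R S p = T P Q S R p" by (simp add: T_sym(3)[of P Q R S])

lemma sum_st: "(\<Sum>\<^sub>*R. f (st R)) = (\<Sum>\<^sub>*R. f R :: complex)"
  by (rule sum.reindex_bij_witness[of _ st st]) auto

lemma con_smooth: "smooth_form1 X UNIV (con R U)"
  by (simp add: con_def smooth_form1_cscale \<Omega>_smooth)

text \<open>Replacing the summation index by its dual changes the sign of \<open>j\<close>, and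
  interchanging the two factors changes the sign of the wedge product.\<close>

lemma structure_eq_sym:
  assumes "structure_eq P Q" shows "structure_eq Q P"
proof -
  have "(\<Sum>\<^sub>*R. j R * (\<Omega> Q R \<sqinter>\<^sub>1 \<Omega> (st R) P) p u v) = (\<Sum>\<^sub>*R. j R * (\<Omega> P R \<sqinter>\<^sub>1 \<Omega> (st R) Q) p u v)" for p u v
  proof -
    have "(\<Sum>\<^sub>*R. j R * (\<Omega> Q R \<sqinter>\<^sub>1 \<Omega> (st R) P) p u v)
      = (\<Sum>\<^sub>*R. j (st R) * (\<Omega> Q (st R) \<sqinter>\<^sub>1 \<Omega> R P) p u v)"
      using sum_st[of "\<lambda>R. j R * (\<Omega> Q R \<sqinter>\<^sub>1 \<Omega> (st R) P) p u v"] by simp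
    also have "\<dots> = (\<Sum>\<^sub>*R. j R * (\<Omega> P R \<sqinter>\<^sub>1 \<Omega> (st R) Q) p u v)"
      by (intro sum.cong refl) (simp add: wedge_def \<Omega>_sym[of Q] \<Omega>_sym[of _ P] algebra_simps)
    finally show ?thesis .
  qed
  moreover have "curv Q P = curv P Q" by (simp add: fun_eq_iff curv_def T_sym(1)[of Q P])
  ultimately show ?thesis using assms \<Omega>_sym[of P Q] by (simp add: structure_eq_def)
qed

text \<open>\<open>T\<close> vanishes on \<open>o1\<close> and \<open>o2\<close>, so the two columns
  from which the curvature is built satisfy structure equations without curvature term.\<close>

lemma d1_con:
  assumes "\<And>P Q. structure_eq P Q" "a \<in> {o1, o2}"
  shows "d1 X (con R a) p u v = (\<Sum>\<^sub>*U. - 1 * (con R U \<sqinter>\<^sub>1 con U a) p u v)"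
proof -
  have "curv (st R) a p u v = 0" by (simp add: curv_def T_zeros[OF assms(2)])
  then show ?thesis
    using assms(1)[of "st R" a]
    unfolding con_def d1_cscale[OF smooth_imp_diff_form1[OF \<Omega>_smooth]]
    by (simp add: structure_eq_def sum_distrib_left sum_negf[symmetric])
      (intro sum.cong refl, simp add: wedge_def cscale_def algebra_simps)
qed

text \<open>Substituting the structure equations into the derivative of their own right-hand side
  leaves four kinds of terms. Products of three connection forms cancel; products of a connection
  form with the curvature correct the indices \<open>P\<close> and \<open>Q\<close> of
  \<open>T\<close>; the derivatives of the two columns correct \<open>R\<close> and \<open>S\<close>
  and leave the trace; the differential of \<open>T\<close> remains.\<close>

theorem second_Bianchi:
  assumes eq: "\<And>P Q. structure_eq P Q"
  shows "(\<Sum>R\<in>- {o1, o2}. \<Sum>S\<in>- {o1, o2}. (DT P Q R S \<sqinter>\<^sub>2 con R o1 \<sqinter>\<^sub>1 con S o2) p u v w) = 0"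
proof -
  let ?N = "- {o1, o2}"
  define t where "t = (\<lambda>a b c :: ('x, 'v) form1. (a \<sqinter>\<^sub>2 b \<sqinter>\<^sub>1 c) p u v w)"
  define E1 where "E1 = (\<lambda>R. con R o1)"
  define E2 where "E2 = (\<lambda>R. con R o2)"
  have rot: "t a b c = t b c a" for a b c unfolding t_def by (rule wedge3_rotate)
  have swp: "t a b c = - t b a c" for a b c unfolding t_def by (rule wedge3_swap)
  have t_scale: "t (z \<cdot> a) b c = z * t a b c" for z a b c
    by (simp add: t_def wedge3_def cscale_def algebra_simps)
  have E: "d1 X (E1 R) p u v = (\<Sum>\<^sub>*U. - 1 * (con R U \<sqinter>\<^sub>1 E1 U) p u v)"
    "d1 X (E2 R) p u v = (\<Sum>\<^sub>*U. - 1 * (con R U \<sqinter>\<^sub>1 E2 U) p u v)" for R u v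
    unfolding E1_def E2_def by (rule d1_con[OF eq]; simp)+
  have sE: "diff_form1 (E1 R)" "diff_form1 (E2 R)" for R
    unfolding E1_def E2_def by (rule smooth_imp_diff_form1[OF con_smooth])+
  have s\<Omega>: "diff_form1 (\<Omega> R S)" for R S by (rule smooth_imp_diff_form1[OF \<Omega>_smooth])
  have K: "(a \<sqinter>\<^sub>2 curv P Q) p u v w = (\<Sum>\<^sub>*R S. T P Q R S p * t a (E1 R) (E2 S))" for a P Q
    unfolding t_def sum.cartesian_product
    by (rule trans[OF wedge3_sum[where I = UNIV and c = "\<lambda>(R, S). T P Q R S p"
          and b = "\<lambda>(R, S). E1 R" and e = "\<lambda>(R, S). E2 S"]])
      (simp_all add: curv_def sum.cartesian_product case_prod_unfold E1_def E2_def)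
  have d\<Omega>: "(a \<sqinter>\<^sub>2 d1 X (\<Omega> P Q)) p u v w
    = - (\<Sum>\<^sub>*R. j R * t a (\<Omega> P R) (\<Omega> (st R) Q)) + (a \<sqinter>\<^sub>2 curv P Q) p u v w" for a P Q
  proof -
    have "(a \<sqinter>\<^sub>2 d1 X (\<Omega> P Q)) p u v w = (a \<sqinter>\<^sub>2
        ((\<lambda>p u v. \<Sum>\<^sub>*R. - j R * (\<Omega> P R \<sqinter>\<^sub>1 \<Omega> (st R) Q) p u v) + curv P Q)) p u v w"
      using eq[of P Q] by (intro wedge3_cong) (simp add: structure_eq_def sum_negf)
    also have "\<dots> = (\<Sum>\<^sub>*R. - j R * t a (\<Omega> P R) (\<Omega> (st R) Q)) + (a \<sqinter>\<^sub>2 curv P Q) p u v w"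
      unfolding wedge3_add_right t_def by (rule arg_cong2[where f = "(+)"], rule wedge3_sum) auto
    finally show ?thesis by (simp add: sum_negf)
  qed
  \<comment> \<open>Quadratic and curvature terms are put into one family of wedge products, so that
    the product rule is applied once to the complete right-hand side.\<close>
  define a where "a = case_sum (\<lambda>R. (- j R) \<cdot> \<Omega> P R) (\<lambda>(R, S). T P Q R S \<odot> E1 R)"
  define b where "b = case_sum (\<lambda>R. \<Omega> (st R) Q) (\<lambda>(R :: 'w, S). E2 S)"
  have "d1 X (\<Omega> P Q) = (\<Sum>i\<in>UNIV. a i \<sqinter>\<^sub>1 b i)"
  proof (intro ext)
    fix p u v
    show "d1 X (\<Omega> P Q) p u v = (\<Sum>i\<in>UNIV. a i \<sqinter>\<^sub>1 b i) p u v"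
      using eq[of P Q]
      unfolding sum_fun_apply sum_UNIV_sum_prod a_def b_def curv_def
      by (simp add: structure_eq_def wedge_cscale wedge_fscale E1_def E2_def sum_negf curv_def)
  qed
  moreover have "diff_form1 (a i)" for i
    by (cases i) (auto simp: a_def intro!: diff_form1_cscale s\<Omega> diff_form1_fscale T_smooth sE)
  moreover have "diff_form1 (b i)" for i
    by (cases i) (auto simp: b_def intro!: s\<Omega> sE)
  ultimately have "(\<Sum>\<^sub>*i. (b i \<sqinter>\<^sub>2 d1 X (a i)) p u v w - (a i \<sqinter>\<^sub>2 d1 X (b i)) p u v w) = 0"
    using d2_sum_wedge[of UNIV a b p u v w] d2_d1[OF \<Omega>_smooth[of P Q]]
    by (simp only: zero_fun_apply)
  moreover have "(\<Omega> (st R) Q \<sqinter>\<^sub>2 d1 X ((- j R) \<cdot> \<Omega> P R)) p u v w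
    = (\<Sum>\<^sub>*U. j R * j U * t (\<Omega> P U) (\<Omega> (st U) R) (\<Omega> (st R) Q)) - (con R Q \<sqinter>\<^sub>2 curv P R) p u v w" for R
  proof -
    have "(\<Omega> (st R) Q \<sqinter>\<^sub>2 d1 X ((- j R) \<cdot> \<Omega> P R)) p u v w = - j R * (\<Omega> (st R) Q \<sqinter>\<^sub>2 d1 X (\<Omega> P R)) p u v w"
      by (simp add: wedge3_def d1_cscale[OF s\<Omega>] algebra_simps)
    also have "\<dots> = (\<Sum>\<^sub>*U. j R * j U * t (\<Omega> P U) (\<Omega> (st U) R) (\<Omega> (st R) Q)) - (con R Q \<sqinter>\<^sub>2 curv P R) p u v w"
      unfolding d\<Omega> rot[of "\<Omega> (st R) Q"]
      by (simp add: algebra_simps sum_distrib_left wedge3_def con_def cscale_def sum_negf)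
    finally show ?thesis .
  qed
  moreover have "((- j R) \<cdot> \<Omega> P R \<sqinter>\<^sub>2 d1 X (\<Omega> (st R) Q)) p u v w
    = (\<Sum>\<^sub>*U. j R * j U * t (\<Omega> P R) (\<Omega> (st R) U) (\<Omega> (st U) Q)) + (con (st R) P \<sqinter>\<^sub>2 curv (st R) Q) p u v w" for R
    unfolding d\<Omega> t_scale
    by (simp add: algebra_simps sum_distrib_left sum_negf wedge3_def con_def cscale_def \<Omega>_sym[of P])
  moreover have "(E2 S \<sqinter>\<^sub>2 d1 X (T P Q R S \<odot> E1 R)) p u v w
    = t (d0 X (T P Q R S)) (E1 R) (E2 S) - (\<Sum>\<^sub>*U. T P Q R S p * t (con R U) (E1 U) (E2 S))" for R S
  proof -
    have "(E2 S \<sqinter>\<^sub>2 d1 X (T P Q R S \<odot> E1 R)) p u v w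
      = t (E2 S) (d0 X (T P Q R S)) (E1 R) + T P Q R S p * (E2 S \<sqinter>\<^sub>2 d1 X (E1 R)) p u v w"
      by (simp add: t_def wedge3_def d1_fscale[OF T_smooth sE(1)] algebra_simps)
    also have "(E2 S \<sqinter>\<^sub>2 d1 X (E1 R)) p u v w = (\<Sum>\<^sub>*U. - 1 * t (E2 S) (con R U) (E1 U))"
      unfolding t_def by (rule wedge3_sum) (rule E)
    finally show ?thesis
      by (simp add: rot[of "E2 S"] sum_negf sum_distrib_left)
  qed
  moreover have "(T P Q R S \<odot> E1 R \<sqinter>\<^sub>2 d1 X (E2 S)) p u v w
    = (\<Sum>\<^sub>*U. T P Q R S p * t (con S U) (E1 R) (E2 U))" for R S
  proof -
    have "(T P Q R S \<odot> E1 R \<sqinter>\<^sub>2 d1 X (E2 S)) p u v w = T P Q R S p * (E1 R \<sqinter>\<^sub>2 d1 X (E2 S)) p u v w"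
      by (simp add: wedge3_def fscale_def algebra_simps)
    also have "(E1 R \<sqinter>\<^sub>2 d1 X (E2 S)) p u v w = (\<Sum>\<^sub>*U. - 1 * t (E1 R) (con S U) (E2 U))"
      unfolding t_def by (rule wedge3_sum) (rule E)
    finally show ?thesis
      by (simp add: swp[of "E1 R"] sum_negf sum_distrib_left)
  qed
  ultimately have main: "(\<Sum>\<^sub>*R. (\<Sum>\<^sub>*U. j R * j U * t (\<Omega> P U) (\<Omega> (st U) R) (\<Omega> (st R) Q)) - (con R Q \<sqinter>\<^sub>2 curv P R) p u v w
       - ((\<Sum>\<^sub>*U. j R * j U * t (\<Omega> P R) (\<Omega> (st R) U) (\<Omega> (st U) Q)) + (con (st R) P \<sqinter>\<^sub>2 curv (st R) Q) p u v w))
     + (\<Sum>\<^sub>*R S. t (d0 X (T P Q R S)) (E1 R) (E2 S) - (\<Sum>\<^sub>*U. T P Q R S p * t (con R U) (E1 U) (E2 S))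
         - (\<Sum>\<^sub>*U. T P Q R S p * t (con S U) (E1 R) (E2 U))) = 0"
    unfolding sum_UNIV_sum_prod a_def b_def by simp
  \<comment> \<open>Both triple sums are the cube of the connection matrix, bracketed from the left
    and from the right; exchanging the names \<open>R\<close> and \<open>U\<close> identifies
    them.\<close>
  have cubic: "(\<Sum>\<^sub>*R U. j R * j U * t (\<Omega> P U) (\<Omega> (st U) R) (\<Omega> (st R) Q))
    = (\<Sum>\<^sub>*R U. j R * j U * t (\<Omega> P R) (\<Omega> (st R) U) (\<Omega> (st U) Q))"
    by (subst sum.swap) (simp add: mult.commute)
  have conP: "(\<Sum>\<^sub>*R. (con (st R) P \<sqinter>\<^sub>2 curv (st R) Q) p u v w) = (\<Sum>\<^sub>*R. (con R P \<sqinter>\<^sub>2 curv R Q) p u v w)"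
    by (rule sum_st)
  have restrict: "(\<Sum>\<^sub>*R S. T P Q R S p * f R S) = (\<Sum>R\<in>?N. \<Sum>S\<in>?N. T P Q R S p * f R S)" for P Q f
  proof -
    have "(\<Sum>S\<in>UNIV. T P Q R S p * f R S) = (\<Sum>S\<in>?N. T P Q R S p * f R S)" for R
      by (rule sum.mono_neutral_right) (auto simp: T_zeros)
    moreover have "(\<Sum>R\<in>UNIV. \<Sum>S\<in>?N. T P Q R S p * f R S) = (\<Sum>R\<in>?N. \<Sum>S\<in>?N. T P Q R S p * f R S)"
      by (rule sum.mono_neutral_right) (auto simp: T_zeros)
    ultimately show ?thesis by simp
  qed
  have split: "(\<Sum>\<^sub>*R. f R) = (\<Sum>R\<in>?N. f R) + f o1 + f o2" for f :: "'w \<Rightarrow> complex"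
  proof -
    have "(\<Sum>\<^sub>*R. f R) = (\<Sum>R\<in>?N. f R) + (\<Sum>R\<in>{o1, o2}. f R)"
      using sum.subset_diff[of "{o1, o2}" UNIV f] by (simp add: Compl_eq_Diff_UNIV)
    then show ?thesis using o12 by simp
  qed
  \<comment> \<open>Where an index lies in the plane, \<open>T\<close> is identically zero as a
    function, hence so is its differential.\<close>
  have d0T: "(\<Sum>\<^sub>*R S. t (d0 X (T P Q R S)) (E1 R) (E2 S)) = (\<Sum>R\<in>?N. \<Sum>S\<in>?N. t (d0 X (T P Q R S)) (E1 R) (E2 S))"
  proof -
    have 0: "d0 X (T P Q R S) = 0" if "R \<in> {o1, o2} \<or> S \<in> {o1, o2}" for R S
    proof -
      have "T P Q R S = (\<lambda>p. 0)" using that by (auto simp: fun_eq_iff T_zeros)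
      then show ?thesis by (simp add: fun_eq_iff d0_def Let_def o_def)
    qed
    have t0: "t 0 b c = 0" for b c by (simp add: t_def wedge3_def)
    have "(\<Sum>S\<in>UNIV. t (d0 X (T P Q R S)) (E1 R) (E2 S)) = (\<Sum>S\<in>?N. t (d0 X (T P Q R S)) (E1 R) (E2 S))" for R
      by (rule sum.mono_neutral_right) (auto simp: 0 t0)
    moreover have "(\<Sum>R\<in>UNIV. \<Sum>S\<in>?N. t (d0 X (T P Q R S)) (E1 R) (E2 S))
        = (\<Sum>R\<in>?N. \<Sum>S\<in>?N. t (d0 X (T P Q R S)) (E1 R) (E2 S))"
      by (rule sum.mono_neutral_right) (auto simp: 0 t0)
    ultimately show ?thesis by simp
  qed
  let ?c1 = "con o1 o1" and ?c2 = "con o2 o2"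
  \<comment> \<open>\<open>U\<close> is split into the indices outside the plane, \<open>o1\<close>
    and \<open>o2\<close>. For \<open>U = o2\<close> the column \<open>E2\<close> occurs twice,
    which vanishes against the symmetric \<open>T\<close>; \<open>U = o1\<close> gives half of the
    trace. In \<open>part2\<close> the roles of \<open>o1\<close> and \<open>o2\<close> are
    exchanged.\<close>
  have part1: "(\<Sum>\<^sub>*R S U. T P Q R S p * t (con R U) (E1 U) (E2 S))
    = (\<Sum>R\<in>?N. \<Sum>S\<in>?N. \<Sum>\<^sub>*U. T P Q U S p * t (con U R) (E1 R) (E2 S))
      - (\<Sum>R\<in>?N. \<Sum>S\<in>?N. T P Q R S p * t ?c1 (E1 R) (E2 S))"
  proof -
    have "(\<Sum>\<^sub>*R S U. T P Q R S p * t (con R U) (E1 U) (E2 S))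
      = (\<Sum>\<^sub>*R U S. T P Q R S p * t (con R U) (E1 U) (E2 S))"
      by (intro sum.cong refl sum.swap)
    also have "\<dots> = (\<Sum>\<^sub>*U R S. T P Q R S p * t (con R U) (E1 U) (E2 S))"
      by (rule sum.swap)
    also have "\<dots> = (\<Sum>U\<in>?N. \<Sum>\<^sub>*R S. T P Q R S p * t (con R U) (E1 U) (E2 S))
      + (\<Sum>\<^sub>*R S. T P Q R S p * t (E1 R) ?c1 (E2 S)) + (\<Sum>\<^sub>*R S. T P Q R S p * t (E2 R) (con o2 o1) (E2 S))"
      unfolding split by (simp add: E1_def E2_def)
    also have "(\<Sum>\<^sub>*R S. T P Q R S p * t (E2 R) (con o2 o1) (E2 S)) = 0"
      by (rule sum_symm_alt_eq_0) (use T_sym34 rot swp in metis)+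
    also have "(\<Sum>\<^sub>*R S. T P Q R S p * t (E1 R) ?c1 (E2 S)) = - (\<Sum>\<^sub>*R S. T P Q R S p * t ?c1 (E1 R) (E2 S))"
      unfolding swp[of _ ?c1] by (simp add: sum_negf)
    also have "(\<Sum>U\<in>?N. \<Sum>\<^sub>*R S. T P Q R S p * t (con R U) (E1 U) (E2 S))
      = (\<Sum>R\<in>?N. \<Sum>\<^sub>*S U. T P Q U S p * t (con U R) (E1 R) (E2 S))"
      by (intro sum.cong refl sum.swap)
    also have "\<dots> = (\<Sum>R\<in>?N. \<Sum>S\<in>?N. \<Sum>\<^sub>*U. T P Q U S p * t (con U R) (E1 R) (E2 S))"
      by (intro sum.cong refl sum.mono_neutral_right) (auto simp: T_zeros)
    finally show ?thesis unfolding restrict by simp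
  qed
  have part2: "(\<Sum>\<^sub>*R S U. T P Q R S p * t (con S U) (E1 R) (E2 U))
    = (\<Sum>R\<in>?N. \<Sum>S\<in>?N. \<Sum>\<^sub>*U. T P Q R U p * t (con U S) (E1 R) (E2 S))
      - (\<Sum>R\<in>?N. \<Sum>S\<in>?N. T P Q R S p * t ?c2 (E1 R) (E2 S))"
  proof -
    have "(\<Sum>\<^sub>*R S U. T P Q R S p * t (con S U) (E1 R) (E2 U))
      = (\<Sum>\<^sub>*R U S. T P Q R S p * t (con S U) (E1 R) (E2 U))"
      by (intro sum.cong refl sum.swap)
    also have "\<dots> = (\<Sum>\<^sub>*R. (\<Sum>S\<in>?N. \<Sum>\<^sub>*U. T P Q R U p * t (con U S) (E1 R) (E2 S)))
      + (\<Sum>\<^sub>*R S. T P Q R S p * t (E1 S) (E1 R) (con o1 o2)) + (\<Sum>\<^sub>*R S. T P Q R S p * t (E2 S) (E1 R) ?c2)"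
      unfolding split[where f = "\<lambda>U. \<Sum>\<^sub>*S. T P Q _ S p * t (con S U) _ (E2 U)"] by (simp add: E1_def E2_def sum.distrib)
    also have "(\<Sum>\<^sub>*R S. T P Q R S p * t (E1 S) (E1 R) (con o1 o2)) = 0"
      by (rule sum_symm_alt_eq_0) (use T_sym34 rot swp in metis)+
    also have "(\<Sum>\<^sub>*R S. T P Q R S p * t (E2 S) (E1 R) ?c2) = - (\<Sum>\<^sub>*R S. T P Q R S p * t ?c2 (E1 R) (E2 S))"
      unfolding swp[of "E2 _" "E1 _" ?c2] rot[of ?c2] by (simp add: sum_negf)
    also have "(\<Sum>\<^sub>*R. (\<Sum>S\<in>?N. \<Sum>\<^sub>*U. T P Q R U p * t (con U S) (E1 R) (E2 S)))
      = (\<Sum>R\<in>?N. \<Sum>S\<in>?N. \<Sum>\<^sub>*U. T P Q R U p * t (con U S) (E1 R) (E2 S))"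
      by (intro sum.mono_neutral_right) (auto simp: T_zeros)
    finally show ?thesis unfolding restrict by simp
  qed
  have part3: "(\<Sum>\<^sub>*U. (con U Q \<sqinter>\<^sub>2 curv P U) p u v w)
    = (\<Sum>R\<in>?N. \<Sum>S\<in>?N. \<Sum>\<^sub>*U. T P U R S p * t (con U Q) (E1 R) (E2 S))"
    unfolding K restrict by (subst sum.swap) (intro sum.cong refl sum.swap)
  have part4: "(\<Sum>\<^sub>*U. (con U P \<sqinter>\<^sub>2 curv U Q) p u v w)
    = (\<Sum>R\<in>?N. \<Sum>S\<in>?N. \<Sum>\<^sub>*U. T U Q R S p * t (con U P) (E1 R) (E2 S))"
    unfolding K restrict by (subst sum.swap) (intro sum.cong refl sum.swap)
  have t_DT: "t (DT P Q R S) b c = t (d0 X (T P Q R S)) b c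
     - (\<Sum>\<^sub>*U. T U Q R S p * t (con U P) b c) - (\<Sum>\<^sub>*U. T P U R S p * t (con U Q) b c)
     - (\<Sum>\<^sub>*U. T P Q U S p * t (con U R) b c) - (\<Sum>\<^sub>*U. T P Q R U p * t (con U S) b c)
     + T P Q R S p * t ?c1 b c + T P Q R S p * t ?c2 b c" for R S b c
    by (simp add: t_def wedge3_def DT_def algebra_simps sum_distrib_left sum_distrib_right sum.distrib sum_subtractf)
  have "(\<Sum>R\<in>?N. \<Sum>S\<in>?N. t (DT P Q R S) (E1 R) (E2 S)) = 0"
    using main unfolding t_DT sum_subtractf sum.distrib cubic conP d0T part1 part2 part3 part4
    by (simp add: sum_subtractf sum.distrib algebra_simps)
  then show ?thesis by (simp add: t_def E1_def E2_def)
qed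

end

text \<open>The antilinear map sending the basis vector of \<open>P\<close> to \<open>t P\<close>
  times that of \<open>bar P\<close> has square -1, because \<open>t (bar P) = - t P\<close> and
  \<open>t P * t P = 1\<close>; it is a quaternionic structure. \<open>j_bar\<close> is its
  compatibility with the symplectic form, and the last two assumptions say that connection and
  curvature are real with respect to it.\<close>

locale real_sp_connection = sp_connection X \<Omega> T st j o1 o2
  for X :: "('x::{t2_space, second_countable_topology}, 'v::euclidean_space) chart set"
    and \<Omega> :: "'w::finite \<Rightarrow> 'w \<Rightarrow> ('x, 'v) form1"
    and T st j o1 o2 +
  fixes bar :: "'w \<Rightarrow> 'w" and t :: "'w \<Rightarrow> complex"
  assumes bar_bar [simp]: "bar (bar P) = P"
    and bar_o1 [simp]: "bar o1 = o2"
    and st_bar: "st (bar P) = bar (st P)"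
    and t_real [simp]: "cnj (t P) = t P"
    and t_square [simp]: "t P * t P = 1"
    and t_bar [simp]: "t (bar P) = - t P"
    and j_real [simp]: "cnj (j P) = j P"
    and j_bar: "j (bar P) = t P * t (st P) * j P"
    and cnj_\<Omega>: "cnj (\<Omega> P Q p u) = t P * t Q * \<Omega> (bar P) (bar Q) p u"
    and cnj_T: "cnj (T P Q R S p) = t P * t Q * t R * t S * T (bar P) (bar Q) (bar R) (bar S) p"
begin

lemma bar_o2 [simp]: "bar o2 = o1"
  using bar_bar[of o1] by simp

lemma t_cancel [simp]: "t P * (t P * z) = z"
  by (simp add: mult.assoc[symmetric])

lemma sum_bar: "(\<Sum>\<^sub>*R. f (bar R)) = (\<Sum>\<^sub>*R. f R :: complex)"
  by (rule sum.reindex_bij_witness[of _ bar bar]) auto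

lemma cnj_con: "cnj (con R U p u) = t R * t U * con (bar R) (bar U) p u"
  by (simp add: con_def cscale_def cnj_\<Omega> st_bar j_bar algebra_simps)

text \<open>Conjugation exchanges \<open>o1\<close> and \<open>o2\<close>, so the curvature term
  comes back with its two columns in the opposite order. The opposite signs \<open>t o1\<close>,
  \<open>t o2\<close> and the symmetry of \<open>T\<close> in its last two indices compensate for
  this.\<close>

lemma structure_eq_bar:
  assumes "structure_eq P Q"
  shows "structure_eq (bar P) (bar Q)"
  unfolding structure_eq_def
proof (intro allI)
  fix p u v
  have "\<Omega> (bar P) (bar Q) = (t P * t Q) \<cdot> cj (\<Omega> P Q)"
    by (simp add: fun_eq_iff cscale_def cj_def cnj_\<Omega> algebra_simps)
  then have "d1 X (\<Omega> (bar P) (bar Q)) p u v = t P * t Q * cnj (d1 X (\<Omega> P Q) p u v)"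
    by (simp add: d1_cscale d1_cj smooth_imp_diff_form1 smooth_form1_cj \<Omega>_smooth)
  also have "\<dots> = - (\<Sum>\<^sub>*R. t P * t Q * (j R * cnj ((\<Omega> P R \<sqinter>\<^sub>1 \<Omega> (st R) Q) p u v)))
      + t P * t Q * cnj (curv P Q p u v)"
    unfolding assms[unfolded structure_eq_def, rule_format]
    by (simp add: algebra_simps sum_distrib_left sum_negf)
  also have "(\<Sum>\<^sub>*R. t P * t Q * (j R * cnj ((\<Omega> P R \<sqinter>\<^sub>1 \<Omega> (st R) Q) p u v)))
    = (\<Sum>\<^sub>*R. j (bar R) * (\<Omega> (bar P) (bar R) \<sqinter>\<^sub>1 \<Omega> (st (bar R)) (bar Q)) p u v)"
    by (intro sum.cong refl) (simp add: wedge_def cnj_\<Omega> j_bar st_bar algebra_simps)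
  also have "\<dots> = (\<Sum>\<^sub>*R. j R * (\<Omega> (bar P) R \<sqinter>\<^sub>1 \<Omega> (st R) (bar Q)) p u v)"
    by (rule sum_bar)
  also have "t P * t Q * cnj (curv P Q p u v)
    = (\<Sum>\<^sub>*R S. T (bar P) (bar Q) (bar R) (bar S) p * (con (bar S) o1 \<sqinter>\<^sub>1 con (bar R) o2) p u v)"
  proof -
    have "t o2 = - t o1" using t_bar[of o1] by simp
    then show ?thesis
      unfolding curv_def cnj_sum sum_distrib_left
      by (intro sum.cong refl) (simp add: wedge_def cnj_con cnj_T algebra_simps)
  qed
  also have "\<dots> = (\<Sum>\<^sub>*S R. T (bar P) (bar Q) (bar R) (bar S) p * (con (bar S) o1 \<sqinter>\<^sub>1 con (bar R) o2) p u v)"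
    by (rule sum.swap)
  also have "\<dots> = (\<Sum>\<^sub>*S R. T (bar P) (bar Q) R (bar S) p * (con (bar S) o1 \<sqinter>\<^sub>1 con R o2) p u v)"
    by (intro sum.cong refl sum_bar)
  also have "\<dots> = (\<Sum>\<^sub>*S R. T (bar P) (bar Q) R S p * (con S o1 \<sqinter>\<^sub>1 con R o2) p u v)"
    by (rule sum_bar)
  also have "\<dots> = curv (bar P) (bar Q) p u v"
    unfolding curv_def by (intro sum.cong refl arg_cong2[where f = "(*)"] T_sym34)
  finally show "d1 X (\<Omega> (bar P) (bar Q)) p u v =
     - (\<Sum>\<^sub>*R. j R * (\<Omega> (bar P) R \<sqinter>\<^sub>1 \<Omega> (st R) (bar Q)) p u v) + curv (bar P) (bar Q) p u v" .
qed

text \<open>The sums over \<open>U\<close> are reindexed by \<open>bar\<close>, and the two summands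
  of the trace are conjugate to each other. Starred forms thus have to be recognised in one
  component of each conjugate pair only.\<close>

lemma cnj_DT: "cnj (DT P Q R S p u) = t P * t Q * t R * t S * DT (bar P) (bar Q) (bar R) (bar S) p u"
proof -
  let ?t = "t P * t Q * t R * t S"
  have "T (bar P) (bar Q) (bar R) (bar S) = (\<lambda>p. ?t * cnj (T P Q R S p))"
    by (simp add: fun_eq_iff cnj_T algebra_simps)
  then have d: "?t * d0 X (T (bar P) (bar Q) (bar R) (bar S)) p u = cnj (d0 X (T P Q R S) p u)"
    using d0_cnj[OF T_smooth, of "?t" P Q R S p u] by (simp add: algebra_simps)
  have "cnj (\<Sum>\<^sub>*U. T U Q R S p * con U P p u)
      = ?t * (\<Sum>\<^sub>*U. T U (bar Q) (bar R) (bar S) p * con U (bar P) p u)"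
    "cnj (\<Sum>\<^sub>*U. T P U R S p * con U Q p u)
      = ?t * (\<Sum>\<^sub>*U. T (bar P) U (bar R) (bar S) p * con U (bar Q) p u)"
    "cnj (\<Sum>\<^sub>*U. T P Q U S p * con U R p u)
      = ?t * (\<Sum>\<^sub>*U. T (bar P) (bar Q) U (bar S) p * con U (bar R) p u)"
    "cnj (\<Sum>\<^sub>*U. T P Q R U p * con U S p u)
      = ?t * (\<Sum>\<^sub>*U. T (bar P) (bar Q) (bar R) U p * con U (bar S) p u)"
    unfolding cnj_sum sum_distrib_left
    by (subst (2) sum_bar[symmetric], intro sum.cong refl, simp add: cnj_con cnj_T algebra_simps)+
  then show ?thesis
    by (simp add: DT_def d[symmetric] cnj_con cnj_T algebra_simps)
qed

end

section \<open>The canonical coframing as a symplectic connection\<close>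

datatype 'i sp_index = Greek 'i | Lo bool | Up bool

lemma UNIV_sp_index: "UNIV = range Greek \<union> {Lo True, Lo False, Up True, Up False}" (is "UNIV = ?A")
proof -
  have "P \<in> ?A" for P :: "'a sp_index"
  proof (cases P)
    case (Lo b) then show ?thesis by (cases b) simp_all
  next
    case (Up b) then show ?thesis by (cases b) simp_all
  qed simp
  then show ?thesis by blast
qed

instance sp_index :: (finite) finite
  by standard (simp add: UNIV_sp_index)

lemma sum_sp_index:
  fixes f :: "'i::finite sp_index \<Rightarrow> 'a::comm_monoid_add"
  shows "(\<Sum>\<^sub>*P. f P) = (\<Sum>\<^sub>*\<alpha>. f (Greek \<alpha>)) + (f (Lo True) + (f (Lo False) + (f (Up True) + f (Up False))))"
proof -
  let ?B = "{Lo True, Lo False, Up True, Up False :: 'i sp_index}"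
  have "(\<Sum>\<^sub>*P. f P) = sum f (range Greek \<union> ?B)"
    by (rule arg_cong[where f = "sum f"]) (rule UNIV_sp_index)
  also have "\<dots> = sum f (range Greek) + sum f ?B"
    by (rule sum.union_disjoint) auto
  also have "sum f (range Greek) = (\<Sum>\<^sub>*\<alpha>. f (Greek \<alpha>))"
    by (simp add: sum.reindex inj_on_def)
  finally show ?thesis by simp
qed

lemma sum_sp_index':
  fixes f :: "'i::finite sp_index \<Rightarrow> complex"
  shows "(\<Sum>P\<in>- {Lo True, Lo False}. f P) = (\<Sum>\<^sub>*\<alpha>. f (Greek \<alpha>)) + (f (Up True) + f (Up False))"
proof -
  have "(\<Sum>\<^sub>*P. f P) = (\<Sum>P\<in>- {Lo True, Lo False}. f P) + (\<Sum>P\<in>{Lo True, Lo False}. f P)"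
    using sum.subset_diff[of "{Lo True, Lo False}" UNIV f] by (simp add: Compl_eq_Diff_UNIV)
  then show ?thesis unfolding sum_sp_index by simp
qed

text \<open>The shift between \<alpha> and \<alpha> + n. Every array \<pi> is supported on the graph
  of this involution, and \<open>sgn_ix\<close> is the sign that it has there besides
  \<epsilon>.\<close>

fun sw :: "'n + 'n \<Rightarrow> 'n + 'n" where
  "sw (Inl i) = Inr i" | "sw (Inr i) = Inl i"

fun sgn_ix :: "'n + 'n \<Rightarrow> complex" where
  "sgn_ix (Inl i) = 1" | "sgn_ix (Inr i) = - 1"

lemma sw_sw [simp]: "sw (sw \<alpha>) = \<alpha>" by (cases \<alpha>) auto
lemma sw_eq_iff: "\<sigma> = sw \<tau> \<longleftrightarrow> \<tau> = sw \<sigma>" by auto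
lemma sw_inject [simp]: "sw \<alpha> = sw \<beta> \<longleftrightarrow> \<alpha> = \<beta>" by (metis sw_sw)
lemma sgn_sw [simp]: "sgn_ix (sw \<alpha>) = - sgn_ix \<alpha>" by (cases \<alpha>) auto
lemma sgn_real [simp]: "cnj (sgn_ix \<alpha>) = sgn_ix \<alpha>" by (cases \<alpha>) auto
lemma sgn_square [simp]: "sgn_ix \<alpha> * sgn_ix \<alpha> = 1" by (cases \<alpha>) auto
lemma sgn_cancel [simp]: "sgn_ix \<alpha> * (sgn_ix \<alpha> * z) = z" by (cases \<alpha>) auto

lemma sum_sw: "(\<Sum>\<^sub>*\<alpha>. f (sw \<alpha>)) = (\<Sum>\<^sub>*\<alpha>. f \<alpha>)"
  by (rule sum.reindex_bij_witness[of _ sw sw]) auto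

fun star :: "('n + 'n) sp_index \<Rightarrow> ('n + 'n) sp_index" where
  "star (Greek \<alpha>) = Greek (sw \<alpha>)" | "star (Lo b) = Up b" | "star (Up b) = Lo b"

text \<open>The quaternionic structure as a signed permutation. On Greek indices it is the map j of
  the context; on the other indices it exchanges the two labels, because the column containing
  \<open>theta\<close> is conjugate to the one containing \<open>thetab\<close>.\<close>

fun conj_ix :: "('n + 'n) sp_index \<Rightarrow> ('n + 'n) sp_index" where
  "conj_ix (Greek \<alpha>) = Greek (sw \<alpha>)" | "conj_ix (Lo b) = Lo (\<not> b)" | "conj_ix (Up b) = Up (\<not> b)"

fun conj_sign :: "('n + 'n) sp_index \<Rightarrow> complex" where
  "conj_sign (Greek \<alpha>) = sgn_ix \<alpha>"
| "conj_sign (Lo b) = (if b then 1 else - 1)"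
| "conj_sign (Up b) = (if b then 1 else - 1)"

fun symp :: "('n + 'n \<Rightarrow> real) \<Rightarrow> ('n + 'n) sp_index \<Rightarrow> complex" where
  "symp \<epsilon> (Greek \<alpha>) = sgn_ix \<alpha> * of_real (\<epsilon> \<alpha>)" | "symp \<epsilon> (Lo b) = 1" | "symp \<epsilon> (Up b) = - 1"

text \<open>In the differential of \<open>etap\<close> the barred products cancel and the unbarred
  ones, contracted with \<open>pdd\<close>, appear twice. If the first column is normalised to
  contain \<open>theta\<close>, the matrix equation yields them with coefficient -1, whence the
  factor -1/2.\<close>

fun eta2 :: "('x, 'v, 'i, 'z) adapted_scheme \<Rightarrow> bool \<Rightarrow> bool \<Rightarrow> ('x, 'v) form1" where
  "eta2 F b c = (if b = c then (-1/2) \<cdot> (eta F 2 + (if b then \<i> else -\<i>) \<cdot> eta F 3) else (\<i>/2) \<cdot> eta F 1)"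

fun psi2 :: "('x, 'v, 'i, 'z) canonical_scheme \<Rightarrow> bool \<Rightarrow> bool \<Rightarrow> ('x, 'v) form1" where
  "psi2 F b c = (if b = c then (-1) \<cdot> (psi F 2 + (if b then -\<i> else \<i>) \<cdot> psi F 3) else (-\<i>) \<cdot> psi F 1)"

fun varphi2 :: "('x, 'v, 'i, 'z) adapted_scheme \<Rightarrow> bool \<Rightarrow> bool \<Rightarrow> ('x, 'v) form1" where
  "varphi2 F b c = (if b = c then (-1/2) \<cdot> (varphi0 F + (if b then \<i> else -\<i>) \<cdot> varphi F 1)
     else (if b then 1/2 else -1/2) \<cdot> (varphi F 2 + (if b then -\<i> else \<i>) \<cdot> varphi F 3))"

fun theta2 :: "('n + 'n \<Rightarrow> real) \<Rightarrow> ('x, 'v, 'n + 'n, 'z) adapted_scheme \<Rightarrow> 'n + 'n \<Rightarrow> bool \<Rightarrow> ('x, 'v) form1" where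
  "theta2 \<epsilon> F \<alpha> b = (if b then (- sgn_ix \<alpha> * of_real (\<epsilon> \<alpha>)) \<cdot> theta F (sw \<alpha>)
     else (- of_real (\<epsilon> \<alpha>)) \<cdot> thetab F \<alpha>)"

text \<open>In the equation for \<open>theta\<close> these entries multiply
  \<open>(1/2) \<cdot> etap F\<close> and \<open>(-\<i>/2) \<cdot> eta F 1\<close> from the first
  column; the factor 2 absorbs the halves.\<close>

fun phi2 :: "('n + 'n \<Rightarrow> real) \<Rightarrow> ('x, 'v, 'n + 'n, 'z) canonical_scheme \<Rightarrow> 'n + 'n \<Rightarrow> bool \<Rightarrow> ('x, 'v) form1" where
  "phi2 \<epsilon> F \<alpha> b = (if b then (- 2 * of_real (\<epsilon> \<alpha>)) \<cdot> phib F \<alpha>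
     else (2 * sgn_ix \<alpha> * of_real (\<epsilon> \<alpha>)) \<cdot> phi F (sw \<alpha>))"

text \<open>\<open>Lo b\<close> are the indices of the isotropic plane stabilised by the parabolic subalgebra, \<open>Up b\<close> the dual
  ones, where \<open>True\<close> stands for the first and \<open>False\<close> for the second index. Once \<open>\<theta>\<^sup>\<alpha>\<close> is scaled as below,
  the other constants are forced by the structure equations.\<close>

fun conn :: "('n + 'n \<Rightarrow> real) \<Rightarrow> ('x, 'v, 'n + 'n) canonical \<Rightarrow>
    ('n + 'n) sp_index \<Rightarrow> ('n + 'n) sp_index \<Rightarrow> ('x, 'v) form1" where
  "conn \<epsilon> F (Greek \<alpha>) (Greek \<beta>) = Gam F \<alpha> \<beta>"
| "conn \<epsilon> F (Greek \<alpha>) (Lo b) = theta2 \<epsilon> F \<alpha> b"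
| "conn \<epsilon> F (Lo b) (Greek \<alpha>) = theta2 \<epsilon> F \<alpha> b"
| "conn \<epsilon> F (Greek \<alpha>) (Up b) = phi2 \<epsilon> F \<alpha> b"
| "conn \<epsilon> F (Up b) (Greek \<alpha>) = phi2 \<epsilon> F \<alpha> b"
| "conn \<epsilon> F (Lo b) (Lo c) = eta2 F b c"
| "conn \<epsilon> F (Up b) (Up c) = psi2 F b c"
| "conn \<epsilon> F (Up b) (Lo c) = varphi2 F b c"
| "conn \<epsilon> F (Lo c) (Up b) = varphi2 F b c"

fun greek_part :: "'i sp_index \<Rightarrow> 'i list" where
  "greek_part (Greek \<alpha>) = [\<alpha>]" | "greek_part (Lo b) = []" | "greek_part (Up b) = []"

fun is_Lo :: "'i sp_index \<Rightarrow> bool" where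
  "is_Lo (Greek \<alpha>) = False" | "is_Lo (Lo b) = True" | "is_Lo (Up b) = False"

fun up_count :: "'i sp_index \<Rightarrow> nat" where
  "up_count (Greek \<alpha>) = 0" | "up_count (Lo b) = 0" | "up_count (Up b) = (if b then 0 else 1)"

text \<open>The components of the curvature depend only on the Greek indices and on the number \<open>k\<close> of indices
  \<open>Up False\<close>.\<close>

fun curv_comp :: "('x, 'n + 'n) curvature \<Rightarrow> ('n + 'n) list \<Rightarrow> nat \<Rightarrow> 'x \<Rightarrow> complex" where
  "curv_comp K [\<alpha>, \<beta>, \<gamma>, \<delta>] k p = cS K \<alpha> \<beta> \<gamma> \<delta> p"
| "curv_comp K [\<alpha>, \<beta>, \<gamma>] k p = (if k = 0 then 2 * \<i> * cV K \<alpha> \<beta> \<gamma> p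
     else 2 * \<i> * sgn_ix \<alpha> * sgn_ix \<beta> * sgn_ix \<gamma> * cnj (cV K (sw \<alpha>) (sw \<beta>) (sw \<gamma>) p))"
| "curv_comp K [\<alpha>, \<beta>] k p = (if k = 0 then - 4 * \<i> * cM K \<alpha> \<beta> p
     else if k = 1 then - 4 * \<i> * cL K \<alpha> \<beta> p
     else 4 * \<i> * sgn_ix \<alpha> * sgn_ix \<beta> * cnj (cM K (sw \<alpha>) (sw \<beta>) p))"
| "curv_comp K [\<alpha>] k p = (if k = 0 then 8 * \<i> * cH K \<alpha> p
     else if k = 1 then 8 * cC K \<alpha> p
     else if k = 2 then 8 * sgn_ix \<alpha> * cnj (cC K (sw \<alpha>) p)
     else 8 * \<i> * sgn_ix \<alpha> * cnj (cH K (sw \<alpha>) p))"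
| "curv_comp K [] k p = (if k = 0 then 4 * \<i> * cQ K p
     else if k = 1 then - 4 * cP K p
     else if k = 2 then 4 * cR K p
     else if k = 3 then 4 * cnj (cP K p)
     else - 4 * \<i> * cnj (cQ K p))"
| "curv_comp K _ k p = 0"

text \<open>The Greek indices are collected in the order of their slots and the others only counted.
  A permutation of the slots then permutes the list and keeps the count, so total symmetry reduces
  to that of \<open>cS\<close>, \<open>cV\<close>, \<open>cL\<close> and \<open>cM\<close>.\<close>

definition curvT :: "('x, 'n + 'n) curvature \<Rightarrow> ('n + 'n) sp_index \<Rightarrow> ('n + 'n) sp_index \<Rightarrow>
    ('n + 'n) sp_index \<Rightarrow> ('n + 'n) sp_index \<Rightarrow> 'x \<Rightarrow> complex" where
  "curvT K P Q R S p = (if is_Lo P \<or> is_Lo Q \<or> is_Lo R \<or> is_Lo S then 0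
     else curv_comp K (greek_part P @ greek_part Q @ greek_part R @ greek_part S)
       (up_count P + up_count Q + up_count R + up_count S) p)"

section \<open>The constant arrays in closed form\<close>

locale signs =
  fixes \<epsilon> :: "'n::finite + 'n \<Rightarrow> real"
  assumes signs: "sign_constants \<epsilon>"
begin

lemma eps_square [simp]: "complex_of_real (\<epsilon> \<alpha>) * complex_of_real (\<epsilon> \<alpha>) = 1"
  and eps_inverse [simp]: "inverse (complex_of_real (\<epsilon> \<alpha>)) = complex_of_real (\<epsilon> \<alpha>)"
proof -
  have "\<epsilon> \<alpha> = 1 \<or> \<epsilon> \<alpha> = - 1" using signs unfolding sign_constants_def by blast
  then show "complex_of_real (\<epsilon> \<alpha>) * complex_of_real (\<epsilon> \<alpha>) = 1"
    "inverse (complex_of_real (\<epsilon> \<alpha>)) = complex_of_real (\<epsilon> \<alpha>)" by auto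
qed

lemma eps_cancel [simp]: "complex_of_real (\<epsilon> \<alpha>) * (complex_of_real (\<epsilon> \<alpha>) * z) = z"
  by (simp add: mult.assoc[symmetric])

lemma eps_sw [simp]: "\<epsilon> (sw \<alpha>) = \<epsilon> \<alpha>"
  using signs by (cases \<alpha>) (auto simp: sign_constants_def)

lemma gl_eq: "gl \<epsilon> \<alpha> \<beta> = (if \<alpha> = \<beta> then complex_of_real (\<epsilon> \<alpha>) else 0)"
  by (simp add: gl_def)

lemma gu_eq: "gu \<epsilon> \<alpha> \<beta> = (if \<alpha> = \<beta> then complex_of_real (\<epsilon> \<alpha>) else 0)"
  by (simp add: gu_def)

lemma pdd_eq: "pdd \<epsilon> \<alpha> \<beta> = (if \<beta> = sw \<alpha> then sgn_ix \<alpha> * complex_of_real (\<epsilon> \<alpha>) else 0)"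
  by (cases \<alpha>; cases \<beta>) (auto simp: pdd_def)

lemma pbd_eq: "pbd \<epsilon> \<sigma> \<alpha> = (if \<sigma> = sw \<alpha> then sgn_ix \<alpha> else 0)"
proof -
  have "pbd \<epsilon> \<sigma> \<alpha> = (\<Sum>\<^sub>*\<tau>. if \<tau> = \<sigma> then complex_of_real (\<epsilon> \<sigma>) * pdd \<epsilon> \<alpha> \<sigma> else 0)"
    unfolding pbd_def gu_eq by (rule sum.cong) auto
  then show ?thesis by (simp add: pdd_eq)
qed

lemma pub_eq: "pub \<epsilon> \<sigma> \<alpha> = (if \<sigma> = sw \<alpha> then sgn_ix \<alpha> else 0)"
  by (simp add: pub_def pbd_eq)

lemma puu_eq: "puu \<epsilon> \<alpha> \<beta> = (if \<beta> = sw \<alpha> then sgn_ix \<alpha> * complex_of_real (\<epsilon> \<alpha>) else 0)"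
proof -
  have "(\<Sum>\<^sub>*\<tau>. gu \<epsilon> \<alpha> \<sigma> * gu \<epsilon> \<beta> \<tau> * cnj (pdd \<epsilon> \<sigma> \<tau>))
    = (\<Sum>\<^sub>*\<tau>. if \<tau> = \<beta> then gu \<epsilon> \<alpha> \<sigma> * of_real (\<epsilon> \<beta>) * cnj (pdd \<epsilon> \<sigma> \<beta>) else 0)" for \<sigma>
    by (rule sum.cong) (auto simp: gu_eq)
  then have "puu \<epsilon> \<alpha> \<beta> = (\<Sum>\<^sub>*\<sigma>. gu \<epsilon> \<alpha> \<sigma> * of_real (\<epsilon> \<beta>) * cnj (pdd \<epsilon> \<sigma> \<beta>))"
    by (simp add: puu_def)
  also have "\<dots> = (\<Sum>\<^sub>*\<sigma>. if \<sigma> = \<alpha> then of_real (\<epsilon> \<alpha>) * of_real (\<epsilon> \<beta>) * cnj (pdd \<epsilon> \<alpha> \<beta>) else 0)"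
    by (rule sum.cong) (auto simp: gu_eq)
  finally show ?thesis by (auto simp: pdd_eq)
qed

end

lemma (in manifold) smooth_fun_bounded_linear:
  fixes f :: "'x \<Rightarrow> complex"
  assumes "smooth_fun X UNIV f" "bounded_linear L"
  shows "smooth_fun X UNIV (\<lambda>p. L (f p))"
  using assms(1) smooth_on_bounded_linear[OF open_chart_range assms(2)]
  by (fastforce simp: smooth_fun_def o_def)

lemma (in manifold) smooth_fun_scale:
  fixes f :: "'x \<Rightarrow> complex"
  assumes "smooth_fun X UNIV f"
  shows "smooth_fun X UNIV (\<lambda>p. z * f p)"
  by (rule smooth_fun_bounded_linear[OF assms bounded_linear_mult_complex])

lemma (in manifold) smooth_fun_minus:
  fixes f :: "'x \<Rightarrow> complex"
  assumes "smooth_fun X UNIV f"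
  shows "smooth_fun X UNIV (\<lambda>p. - f p)"
  using smooth_fun_scale[OF assms, of "- 1"] by simp

lemma (in manifold) smooth_fun_cnj:
  fixes f :: "'x \<Rightarrow> complex"
  assumes "smooth_fun X UNIV f"
  shows "smooth_fun X UNIV (\<lambda>p. cnj (f p))"
  by (rule smooth_fun_bounded_linear[OF assms bounded_linear_cnj])

text \<open>Isolates the facts on one single manifold from which the identities follow. Reality of
  the tautological forms is derived from the bundles in \<open>P1_forms_real\<close>.\<close>

locale qc_coframing = manifold X + signs \<epsilon>
  for X :: "('x::{t2_space, second_countable_topology}, 'v::euclidean_space) chart set"
    and \<epsilon> :: "'n::finite + 'n \<Rightarrow> real" +
  fixes F :: "('x, 'v, 'n + 'n) canonical" and K :: "('x, 'n + 'n) curvature"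
  assumes adapted_smooth: "smooth_form1 X UNIV (eta F s)" "smooth_form1 X UNIV (theta F \<alpha>)"
      "smooth_form1 X UNIV (varphi0 F)" "smooth_form1 X UNIV (varphi F s)"
    and adapted_real: "real_form UNIV (eta F s)" "real_form UNIV (varphi0 F)" "real_form UNIV (varphi F s)"
    and SE: "SE \<epsilon> X UNIV F"
    and canonical: "canonical_coframing \<epsilon> X F"
    and curvature: "curvature_functions \<epsilon> X F K"
begin

lemma canonical_smooth:
  "smooth_form1 X UNIV (Gam F \<alpha> \<beta>)" "smooth_form1 X UNIV (phi F \<alpha>)" "smooth_form1 X UNIV (psi F s)"
  using canonical by (simp_all add: canonical_coframing_def)

lemma cnj_real_forms [simp]:
  "cnj (eta F s p u) = eta F s p u" "cnj (varphi0 F p u) = varphi0 F p u"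
  "cnj (varphi F s p u) = varphi F s p u" "cnj (psi F s p u) = psi F s p u"
  using adapted_real canonical
  by (simp_all add: real_form_def canonical_coframing_def Reals_cnj_iff)

lemma cnj_Gam: "cnj (Gam F \<alpha> \<beta> p u) = sgn_ix \<alpha> * sgn_ix \<beta> * Gam F (sw \<alpha>) (sw \<beta>) p u"
proof -
  have "Gam F (sw \<alpha>) (sw \<beta>) p u = (\<Sum>\<^sub>*\<sigma> \<tau>. (pbd \<epsilon> \<sigma> (sw \<alpha>) * pbd \<epsilon> \<tau> (sw \<beta>)) \<cdot> Gamb F \<sigma> \<tau>) p u"
    using canonical by (simp add: canonical_coframing_def)
  also have "\<dots> = (\<Sum>\<^sub>*\<sigma>. \<Sum>\<^sub>*\<tau>. if \<tau> = \<beta> then pbd \<epsilon> \<sigma> (sw \<alpha>) * - sgn_ix \<beta> * cnj (Gam F \<sigma> \<beta> p u) else 0)"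
    unfolding sum_fun_apply
    by (intro sum.cong refl) (auto simp: pbd_eq cscale_def cj_def)
  also have "\<dots> = (\<Sum>\<^sub>*\<sigma>. if \<sigma> = \<alpha> then sgn_ix \<alpha> * sgn_ix \<beta> * cnj (Gam F \<alpha> \<beta> p u) else 0)"
    by (intro sum.cong refl) (auto simp: pbd_eq)
  finally show ?thesis by (simp add: algebra_simps)
qed

lemma Gam_sym: "Gam F \<alpha> \<beta> = Gam F \<beta> \<alpha>"
  using canonical by (simp add: canonical_coframing_def)

lemma curvature_sym:
  "cS K \<alpha> \<beta> \<gamma> \<delta> = cS K \<beta> \<alpha> \<gamma> \<delta>" "cS K \<alpha> \<beta> \<gamma> \<delta> = cS K \<alpha> \<gamma> \<beta> \<delta>" "cS K \<alpha> \<beta> \<gamma> \<delta> = cS K \<alpha> \<beta> \<delta> \<gamma>"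
  "cV K \<alpha> \<beta> \<gamma> = cV K \<beta> \<alpha> \<gamma>" "cV K \<alpha> \<beta> \<gamma> = cV K \<alpha> \<gamma> \<beta>"
  "cL K \<alpha> \<beta> = cL K \<beta> \<alpha>" "cM K \<alpha> \<beta> = cM K \<beta> \<alpha>"
  using curvature unfolding curvature_functions_def by blast+

lemma curvature_smooth:
  "smooth_fun X UNIV (cS K \<alpha> \<beta> \<gamma> \<delta>)" "smooth_fun X UNIV (cV K \<alpha> \<beta> \<gamma>)" "smooth_fun X UNIV (cL K \<alpha> \<beta>)"
  "smooth_fun X UNIV (cM K \<alpha> \<beta>)" "smooth_fun X UNIV (cC K \<alpha>)" "smooth_fun X UNIV (cH K \<alpha>)"
  "smooth_fun X UNIV (cP K)" "smooth_fun X UNIV (cQ K)" "smooth_fun X UNIV (cR K)"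
  using curvature by (simp_all add: curvature_functions_def)

lemma j2_eq: "j2 \<epsilon> A \<alpha> \<beta> p = sgn_ix \<alpha> * sgn_ix \<beta> * cnj (A (sw \<alpha>) (sw \<beta>) p)"
proof -
  have "j2 \<epsilon> A \<alpha> \<beta> p = (\<Sum>\<^sub>*\<mu>. \<Sum>\<^sub>*\<nu>. if \<nu> = sw \<beta> then pbd \<epsilon> \<mu> \<alpha> * sgn_ix \<beta> * cnj (A \<mu> (sw \<beta>) p) else 0)"
    unfolding j2_def by (intro sum.cong refl) (auto simp: pbd_eq)
  also have "\<dots> = (\<Sum>\<^sub>*\<mu>. if \<mu> = sw \<alpha> then sgn_ix \<alpha> * sgn_ix \<beta> * cnj (A (sw \<alpha>) (sw \<beta>) p) else 0)"
    by (intro sum.cong refl) (auto simp: pbd_eq)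
  finally show ?thesis by simp
qed

lemma j3_eq: "j3 \<epsilon> A \<alpha> \<beta> \<gamma> p = sgn_ix \<alpha> * sgn_ix \<beta> * sgn_ix \<gamma> * cnj (A (sw \<alpha>) (sw \<beta>) (sw \<gamma>) p)"
proof -
  have "j3 \<epsilon> A \<alpha> \<beta> \<gamma> p = (\<Sum>\<^sub>*\<mu>. pbd \<epsilon> \<mu> \<alpha> * j2 \<epsilon> (A \<mu>) \<beta> \<gamma> p)"
    unfolding j3_def j2_def by (simp add: sum_distrib_left mult.assoc)
  also have "\<dots> = (\<Sum>\<^sub>*\<mu>. if \<mu> = sw \<alpha> then sgn_ix \<alpha> * j2 \<epsilon> (A (sw \<alpha>)) \<beta> \<gamma> p else 0)"
    by (intro sum.cong refl) (auto simp: pbd_eq)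
  finally show ?thesis by (simp add: j2_eq)
qed

lemma j4_eq: "j4 \<epsilon> A \<alpha> \<beta> \<gamma> \<delta> p
  = sgn_ix \<alpha> * sgn_ix \<beta> * sgn_ix \<gamma> * sgn_ix \<delta> * cnj (A (sw \<alpha>) (sw \<beta>) (sw \<gamma>) (sw \<delta>) p)"
proof -
  have "j4 \<epsilon> A \<alpha> \<beta> \<gamma> \<delta> p = (\<Sum>\<^sub>*\<mu>. pbd \<epsilon> \<mu> \<alpha> * j3 \<epsilon> (A \<mu>) \<beta> \<gamma> \<delta> p)"
    unfolding j4_def j3_def by (simp add: sum_distrib_left mult.assoc)
  also have "\<dots> = (\<Sum>\<^sub>*\<mu>. if \<mu> = sw \<alpha> then sgn_ix \<alpha> * j3 \<epsilon> (A (sw \<alpha>)) \<beta> \<gamma> \<delta> p else 0)"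
    by (intro sum.cong refl) (auto simp: pbd_eq)
  finally show ?thesis by (simp add: j3_eq)
qed

lemma cnj_curvature:
  "cnj (cS K \<alpha> \<beta> \<gamma> \<delta> p) = sgn_ix \<alpha> * sgn_ix \<beta> * sgn_ix \<gamma> * sgn_ix \<delta> * cS K (sw \<alpha>) (sw \<beta>) (sw \<gamma>) (sw \<delta>) p"
  "cnj (cL K \<alpha> \<beta> p) = sgn_ix \<alpha> * sgn_ix \<beta> * cL K (sw \<alpha>) (sw \<beta>) p"
  "cnj (cR K p) = cR K p"
proof -
  have "j4 \<epsilon> (cS K) = cS K" "j2 \<epsilon> (cL K) = cL K"
    using curvature unfolding curvature_functions_def by blast+
  then have "cS K (sw \<alpha>) (sw \<beta>) (sw \<gamma>) (sw \<delta>) p = j4 \<epsilon> (cS K) (sw \<alpha>) (sw \<beta>) (sw \<gamma>) (sw \<delta>) p"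
    "cL K (sw \<alpha>) (sw \<beta>) p = j2 \<epsilon> (cL K) (sw \<alpha>) (sw \<beta>) p" by simp_all
  then show "cnj (cS K \<alpha> \<beta> \<gamma> \<delta> p) = sgn_ix \<alpha> * sgn_ix \<beta> * sgn_ix \<gamma> * sgn_ix \<delta> * cS K (sw \<alpha>) (sw \<beta>) (sw \<gamma>) (sw \<delta>) p"
    "cnj (cL K \<alpha> \<beta> p) = sgn_ix \<alpha> * sgn_ix \<beta> * cL K (sw \<alpha>) (sw \<beta>) p"
    by (simp_all add: j4_eq j2_eq algebra_simps)
  show "cnj (cR K p) = cR K p"
    using curvature unfolding curvature_functions_def by blast
qed

lemma conn_smooth: "smooth_form1 X UNIV (conn \<epsilon> F P Q)"
  by (cases P; cases Q) (auto intro!: smooth_form1_cscale smooth_form1_plus smooth_form1_cj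
    adapted_smooth canonical_smooth)

lemma conn_sym: "conn \<epsilon> F P Q = conn \<epsilon> F Q P"
  by (cases P; cases Q) (auto simp: Gam_sym)

lemma curv_comp_smooth: "smooth_fun X UNIV (curv_comp K as k)"
proof -
  have 0: "smooth_fun X UNIV (\<lambda>p. 0 :: complex)"
    using smooth_fun_scale[OF curvature_smooth(9), of 0] by simp
  \<comment> \<open>The case rule of \<open>curv_comp\<close> also asks for a point, for which
    \<open>undefined\<close> is a dummy. The last alternative covers lists with more than four
    entries, where the default value 0 applies.\<close>
  have "(\<exists>\<alpha> \<beta> \<gamma> \<delta>. as = [\<alpha>, \<beta>, \<gamma>, \<delta>]) \<or> (\<exists>\<alpha> \<beta> \<gamma>. as = [\<alpha>, \<beta>, \<gamma>]) \<or> (\<exists>\<alpha> \<beta>. as = [\<alpha>, \<beta>])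
      \<or> (\<exists>\<alpha>. as = [\<alpha>]) \<or> as = [] \<or> curv_comp K as k = (\<lambda>p. 0)"
    by (cases "(K, as, k, undefined :: 'x)" rule: curv_comp.cases) (auto simp: fun_eq_iff)
  then show ?thesis
    by (elim disjE exE; cases "k = 0"; cases "k = 1"; cases "k = 2"; cases "k = 3")
      (simp_all add: curv_comp.simps[abs_def] curvature_smooth smooth_fun_scale smooth_fun_minus smooth_fun_cnj 0)
qed

lemma curvT_smooth: "smooth_fun X UNIV (curvT K P Q R S)"
proof (cases "is_Lo P \<or> is_Lo Q \<or> is_Lo R \<or> is_Lo S")
  case True
  then have "curvT K P Q R S = (\<lambda>p. 0 * cR K p)" by (simp add: fun_eq_iff curvT_def)
  then show ?thesis using smooth_fun_scale[OF curvature_smooth(9), of 0] by simp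
next
  case False
  then have "curvT K P Q R S = curv_comp K (greek_part P @ greek_part Q @ greek_part R @ greek_part S)
       (up_count P + up_count Q + up_count R + up_count S)" by (simp add: fun_eq_iff curvT_def)
  then show ?thesis by (simp add: curv_comp_smooth)
qed

lemma curvT_sym:
  "curvT K P Q R S = curvT K Q P R S" "curvT K P Q R S = curvT K P R Q S" "curvT K P Q R S = curvT K P Q S R"
proof -
  show "curvT K P Q R S = curvT K Q P R S"
    by (rule ext, cases P; cases Q; cases R; cases S) (simp_all add: curvT_def curvature_sym add_ac)
  show "curvT K P Q R S = curvT K P R Q S"
    by (rule ext, cases P; cases Q; cases R; cases S) (simp_all add: curvT_def curvature_sym add_ac)
  show "curvT K P Q R S = curvT K P Q S R"
    by (rule ext, cases P; cases Q; cases R; cases S) (simp_all add: curvT_def curvature_sym add_ac)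
qed

lemma cnj_conn:
  "cnj (conn \<epsilon> F P Q p u) = conj_sign P * conj_sign Q * conn \<epsilon> F (conj_ix P) (conj_ix Q) p u"
  by (cases P; cases Q) (auto simp: cscale_def cj_def cnj_Gam algebra_simps)

text \<open>Conjugation turns k labels \<open>Up False\<close> among m indices \<open>Up\<close>
  into m - k. Components with different k are paired by the definition of \<open>curv_comp\<close>;
  the ones paired with themselves are \<open>cS\<close>, \<open>cL\<close> and \<open>cR\<close>,
  whose reality is assumed.\<close>

lemma cnj_curvT:
  "cnj (curvT K P Q R S p) = conj_sign P * conj_sign Q * conj_sign R * conj_sign S
     * curvT K (conj_ix P) (conj_ix Q) (conj_ix R) (conj_ix S) p"
proof (cases "is_Lo P \<or> is_Lo Q \<or> is_Lo R \<or> is_Lo S")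
  case True
  have "is_Lo (conj_ix P) = is_Lo P" for P :: "('n + 'n) sp_index" by (cases P) auto
  with True show ?thesis by (auto simp: curvT_def)
next
  case False
  have "(\<exists>\<alpha>. P = Greek \<alpha>) \<or> P = Up True \<or> P = Up False" if "\<not> is_Lo P" for P :: "('n + 'n) sp_index"
    using that by (cases P) auto
  with False have "(\<exists>\<alpha>. P = Greek \<alpha>) \<or> P = Up True \<or> P = Up False"
    "(\<exists>\<alpha>. Q = Greek \<alpha>) \<or> Q = Up True \<or> Q = Up False"
    "(\<exists>\<alpha>. R = Greek \<alpha>) \<or> R = Up True \<or> R = Up False"
    "(\<exists>\<alpha>. S = Greek \<alpha>) \<or> S = Up True \<or> S = Up False" by blast+
  then show ?thesis
    by (elim disjE exE; simp only:) (simp_all add: curvT_def cnj_curvature mult_ac)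
qed

sublocale real_sp_connection X "conn \<epsilon> F" "curvT K" star "symp \<epsilon>" "Lo True" "Lo False" conj_ix conj_sign
proof
  show "star (star P) = P" for P :: "('n + 'n) sp_index" by (cases P) auto
  show "symp \<epsilon> (star P) = - symp \<epsilon> P" for P by (cases P) auto
  show "conj_ix (conj_ix P) = P" for P :: "('n + 'n) sp_index" by (cases P) auto
  show "star (conj_ix P) = conj_ix (star P)" for P :: "('n + 'n) sp_index" by (cases P) auto
  show "cnj (conj_sign P) = conj_sign P" for P :: "('n + 'n) sp_index" by (cases P) auto
  show "conj_sign P * conj_sign P = 1" for P :: "('n + 'n) sp_index" by (cases P) auto
  show "conj_sign (conj_ix P) = - conj_sign P" for P :: "('n + 'n) sp_index" by (cases P) auto
  show "cnj (symp \<epsilon> P) = symp \<epsilon> P" for P by (cases P) auto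
  show "symp \<epsilon> (conj_ix P) = conj_sign P * conj_sign (star P) * symp \<epsilon> P" for P by (cases P) auto
  show "conj_ix (Lo True) = (Lo False :: ('n + 'n) sp_index)" by simp
  show "curvT K (Lo True) Q R S p = 0" "curvT K (Lo False) Q R S p = 0" for Q R S p
    by (simp_all add: curvT_def)
  show "Lo True \<noteq> (Lo False :: ('n + 'n) sp_index)" by simp
qed (rule conn_sym conn_smooth curvT_smooth curvT_sym cnj_conn cnj_curvT)+

end

section \<open>The structure equations\<close>

lemma wedge_cscale_right: "(a \<sqinter>\<^sub>1 z \<cdot> b) p u v = z * (a \<sqinter>\<^sub>1 b) p u v"
  by (simp add: wedge_def cscale_def algebra_simps)

lemma wedge_add_left: "((a + a') \<sqinter>\<^sub>1 b) p u v = (a \<sqinter>\<^sub>1 b) p u v + (a' \<sqinter>\<^sub>1 b) p u v"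
  by (simp add: wedge_def algebra_simps)

lemma wedge_add_right: "(a \<sqinter>\<^sub>1 (b + b')) p u v = (a \<sqinter>\<^sub>1 b) p u v + (a \<sqinter>\<^sub>1 b') p u v"
  by (simp add: wedge_def algebra_simps)

lemma wedge_diff_left: "((a - a') \<sqinter>\<^sub>1 b) p u v = (a \<sqinter>\<^sub>1 b) p u v - (a' \<sqinter>\<^sub>1 b) p u v"
  by (simp add: wedge_def algebra_simps)

lemma wedge_diff_right: "(a \<sqinter>\<^sub>1 (b - b')) p u v = (a \<sqinter>\<^sub>1 b) p u v - (a \<sqinter>\<^sub>1 b') p u v"
  by (simp add: wedge_def algebra_simps)

lemma wedge_sum_left: "((\<Sum>i\<in>I. a i) \<sqinter>\<^sub>1 b) p u v = (\<Sum>i\<in>I. (a i \<sqinter>\<^sub>1 b) p u v)"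
  by (simp add: wedge_def sum_fun_apply sum_distrib_right sum_distrib_left sum_subtractf)

lemma wedge_commute: "(a \<sqinter>\<^sub>1 b) p u v = - (b \<sqinter>\<^sub>1 a) p u v"
  by (simp add: wedge_def)

lemmas wedge_linear = wedge_cscale wedge_cscale_right wedge_fscale wedge_add_left wedge_add_right
  wedge_diff_left wedge_diff_right wedge_sum_left

lemma if_mult_0: "(if b then x else 0) * y = (if b then x * y else (0::complex))"
  "y * (if b then x else 0) = (if b then y * x else (0::complex))"
  by simp_all

lemma sum_if_const: "(\<Sum>\<^sub>*\<gamma>. if b then g \<gamma> else 0) = (if b then (\<Sum>\<^sub>*\<gamma>. g \<gamma>) else (0::complex))"
  by simp

lemma sum_delta_sw:
  fixes f :: "'n::finite + 'n \<Rightarrow> 'n + 'n \<Rightarrow> complex"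
  shows "(\<Sum>\<^sub>*\<sigma> \<gamma>. if \<sigma> = sw \<gamma> then f \<sigma> \<gamma> else 0) = (\<Sum>\<^sub>*\<gamma>. f (sw \<gamma>) \<gamma>)"
  by (subst sum.swap) simp

lemma fun_minus_apply: "(f - g) x = f x - (g x :: 'a::group_add)" "(- f) x = - (f x :: 'a)"
  by (simp_all add: fun_diff_def fun_Compl_def)

lemmas collapse = sum_fun_apply fun_minus_apply if_mult_0 sum_if_const sum_delta_sw wedge_linear

context qc_coframing
begin

lemma phil_eq: "phil \<epsilon> F \<alpha> = of_real (\<epsilon> \<alpha>) \<cdot> phib F \<alpha>"
  by (simp add: fun_eq_iff phil_def sum_fun_apply cscale_def gl_eq if_mult_0)

lemma thl_eq: "thl \<epsilon> F \<alpha> = of_real (\<epsilon> \<alpha>) \<cdot> thetab F \<alpha>"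
  by (simp add: fun_eq_iff thl_def sum_fun_apply cscale_def gl_eq if_mult_0)

lemma cj_cscale: "cj (z \<cdot> a) = cnj z \<cdot> cj a" and cj_cj: "cj (cj a) = a"
  by (simp_all add: fun_eq_iff cj_def cscale_def)

lemmas array_eq = gl_eq gu_eq pdd_eq pbd_eq pub_eq puu_eq phil_eq thl_eq j2_eq j3_eq cj_cscale cj_cj

lemma eta2_etap: "eta2 F True True = (-1/2) \<cdot> etap F" "eta2 F False False = (-1/2) \<cdot> etam F"
  by (simp_all add: fun_eq_iff etap_def etam_def cscale_def fun_minus_apply)

lemma eta2_eta: "eta2 F True False = (\<i>/2) \<cdot> eta F 1" "eta2 F False True = (\<i>/2) \<cdot> eta F 1"
  by simp_all

lemma con_eqs:
  "con (Greek \<alpha>) (Lo True) = theta F \<alpha>"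
  "con (Greek \<alpha>) (Lo False) = (- sgn_ix \<alpha>) \<cdot> thetab F (sw \<alpha>)"
  "con (Up True) (Lo True) = (1/2) \<cdot> etap F"
  "con (Up True) (Lo False) = (-\<i>/2) \<cdot> eta F 1"
  "con (Up False) (Lo True) = (-\<i>/2) \<cdot> eta F 1"
  "con (Up False) (Lo False) = (1/2) \<cdot> etam F"
  by (simp_all add: con_def eta2_etap eta2_eta del: eta2.simps)
    (simp_all add: fun_eq_iff cscale_def mult_ac)

text \<open>The origin of the constants in \<open>curv_comp\<close>: equating these terms with the
  given right-hand sides determines each component. For instance -\<i>/2 times 2 \<i> is the
  coefficient 1 of \<open>cV\<close>, and \<i>/4 times -4 \<i> the coefficient 1 of
  \<open>cM\<close> in the differential of \<open>Gam\<close>.\<close>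

lemma curv_eq: "curv P Q p u v =
    (\<Sum>\<^sub>*\<gamma> \<delta>. sgn_ix \<delta> * curvT K P Q (Greek \<gamma>) (Greek (sw \<delta>)) p * (theta F \<gamma> \<sqinter>\<^sub>1 thetab F \<delta>) p u v)
    - (\<i>/2) * (\<Sum>\<^sub>*\<gamma>. curvT K P Q (Greek \<gamma>) (Up True) p * (theta F \<gamma> \<sqinter>\<^sub>1 eta F 1) p u v)
    - (1/2) * (\<Sum>\<^sub>*\<gamma>. sgn_ix \<gamma> * curvT K P Q (Greek (sw \<gamma>)) (Up True) p * (thetab F \<gamma> \<sqinter>\<^sub>1 etap F) p u v)
    + (1/2) * (\<Sum>\<^sub>*\<gamma>. curvT K P Q (Greek \<gamma>) (Up False) p * (theta F \<gamma> \<sqinter>\<^sub>1 etam F) p u v)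
    + (\<i>/2) * (\<Sum>\<^sub>*\<gamma>. sgn_ix \<gamma> * curvT K P Q (Greek (sw \<gamma>)) (Up False) p * (thetab F \<gamma> \<sqinter>\<^sub>1 eta F 1) p u v)
    + (\<i>/4) * curvT K P Q (Up True) (Up True) p * (eta F 1 \<sqinter>\<^sub>1 etap F) p u v
    + (1/4) * curvT K P Q (Up True) (Up False) p * (etap F \<sqinter>\<^sub>1 etam F) p u v
    - (\<i>/4) * curvT K P Q (Up False) (Up False) p * (eta F 1 \<sqinter>\<^sub>1 etam F) p u v"
proof -
  let ?T = "\<lambda>R S. curvT K P Q R S p"
  have 0: "?T (Lo b) S = 0" "?T R (Lo b) = 0" for b R S by (simp_all add: curvT_def)
  have 1: "(\<Sum>\<^sub>*\<delta>. ?T (Greek \<gamma>) (Greek \<delta>) * (theta F \<gamma> \<sqinter>\<^sub>1 (- sgn_ix \<delta>) \<cdot> thetab F (sw \<delta>)) p u v)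
    = (\<Sum>\<^sub>*\<delta>. sgn_ix \<delta> * ?T (Greek \<gamma>) (Greek (sw \<delta>)) * (theta F \<gamma> \<sqinter>\<^sub>1 thetab F \<delta>) p u v)" for \<gamma>
    by (subst sum_sw[symmetric]) (simp add: wedge_linear mult_ac)
  have 2: "(\<Sum>\<^sub>*\<gamma>. ?T (Up b) (Greek \<gamma>) * (a \<sqinter>\<^sub>1 (- sgn_ix \<gamma>) \<cdot> thetab F (sw \<gamma>)) p u v)
    = - (\<Sum>\<^sub>*\<gamma>. sgn_ix \<gamma> * ?T (Greek (sw \<gamma>)) (Up b) * (thetab F \<gamma> \<sqinter>\<^sub>1 a) p u v)" for a b
    by (subst sum_sw[symmetric])
      (simp add: wedge_linear curvT_sym(3)[of P Q "Up b"] wedge_commute[of a] sum_negf mult_ac)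
  show ?thesis
    unfolding curv_def sum_sp_index con_eqs sum.distrib 0 1 2
    by (simp add: wedge_linear sum_distrib_left 0 curvT_sym(3)[of P Q "Up False" "Up True"]
        wedge_commute[of "etap F" "eta F 1"] sum_negf mult_ac)
      (simp add: wedge_def)
qed

lemmas expand_sums = add_divide_distrib diff_divide_distrib sum_distrib_left sum_distrib_right sum_divide_distrib sum_negf sum_subtractf sum.distrib

text \<open>The block verifications share one pattern: the closed forms of the constant arrays
  collapse multiple sums, and what remains is compared after evaluation on \<open>u\<close> and
  \<open>v\<close>.\<close>

lemma structure_eq_GG: "structure_eq (Greek \<alpha>) (Greek \<beta>)"
  unfolding structure_eq_def
proof (intro allI)
  fix p u v
  have d: "d1 X (Gam F \<alpha> \<beta>) = dGam_rhs \<epsilon> F K \<alpha> \<beta>"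
    using curvature by (simp add: curvature_functions_def)
  show "d1 X (conn \<epsilon> F (Greek \<alpha>) (Greek \<beta>)) p u v =
     - (\<Sum>\<^sub>*R. symp \<epsilon> R * (conn \<epsilon> F (Greek \<alpha>) R \<sqinter>\<^sub>1 conn \<epsilon> F (star R) (Greek \<beta>)) p u v)
     + curv (Greek \<alpha>) (Greek \<beta>) p u v"
    by (simp add: d dGam_rhs_def collapse array_eq,
        simp add: curv_eq curvT_def sum_sp_index collapse,
        simp add: expand_sums algebra_simps,
        simp add: wedge_def expand_sums algebra_simps)
qed

lemma d1_theta: "d1 X (theta F \<alpha>) =
        - ((\<i> \<cdot> phi F \<alpha>) \<sqinter>\<^sub>1 eta F 1)
        - (\<Sum>\<^sub>*\<sigma>. pub \<epsilon> \<alpha> \<sigma> \<cdot> phib F \<sigma> \<sqinter>\<^sub>1 etap F)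
        - (\<Sum>\<^sub>*\<sigma> \<beta>. puu \<epsilon> \<alpha> \<sigma> \<cdot> Gam F \<sigma> \<beta> \<sqinter>\<^sub>1 theta F \<beta>)
        - ((1/2) \<cdot> (varphi0 F + \<i> \<cdot> varphi F 1) \<sqinter>\<^sub>1 theta F \<alpha>)
        - (\<Sum>\<^sub>*\<beta>. ((1/2) * pub \<epsilon> \<alpha> \<beta>) \<cdot> (varphi F 2 + \<i> \<cdot> varphi F 3) \<sqinter>\<^sub>1 thetab F \<beta>)"
  using canonical by (simp add: canonical_coframing_def)

lemma structure_eq_GL: "structure_eq (Greek \<alpha>) (Lo True)"
  unfolding structure_eq_def
proof (intro allI)
  fix p u v
  show "d1 X (conn \<epsilon> F (Greek \<alpha>) (Lo True)) p u v =
     - (\<Sum>\<^sub>*R. symp \<epsilon> R * (conn \<epsilon> F (Greek \<alpha>) R \<sqinter>\<^sub>1 conn \<epsilon> F (star R) (Lo True)) p u v)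
     + curv (Greek \<alpha>) (Lo True) p u v"
    by (simp add: d1_cscale smooth_imp_diff_form1 adapted_smooth,
        simp add: d1_theta collapse array_eq sw_eq_iff[of \<alpha>],
        simp add: curv_eq curvT_def sum_sp_index collapse etap_def,
        simp add: expand_sums algebra_simps,
        simp add: wedge_def expand_sums algebra_simps)
qed

lemma Cup_eq: "Cup \<epsilon> K \<alpha> p = of_real (\<epsilon> \<alpha>) * cnj (cC K \<alpha> p)"
  by (simp add: Cup_def gu_eq if_mult_0)

text \<open>The given equation for \<open>phil\<close> contains the conjugate connection forms, the
  matrix product the unbarred ones; reality of \<open>Gam\<close> converts between them.\<close>

lemma Gamb_sum: "(\<Sum>\<^sub>*\<gamma>. sgn_ix \<alpha> * (Gamb F (sw \<alpha>) \<gamma> \<sqinter>\<^sub>1 phib F \<gamma>) p u v)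
    = (\<Sum>\<^sub>*\<gamma>. sgn_ix \<gamma> * (Gam F \<alpha> \<gamma> \<sqinter>\<^sub>1 phib F (sw \<gamma>)) p u v)"
  by (subst sum_sw[symmetric])
    (intro sum.cong refl, simp add: wedge_def cj_def cnj_Gam algebra_simps)

lemma d1_eta: "d1 X (eta F 1) p = SE1 \<epsilon> F p" "d1 X (eta F 2) p = SE2 \<epsilon> F p" "d1 X (eta F 3) p = SE3 \<epsilon> F p"
  using SE by (simp_all add: SE_def)

lemma d1_varphi:
  "d1 X (varphi0 F) =
        - (\<Sum>\<^sub>*s. psi F s \<sqinter>\<^sub>1 eta F s)
        - (\<Sum>\<^sub>*\<beta>. 2 \<cdot> phil \<epsilon> F \<beta> \<sqinter>\<^sub>1 theta F \<beta>) - (\<Sum>\<^sub>*\<beta>. 2 \<cdot> cj (phil \<epsilon> F \<beta>) \<sqinter>\<^sub>1 thetab F \<beta>)"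
  "d1 X (varphi F 1) =
        - (varphi F 2 \<sqinter>\<^sub>1 varphi F 3) - (psi F 2 \<sqinter>\<^sub>1 eta F 3) + (psi F 3 \<sqinter>\<^sub>1 eta F 2)
        + (\<Sum>\<^sub>*\<beta>. (2 * \<i>) \<cdot> phil \<epsilon> F \<beta> \<sqinter>\<^sub>1 theta F \<beta>)
        - (\<Sum>\<^sub>*\<beta>. (2 * \<i>) \<cdot> cj (phil \<epsilon> F \<beta>) \<sqinter>\<^sub>1 thetab F \<beta>)"
  "d1 X (varphi F 2) =
        - (varphi F 3 \<sqinter>\<^sub>1 varphi F 1) - (psi F 3 \<sqinter>\<^sub>1 eta F 1) + (psi F 1 \<sqinter>\<^sub>1 eta F 3)
        - (\<Sum>\<^sub>*\<sigma> \<beta>. (2 * pdd \<epsilon> \<sigma> \<beta>) \<cdot> phi F \<sigma> \<sqinter>\<^sub>1 theta F \<beta>)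
        - (\<Sum>\<^sub>*\<sigma> \<beta>. (2 * cnj (pdd \<epsilon> \<sigma> \<beta>)) \<cdot> phib F \<sigma> \<sqinter>\<^sub>1 thetab F \<beta>)"
  "d1 X (varphi F 3) =
        - (varphi F 1 \<sqinter>\<^sub>1 varphi F 2) - (psi F 1 \<sqinter>\<^sub>1 eta F 2) + (psi F 2 \<sqinter>\<^sub>1 eta F 1)
        + (\<Sum>\<^sub>*\<sigma> \<beta>. (2 * \<i> * pdd \<epsilon> \<sigma> \<beta>) \<cdot> phi F \<sigma> \<sqinter>\<^sub>1 theta F \<beta>)
        - (\<Sum>\<^sub>*\<sigma> \<beta>. (2 * \<i> * cnj (pdd \<epsilon> \<sigma> \<beta>)) \<cdot> phib F \<sigma> \<sqinter>\<^sub>1 thetab F \<beta>)"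
  using canonical by (simp_all add: canonical_coframing_def)

lemma d1_combination:
  assumes "smooth_form1 X UNIV a" "smooth_form1 X UNIV b"
  shows "d1 X (z \<cdot> (a + y \<cdot> b)) p u v = z * (d1 X a p u v + y * d1 X b p u v)"
  using assms by (simp add: d1_cscale d1_plus smooth_imp_diff_form1 smooth_form1_plus smooth_form1_cscale)

end

lemma cnj_if_0: "cnj (if b then x else 0) = (if b then cnj x else 0)" by simp

context qc_coframing
begin

lemma structure_eq_GU: "structure_eq (Greek \<alpha>) (Up True)"
  unfolding structure_eq_def
proof (intro allI)
  fix p u v
  \<comment> \<open>The differential of \<open>phi\<close> is prescribed with the index lowered, so
    this block is expressed through \<open>phil\<close>.\<close>
  have 1: "conn \<epsilon> F (Greek \<alpha>) (Up True) = (- 2) \<cdot> phil \<epsilon> F \<alpha>"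
    by (simp add: phil_eq fun_eq_iff cscale_def)
  have 2: "diff_form1 (phil \<epsilon> F \<alpha>)"
    by (simp add: phil_eq smooth_imp_diff_form1 smooth_form1_cscale smooth_form1_cj canonical_smooth)
  have d: "d1 X (phil \<epsilon> F \<alpha>) = dphil_rhs \<epsilon> F K \<alpha>"
    using curvature by (simp add: curvature_functions_def)
  show "d1 X (conn \<epsilon> F (Greek \<alpha>) (Up True)) p u v =
     - (\<Sum>\<^sub>*R. symp \<epsilon> R * (conn \<epsilon> F (Greek \<alpha>) R \<sqinter>\<^sub>1 conn \<epsilon> F (star R) (Up True)) p u v)
     + curv (Greek \<alpha>) (Up True) p u v"
    unfolding 1 d1_cscale[OF 2] d
    by (simp add: dphil_rhs_def collapse array_eq,
        simp add: Gamb_sum Cup_eq cnj_curvature,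
        simp add: curv_eq curvT_def sum_sp_index collapse etap_def etam_def,
        simp add: expand_sums algebra_simps,
        simp add: wedge_def expand_sums algebra_simps)
qed

lemma structure_eq_LL: "structure_eq (Lo True) (Lo True)"
  unfolding structure_eq_def
proof (intro allI)
  fix p u v
  show "d1 X (conn \<epsilon> F (Lo True) (Lo True)) p u v =
     - (\<Sum>\<^sub>*R. symp \<epsilon> R * (conn \<epsilon> F (Lo True) R \<sqinter>\<^sub>1 conn \<epsilon> F (star R) (Lo True)) p u v)
     + curv (Lo True) (Lo True) p u v"
    by (simp add: d1_cscale d1_combination smooth_imp_diff_form1 adapted_smooth canonical_smooth,
        simp add: d1_eta SE2_def SE3_def collapse array_eq UNIV_3 etap_def etam_def,
        simp add: curv_eq curvT_def sum_sp_index collapse etap_def etam_def,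
        simp add: expand_sums algebra_simps,
        simp add: wedge_def expand_sums algebra_simps)
qed

lemma structure_eq_LL': "structure_eq (Lo True) (Lo False)"
  unfolding structure_eq_def
proof (intro allI)
  fix p u v
  \<comment> \<open>In the matrix product both factors carry the shifted index, in
    \<open>SE1\<close> both carry the index itself; the inserted instances of \<open>sum_sw\<close>
    match the two sums.\<close>
  show "d1 X (conn \<epsilon> F (Lo True) (Lo False)) p u v =
     - (\<Sum>\<^sub>*R. symp \<epsilon> R * (conn \<epsilon> F (Lo True) R \<sqinter>\<^sub>1 conn \<epsilon> F (star R) (Lo False)) p u v)
     + curv (Lo True) (Lo False) p u v"
    by (simp add: d1_cscale d1_combination smooth_imp_diff_form1 adapted_smooth canonical_smooth,
        simp add: d1_eta SE1_def collapse array_eq UNIV_3 etap_def etam_def,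
        simp add: curv_eq curvT_def sum_sp_index collapse etap_def etam_def,
        simp add: expand_sums algebra_simps,
        insert sum_sw[of "\<lambda>n. 2 * (complex_of_real (\<epsilon> n) * (theta F n p u * thetab F n p v))"] sum_sw[of "\<lambda>n. 2 * (complex_of_real (\<epsilon> n) * (theta F n p v * thetab F n p u))"],
        simp add: wedge_def expand_sums algebra_simps)
qed

lemma structure_eq_UL: "structure_eq (Up True) (Lo True)"
  unfolding structure_eq_def
proof (intro allI)
  fix p u v
  show "d1 X (conn \<epsilon> F (Up True) (Lo True)) p u v =
     - (\<Sum>\<^sub>*R. symp \<epsilon> R * (conn \<epsilon> F (Up True) R \<sqinter>\<^sub>1 conn \<epsilon> F (star R) (Lo True)) p u v)
     + curv (Up True) (Lo True) p u v"
    by (simp add: d1_cscale d1_combination smooth_imp_diff_form1 adapted_smooth canonical_smooth,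
        simp add: d1_varphi collapse array_eq sum_3 etap_def etam_def,
        simp add: curv_eq curvT_def sum_sp_index collapse etap_def etam_def,
        simp add: expand_sums algebra_simps,
        simp add: wedge_def expand_sums algebra_simps)
qed

lemma structure_eq_UL': "structure_eq (Up False) (Lo True)"
  unfolding structure_eq_def
proof (intro allI)
  fix p u v
  \<comment> \<open>The same contraction with \<open>pdd\<close> occurs once summed over the index
    of \<open>phi\<close> and once over that of \<open>theta\<close>; \<open>sgn_ix\<close> changes
    sign under the shift.\<close>
  have r: "(\<Sum>\<^sub>*n. sgn_ix n * (2 * (complex_of_real (\<epsilon> n) * (phi F n p x * theta F (sw n) p y))))
    = - (\<Sum>\<^sub>*n. sgn_ix n * (2 * (complex_of_real (\<epsilon> n) * (theta F n p y * phi F (sw n) p x))))" for x y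
    by (subst sum_sw[symmetric]) (simp add: sum_negf mult_ac)
  show "d1 X (conn \<epsilon> F (Up False) (Lo True)) p u v =
     - (\<Sum>\<^sub>*R. symp \<epsilon> R * (conn \<epsilon> F (Up False) R \<sqinter>\<^sub>1 conn \<epsilon> F (star R) (Lo True)) p u v)
     + curv (Up False) (Lo True) p u v"
    by (simp add: d1_cscale d1_combination smooth_imp_diff_form1 adapted_smooth canonical_smooth,
        simp add: d1_varphi collapse array_eq sum_3 etap_def etam_def,
        simp add: curv_eq curvT_def sum_sp_index collapse etap_def etam_def,
        simp add: expand_sums algebra_simps,
        simp add: wedge_def expand_sums algebra_simps,
        simp add: r)
qed

lemma structure_eq_UU': "structure_eq (Up True) (Up False)"
  unfolding structure_eq_def
proof (intro allI)
  fix p u v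
  have d: "d1 X (psi F 1) = dpsi1_rhs \<epsilon> F K"
    using curvature by (simp add: curvature_functions_def)
  show "d1 X (conn \<epsilon> F (Up True) (Up False)) p u v =
     - (\<Sum>\<^sub>*R. symp \<epsilon> R * (conn \<epsilon> F (Up True) R \<sqinter>\<^sub>1 conn \<epsilon> F (star R) (Up False)) p u v)
     + curv (Up True) (Up False) p u v"
    by (simp add: d1_cscale smooth_imp_diff_form1 canonical_smooth d,
        simp add: dpsi1_rhs_def cnj_if_0 collapse array_eq etap_def etam_def Cup_eq cnj_curvature,
        simp add: curv_eq curvT_def sum_sp_index collapse etap_def etam_def,
        simp add: expand_sums algebra_simps,
        simp add: wedge_def expand_sums algebra_simps)
qed

lemma structure_eq_UU: "structure_eq (Up False) (Up False)"
  unfolding structure_eq_def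
proof (intro allI)
  fix p u v
  have "d1 X (conn \<epsilon> F (Up False) (Up False)) p u v = - (d1 X (psi F 2) p u v + \<i> * d1 X (psi F 3) p u v)"
    by (simp add: d1_combination canonical_smooth)
  also have "\<dots> = - dpsi23_rhs \<epsilon> F K p u v"
    using curvature by (simp add: curvature_functions_def)
  finally have d: "d1 X (conn \<epsilon> F (Up False) (Up False)) p u v = - dpsi23_rhs \<epsilon> F K p u v" .
  show "d1 X (conn \<epsilon> F (Up False) (Up False)) p u v =
     - (\<Sum>\<^sub>*R. symp \<epsilon> R * (conn \<epsilon> F (Up False) R \<sqinter>\<^sub>1 conn \<epsilon> F (star R) (Up False)) p u v)
     + curv (Up False) (Up False) p u v"
    unfolding d
    by (simp add: dpsi23_rhs_def collapse array_eq etap_def etam_def Cup_eq cnj_curvature,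
        simp add: curv_eq curvT_def sum_sp_index collapse etap_def etam_def,
        simp add: expand_sums algebra_simps,
        simp add: wedge_def expand_sums algebra_simps)
qed

text \<open>Conjugation flips the Boolean labels and transposition exchanges the two indices; under
  these operations the nine verified blocks reach all others.\<close>

theorem structure_equations: "structure_eq P Q"
proof -
  have up: "structure_eq (Greek \<alpha>) (Lo b)" "structure_eq (Greek \<alpha>) (Up b)"
    "structure_eq (Lo b) (Lo c)" "structure_eq (Up b) (Lo c)" "structure_eq (Up b) (Up c)" for \<alpha> b c
    using structure_eq_bar[OF structure_eq_GL[of "sw \<alpha>"]] structure_eq_GL[of \<alpha>]
      structure_eq_bar[OF structure_eq_GU[of "sw \<alpha>"]] structure_eq_GU[of \<alpha>]
      structure_eq_bar[OF structure_eq_LL] structure_eq_LL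
      structure_eq_sym[OF structure_eq_LL'] structure_eq_LL'
      structure_eq_bar[OF structure_eq_UL] structure_eq_UL
      structure_eq_bar[OF structure_eq_UL'] structure_eq_UL'
      structure_eq_sym[OF structure_eq_UU'] structure_eq_UU'
      structure_eq_bar[OF structure_eq_UU] structure_eq_UU
    by (cases b; cases c; simp)+
  show ?thesis
    by (cases P; cases Q) (auto intro: structure_eq_GG up structure_eq_sym[OF up(1)]
      structure_eq_sym[OF up(2)] structure_eq_sym[OF up(4)])
qed

end

section \<open>The starred forms as covariant derivatives of the curvature\<close>

context qc_coframing
begin

lemma d0_scale:
  fixes f :: "'x \<Rightarrow> complex"
  assumes "smooth_fun X UNIV f"
  shows "d0 X (\<lambda>p. z * f p) p u = z * d0 X f p u"
  using frechet_derivative_bounded_linear[OF bounded_linear_mult_complex[of z] smooth_fun_differentiable[OF assms]]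
  by (simp add: d0_def Let_def o_def)

lemma d0_curvT:
  "d0 X (curvT K (Greek \<alpha>) (Greek \<beta>) (Greek \<gamma>) (Greek \<delta>)) p u = d0 X (cS K \<alpha> \<beta> \<gamma> \<delta>) p u"
  "d0 X (curvT K (Greek \<alpha>) (Greek \<beta>) (Greek \<gamma>) (Up True)) p u = 2 * \<i> * d0 X (cV K \<alpha> \<beta> \<gamma>) p u"
  "d0 X (curvT K (Greek \<alpha>) (Greek \<beta>) (Up True) (Up True)) p u = - 4 * \<i> * d0 X (cM K \<alpha> \<beta>) p u"
  "d0 X (curvT K (Greek \<alpha>) (Greek \<beta>) (Up True) (Up False)) p u = - 4 * \<i> * d0 X (cL K \<alpha> \<beta>) p u"
  "d0 X (curvT K (Greek \<alpha>) (Up True) (Up True) (Up True)) p u = 8 * \<i> * d0 X (cH K \<alpha>) p u"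
  "d0 X (curvT K (Greek \<alpha>) (Up True) (Up True) (Up False)) p u = 8 * d0 X (cC K \<alpha>) p u"
  "d0 X (curvT K (Up True) (Up True) (Up True) (Up True)) p u = 4 * \<i> * d0 X (cQ K) p u"
  "d0 X (curvT K (Up True) (Up True) (Up True) (Up False)) p u = - 4 * d0 X (cP K) p u"
  "d0 X (curvT K (Up True) (Up True) (Up False) (Up False)) p u = 4 * d0 X (cR K) p u"
  unfolding d0_scale[OF curvature_smooth(1), symmetric] d0_scale[OF curvature_smooth(2), symmetric]
    d0_scale[OF curvature_smooth(3), symmetric] d0_scale[OF curvature_smooth(4), symmetric]
    d0_scale[OF curvature_smooth(5), symmetric] d0_scale[OF curvature_smooth(6), symmetric]
    d0_scale[OF curvature_smooth(7), symmetric] d0_scale[OF curvature_smooth(8), symmetric]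
    d0_scale[OF curvature_smooth(9), symmetric]
  by (intro arg_cong2[where f = "\<lambda>f u. d0 X f p u"] refl ext; simp add: curvT_def)+

lemma Hupb_eq: "Hupb \<epsilon> K \<alpha> p = of_real (\<epsilon> \<alpha>) * cH K \<alpha> p"
  by (simp add: Hupb_def gu_eq if_mult_0)

lemmas DT_unfold = DT_def d0_curvT con_def fun_minus_apply sum_fun_apply cscale_def fscale_def sum_sp_index
  curvT_def array_eq Cup_eq Hupb_eq cnj_if_0 if_mult_0 sum_if_const cj_def

text \<open>Greek values of the summation index in \<open>DT\<close> give the terms with
  \<open>Gam\<close>. Passing between Greek indices and indices \<open>Up\<close> gives
  \<open>theta\<close>, \<open>thetab\<close>, \<open>phi\<close> and \<open>phib\<close>; passing
  between the labels gives \<open>varphi\<close>. The weights come from the diagonal: the trace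
  accounts for one \<open>varphi0\<close>, each \<open>Up True\<close> adds half of
  \<open>varphi0 F + \<i> \<cdot> varphi F 1\<close>, and each \<open>Up False\<close> the conjugate
  of that.\<close>

lemma DT_S: "DT (Greek \<alpha>) (Greek \<beta>) (Greek \<gamma>) (Greek \<delta>) p u = starS \<epsilon> X F K \<alpha> \<beta> \<gamma> \<delta> p u"
  unfolding starS_def tildeS_def
  by (simp add: DT_unfold,
      simp add: expand_sums algebra_simps if_mult_0 curvature_sym)

lemma DT_V: "DT (Greek \<alpha>) (Greek \<beta>) (Greek \<gamma>) (Up True) p u = 2 * \<i> * starV \<epsilon> X F K \<alpha> \<beta> \<gamma> p u"
  unfolding starV_def tildeV_def
  by (simp add: DT_unfold,
      simp add: expand_sums algebra_simps if_mult_0 sum_delta_sw curvature_sym cnj_curvature,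
      subst (1) sum_sw[symmetric],
      simp add: expand_sums curvature_sym mult_ac)

lemma DT_M: "DT (Greek \<alpha>) (Greek \<beta>) (Up True) (Up True) p u = - 4 * \<i> * starM \<epsilon> X F K \<alpha> \<beta> p u"
  unfolding starM_def tildeM_def
  by (simp add: DT_unfold,
      simp add: expand_sums algebra_simps if_mult_0 sum_delta_sw curvature_sym cnj_curvature,
      subst (1) sum_sw[symmetric],
      simp add: expand_sums curvature_sym mult_ac)

lemma DT_L: "DT (Greek \<alpha>) (Greek \<beta>) (Up True) (Up False) p u = - 4 * \<i> * starL \<epsilon> X F K \<alpha> \<beta> p u"
  unfolding starL_def tildeL_def
  by (simp add: DT_unfold,
      simp add: expand_sums algebra_simps if_mult_0 sum_delta_sw curvature_sym cnj_curvature,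
      subst (1) sum_sw[symmetric],
      simp add: expand_sums curvature_sym mult_ac)

lemma DT_H: "DT (Greek \<alpha>) (Up True) (Up True) (Up True) p u = 8 * \<i> * starH \<epsilon> X F K \<alpha> p u"
  unfolding starH_def tildeH_def
  by (simp add: DT_unfold,
      simp add: expand_sums algebra_simps if_mult_0 sum_delta_sw curvature_sym cnj_curvature,
      subst (1) sum_sw[symmetric],
      simp add: expand_sums curvature_sym mult_ac)

lemma DT_C: "DT (Greek \<alpha>) (Up True) (Up True) (Up False) p u = 8 * starC \<epsilon> X F K \<alpha> p u"
  unfolding starC_def tildeC_def
  by (simp add: DT_unfold,
      simp add: expand_sums algebra_simps if_mult_0 sum_delta_sw curvature_sym cnj_curvature,
      subst (1) sum_sw[symmetric],
      simp add: expand_sums curvature_sym mult_ac)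

lemma DT_Q: "DT (Up True) (Up True) (Up True) (Up True) p u = 4 * \<i> * starQ \<epsilon> X F K  p u"
  unfolding starQ_def tildeQ_def
  by (simp add: DT_unfold,
      simp add: expand_sums algebra_simps if_mult_0 sum_delta_sw curvature_sym cnj_curvature,
      subst (1) sum_sw[symmetric],
      simp add: expand_sums curvature_sym mult_ac)

lemma DT_P: "DT (Up True) (Up True) (Up True) (Up False) p u = - 4 * starP \<epsilon> X F K  p u"
  unfolding starP_def tildeP_def
  by (simp add: DT_unfold,
      simp add: expand_sums algebra_simps if_mult_0 sum_delta_sw curvature_sym cnj_curvature,
      subst (1) sum_sw[symmetric],
      simp add: expand_sums curvature_sym mult_ac)

lemma DT_R: "DT (Up True) (Up True) (Up False) (Up False) p u = 4 * starR X F K  p u"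
  unfolding starR_def tildeR_def
  by (simp add: DT_unfold,
      simp add: expand_sums algebra_simps if_mult_0 sum_delta_sw curvature_sym cnj_curvature,
      subst (1) sum_sw[symmetric],
      simp add: expand_sums curvature_sym mult_ac)

end

section \<open>The Bianchi identity in components\<close>

lemma wedge3_linear:
  "(z \<cdot> a \<sqinter>\<^sub>2 B) p u v w = z * (a \<sqinter>\<^sub>2 B) p u v w"
  "(a \<sqinter>\<^sub>2 z \<cdot> b \<sqinter>\<^sub>1 c) p u v w = z * (a \<sqinter>\<^sub>2 b \<sqinter>\<^sub>1 c) p u v w"
  "(a \<sqinter>\<^sub>2 b \<sqinter>\<^sub>1 z \<cdot> c) p u v w = z * (a \<sqinter>\<^sub>2 b \<sqinter>\<^sub>1 c) p u v w"
  by (simp_all add: wedge3_def wedge_def cscale_def algebra_simps)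

lemma wedge3_flip: "(a \<sqinter>\<^sub>2 b \<sqinter>\<^sub>1 c) p u v w = - (a \<sqinter>\<^sub>2 c \<sqinter>\<^sub>1 b) p u v w"
  by (simp add: wedge3_def wedge_def algebra_simps)

lemma wedge3_self: "(a \<sqinter>\<^sub>2 b \<sqinter>\<^sub>1 b) p u v w = 0"
  by (simp add: wedge3_def wedge_def)

lemma double_cancel: "2 * a = 2 * b \<Longrightarrow> a = (b :: complex)"
  by simp

context qc_coframing
begin

lemma DT_sym:
  "DT P Q R S = DT Q P R S" "DT P Q R S = DT P R Q S" "DT P Q R S = DT P Q S R"
proof -
  show "DT P Q R S = DT Q P R S"
    by (intro ext) (simp add: DT_def curvT_sym(1))
  show "DT P Q R S = DT P R Q S"
    by (intro ext) (simp add: DT_def curvT_sym(2))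
  show "DT P Q R S = DT P Q S R"
    by (intro ext) (simp add: DT_def curvT_sym(3))
qed

text \<open>Oriented instances of the symmetry that terminate as rewrite rules: Greek indices move
  to the left of \<open>Up\<close>, and \<open>Up True\<close> to the left of
  \<open>Up False\<close>.\<close>

lemma DT_sort:
  "DT P Q (Up b) (Greek \<gamma>) = DT P Q (Greek \<gamma>) (Up b)"
  "DT P (Up b) (Greek \<gamma>) S = DT P (Greek \<gamma>) (Up b) S"
  "DT (Up b) (Greek \<gamma>) R S = DT (Greek \<gamma>) (Up b) R S"
  "DT P Q (Up False) (Up True) = DT P Q (Up True) (Up False)"
  "DT P (Up False) (Up True) S = DT P (Up True) (Up False) S"
  "DT (Up False) (Up True) R S = DT (Up True) (Up False) R S"
  by (rule DT_sym)+

lemma DT_star: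
  "DT (Greek \<alpha>) (Greek \<beta>) (Greek \<gamma>) (Greek \<delta>) = starS \<epsilon> X F K \<alpha> \<beta> \<gamma> \<delta>"
  "DT (Greek \<alpha>) (Greek \<beta>) (Greek \<gamma>) (Up True) = (2 * \<i>) \<cdot> starV \<epsilon> X F K \<alpha> \<beta> \<gamma>"
  "DT (Greek \<alpha>) (Greek \<beta>) (Up True) (Up True) = (- 4 * \<i>) \<cdot> starM \<epsilon> X F K \<alpha> \<beta>"
  "DT (Greek \<alpha>) (Greek \<beta>) (Up True) (Up False) = (- 4 * \<i>) \<cdot> starL \<epsilon> X F K \<alpha> \<beta>"
  "DT (Greek \<alpha>) (Up True) (Up True) (Up True) = (8 * \<i>) \<cdot> starH \<epsilon> X F K \<alpha>"
  "DT (Greek \<alpha>) (Up True) (Up True) (Up False) = 8 \<cdot> starC \<epsilon> X F K \<alpha>"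
  "DT (Up True) (Up True) (Up True) (Up True) = (4 * \<i>) \<cdot> starQ \<epsilon> X F K"
  "DT (Up True) (Up True) (Up True) (Up False) = (- 4) \<cdot> starP \<epsilon> X F K"
  "DT (Up True) (Up True) (Up False) (Up False) = 4 \<cdot> starR X F K"
  by (intro ext; simp add: cscale_def DT_S DT_V DT_M DT_L DT_H DT_C DT_Q DT_P DT_R)+

text \<open>\<open>cnj_DT\<close> solved for \<open>DT\<close>, which expresses the components not
  listed in \<open>DT_star\<close> as conjugates of listed ones.\<close>

lemma DT_conj: "DT P Q R S = (conj_sign P * conj_sign Q * conj_sign R * conj_sign S) \<cdot>
    cj (DT (conj_ix P) (conj_ix Q) (conj_ix R) (conj_ix S))"
  using cnj_DT[of "conj_ix P" "conj_ix Q" "conj_ix R" "conj_ix S"]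
  by (simp add: fun_eq_iff cscale_def cj_def mult_ac)

lemma DT_star_conj:
  "DT (Greek \<alpha>) (Greek \<beta>) (Greek \<gamma>) (Up False)
    = (2 * \<i> * sgn_ix \<alpha> * sgn_ix \<beta> * sgn_ix \<gamma>) \<cdot> cj (starV \<epsilon> X F K (sw \<alpha>) (sw \<beta>) (sw \<gamma>))"
  "DT (Greek \<alpha>) (Greek \<beta>) (Up False) (Up False)
    = (4 * \<i> * sgn_ix \<alpha> * sgn_ix \<beta>) \<cdot> cj (starM \<epsilon> X F K (sw \<alpha>) (sw \<beta>))"
  "DT (Greek \<alpha>) (Up True) (Up False) (Up False) = (8 * sgn_ix \<alpha>) \<cdot> cj (starC \<epsilon> X F K (sw \<alpha>))"
  "DT (Greek \<alpha>) (Up False) (Up False) (Up False) = (8 * \<i> * sgn_ix \<alpha>) \<cdot> cj (starH \<epsilon> X F K (sw \<alpha>))"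
  "DT (Up True) (Up False) (Up False) (Up False) = 4 \<cdot> cj (starP \<epsilon> X F K)"
  "DT (Up False) (Up False) (Up False) (Up False) = (- 4 * \<i>) \<cdot> cj (starQ \<epsilon> X F K)"
  by (subst DT_conj, simp add: DT_sort DT_star, simp add: fun_eq_iff cscale_def cj_def)+

text \<open>With one index \<open>Up\<close> of each label, conjugation maps the component to
  itself. The reality of \<open>cL\<close> therefore carries over to its starred form without a new
  computation of derivatives.\<close>

lemma starL_conj: "cj (starL \<epsilon> X F K \<alpha> \<beta>) = (sgn_ix \<alpha> * sgn_ix \<beta>) \<cdot> starL \<epsilon> X F K (sw \<alpha>) (sw \<beta>)"
proof -
  have "(- 4 * \<i>) \<cdot> starL \<epsilon> X F K (sw \<alpha>) (sw \<beta>)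
      = (- sgn_ix \<alpha> * sgn_ix \<beta>) \<cdot> cj ((- 4 * \<i>) \<cdot> starL \<epsilon> X F K \<alpha> \<beta>)"
    using DT_conj[of "Greek (sw \<alpha>)" "Greek (sw \<beta>)" "Up True" "Up False"]
    by (simp add: DT_sort DT_star)
  then show ?thesis by (simp add: fun_eq_iff cscale_def cj_def mult_ac)
qed

text \<open>The coefficients agree with those in \<open>curv_eq\<close>, which is why the identities
  look like the curvature parts of the structure equations with starred forms in place of the
  functions. In the pair \<open>Up False\<close>, \<open>Up True\<close> both columns contribute a
  multiple of \<open>eta F 1\<close>, so that term vanishes.\<close>

theorem Bianchi_blocks:
  "(\<Sum>\<^sub>*\<gamma> \<delta>. sgn_ix \<delta> * (DT P Q (Greek \<gamma>) (Greek (sw \<delta>)) \<sqinter>\<^sub>2 theta F \<gamma> \<sqinter>\<^sub>1 thetab F \<delta>) p u v w)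
    - (\<i>/2) * (\<Sum>\<^sub>*\<gamma>. (DT P Q (Greek \<gamma>) (Up True) \<sqinter>\<^sub>2 theta F \<gamma> \<sqinter>\<^sub>1 eta F 1) p u v w)
    - (1/2) * (\<Sum>\<^sub>*\<gamma>. sgn_ix \<gamma> * (DT P Q (Greek (sw \<gamma>)) (Up True) \<sqinter>\<^sub>2 thetab F \<gamma> \<sqinter>\<^sub>1 etap F) p u v w)
    + (1/2) * (\<Sum>\<^sub>*\<gamma>. (DT P Q (Greek \<gamma>) (Up False) \<sqinter>\<^sub>2 theta F \<gamma> \<sqinter>\<^sub>1 etam F) p u v w)
    + (\<i>/2) * (\<Sum>\<^sub>*\<gamma>. sgn_ix \<gamma> * (DT P Q (Greek (sw \<gamma>)) (Up False) \<sqinter>\<^sub>2 thetab F \<gamma> \<sqinter>\<^sub>1 eta F 1) p u v w)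
    + (\<i>/4) * (DT P Q (Up True) (Up True) \<sqinter>\<^sub>2 eta F 1 \<sqinter>\<^sub>1 etap F) p u v w
    + (1/4) * (DT P Q (Up True) (Up False) \<sqinter>\<^sub>2 etap F \<sqinter>\<^sub>1 etam F) p u v w
    - (\<i>/4) * (DT P Q (Up False) (Up False) \<sqinter>\<^sub>2 eta F 1 \<sqinter>\<^sub>1 etam F) p u v w = 0"
proof -
  let ?D = "\<lambda>R S. DT P Q R S"
  have 1: "(\<Sum>\<^sub>*\<delta>. (?D (Greek \<gamma>) (Greek \<delta>) \<sqinter>\<^sub>2 theta F \<gamma> \<sqinter>\<^sub>1 (- sgn_ix \<delta>) \<cdot> thetab F (sw \<delta>)) p u v w)
    = (\<Sum>\<^sub>*\<delta>. sgn_ix \<delta> * (?D (Greek \<gamma>) (Greek (sw \<delta>)) \<sqinter>\<^sub>2 theta F \<gamma> \<sqinter>\<^sub>1 thetab F \<delta>) p u v w)" for \<gamma>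
    by (subst sum_sw[symmetric]) (simp add: wedge3_linear mult_ac)
  have 2: "(\<Sum>\<^sub>*\<gamma>. (?D (Up b) (Greek \<gamma>) \<sqinter>\<^sub>2 a \<sqinter>\<^sub>1 (- sgn_ix \<gamma>) \<cdot> thetab F (sw \<gamma>)) p u v w)
    = - (\<Sum>\<^sub>*\<gamma>. sgn_ix \<gamma> * (?D (Greek (sw \<gamma>)) (Up b) \<sqinter>\<^sub>2 thetab F \<gamma> \<sqinter>\<^sub>1 a) p u v w)" for a b
    by (subst sum_sw[symmetric])
      (simp add: wedge3_linear DT_sort wedge3_flip[of _ a] sum_negf mult_ac)
  show ?thesis
    using second_Bianchi[OF structure_equations, of P Q p u v w]
    unfolding sum_sp_index' con_eqs sum.distrib 1 2
    by (simp add: wedge3_linear sum_distrib_left DT_sort wedge3_self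
        wedge3_flip[of _ "etap F" "eta F 1"] sum_negf algebra_simps)
qed

lemmas star_unfold = fun_minus_apply sum_fun_apply array_eq if_mult_0 sum_if_const sum_delta_sw wedge3_linear

lemma Bianchi_Gam: "(\<Sum>\<^sub>*\<gamma> \<delta> \<sigma>. pub \<epsilon> \<sigma> \<delta> \<cdot> starS \<epsilon> X F K \<alpha> \<beta> \<gamma> \<sigma> \<sqinter>\<^sub>2 theta F \<gamma> \<sqinter>\<^sub>1 thetab F \<delta>)
          + (\<Sum>\<^sub>*\<gamma>. starV \<epsilon> X F K \<alpha> \<beta> \<gamma> \<sqinter>\<^sub>2 theta F \<gamma> \<sqinter>\<^sub>1 eta F 1)
          + (\<Sum>\<^sub>*\<mu> \<nu> \<gamma>. (pbd \<epsilon> \<mu> \<alpha> * pbd \<epsilon> \<nu> \<beta>) \<cdot> cj (starV \<epsilon> X F K \<mu> \<nu> \<gamma>)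
                \<sqinter>\<^sub>2 thetab F \<gamma> \<sqinter>\<^sub>1 eta F 1)
          - (\<Sum>\<^sub>*\<sigma> \<gamma>. (\<i> * pub \<epsilon> \<sigma> \<gamma>) \<cdot> starV \<epsilon> X F K \<alpha> \<beta> \<sigma> \<sqinter>\<^sub>2 thetab F \<gamma> \<sqinter>\<^sub>1 etap F)
          + (\<Sum>\<^sub>*\<mu> \<nu> \<xi> \<gamma>. (\<i> * pbd \<epsilon> \<mu> \<alpha> * pbd \<epsilon> \<nu> \<beta> * pbd \<epsilon> \<xi> \<gamma>) \<cdot> cj (starV \<epsilon> X F K \<mu> \<nu> \<xi>)
                \<sqinter>\<^sub>2 theta F \<gamma> \<sqinter>\<^sub>1 etam F)
          - (\<i> \<cdot> starL \<epsilon> X F K \<alpha> \<beta> \<sqinter>\<^sub>2 etap F \<sqinter>\<^sub>1 etam F)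
          + (starM \<epsilon> X F K \<alpha> \<beta> \<sqinter>\<^sub>2 eta F 1 \<sqinter>\<^sub>1 etap F)
          + (\<Sum>\<^sub>*\<mu> \<nu>. (pbd \<epsilon> \<mu> \<alpha> * pbd \<epsilon> \<nu> \<beta>) \<cdot> cj (starM \<epsilon> X F K \<mu> \<nu>)
                \<sqinter>\<^sub>2 eta F 1 \<sqinter>\<^sub>1 etam F) = 0" (is "?L = 0")
proof (intro ext)
  fix p u v w
  show "?L p u v w = 0 p u v w"
    by (insert Bianchi_blocks[of "Greek \<alpha>" "Greek \<beta>" p u v w],
        simp add: DT_sort DT_star DT_star_conj wedge3_linear,
        simp add: star_unfold,
        simp add: expand_sums algebra_simps)
qed

lemma Bianchi_phil: "- (\<Sum>\<^sub>*\<beta> \<gamma> \<nu>. (\<i> * pub \<epsilon> \<nu> \<gamma>) \<cdot> starV \<epsilon> X F K \<alpha> \<beta> \<nu> \<sqinter>\<^sub>2 theta F \<beta> \<sqinter>\<^sub>1 thetab F \<gamma>)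
          + (\<Sum>\<^sub>*\<mu> \<beta>. pbd \<epsilon> \<mu> \<alpha> \<cdot> cj (starL \<epsilon> X F K \<mu> \<beta>) \<sqinter>\<^sub>2 thetab F \<beta> \<sqinter>\<^sub>1 eta F 1)
          + (\<Sum>\<^sub>*\<beta>. starM \<epsilon> X F K \<alpha> \<beta> \<sqinter>\<^sub>2 theta F \<beta> \<sqinter>\<^sub>1 eta F 1)
          - (\<Sum>\<^sub>*\<nu> \<beta>. (\<i> * pub \<epsilon> \<nu> \<beta>) \<cdot> starM \<epsilon> X F K \<alpha> \<nu> \<sqinter>\<^sub>2 thetab F \<beta> \<sqinter>\<^sub>1 etap F)
          + (\<Sum>\<^sub>*\<beta>. \<i> \<cdot> starL \<epsilon> X F K \<alpha> \<beta> \<sqinter>\<^sub>2 theta F \<beta> \<sqinter>\<^sub>1 etam F)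
          - (starC \<epsilon> X F K \<alpha> \<sqinter>\<^sub>2 etap F \<sqinter>\<^sub>1 etam F)
          + (\<Sum>\<^sub>*\<mu>. (\<i> * pbd \<epsilon> \<mu> \<alpha>) \<cdot> cj (starC \<epsilon> X F K \<mu>) \<sqinter>\<^sub>2 eta F 1 \<sqinter>\<^sub>1 etam F)
          + (starH \<epsilon> X F K \<alpha> \<sqinter>\<^sub>2 eta F 1 \<sqinter>\<^sub>1 etap F) = 0" (is "?L = 0")
proof (intro ext)
  fix p u v w
  \<comment> \<open>The block identity is -2 times the asserted one, which is why the goal is
    doubled.\<close>
  show "?L p u v w = 0 p u v w"
    by (insert Bianchi_blocks[of "Greek \<alpha>" "Up True" p u v w],
        simp add: DT_sort DT_star DT_star_conj wedge3_linear,
        simp add: star_unfold starL_conj,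
        simp add: expand_sums algebra_simps,
        rule double_cancel,
        simp add: expand_sums algebra_simps)
qed

lemma Bianchi_psi1: "(\<Sum>\<^sub>*\<beta> \<gamma> \<mu>. (4 * pub \<epsilon> \<mu> \<gamma>) \<cdot> starL \<epsilon> X F K \<beta> \<mu> \<sqinter>\<^sub>2 theta F \<beta> \<sqinter>\<^sub>1 thetab F \<gamma>)
          + (\<Sum>\<^sub>*\<beta>. 4 \<cdot> starC \<epsilon> X F K \<beta> \<sqinter>\<^sub>2 theta F \<beta> \<sqinter>\<^sub>1 eta F 1)
          + (\<Sum>\<^sub>*\<gamma>. 4 \<cdot> cj (starC \<epsilon> X F K \<gamma>) \<sqinter>\<^sub>2 thetab F \<gamma> \<sqinter>\<^sub>1 eta F 1)
          + (\<Sum>\<^sub>*\<mu> \<beta>. (4 * \<i> * pbd \<epsilon> \<mu> \<beta>) \<cdot> cj (starC \<epsilon> X F K \<mu>) \<sqinter>\<^sub>2 theta F \<beta> \<sqinter>\<^sub>1 etam F)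
          - (\<Sum>\<^sub>*\<mu> \<gamma>. (4 * \<i> * pub \<epsilon> \<mu> \<gamma>) \<cdot> starC \<epsilon> X F K \<mu> \<sqinter>\<^sub>2 thetab F \<gamma> \<sqinter>\<^sub>1 etap F)
          + (starP \<epsilon> X F K \<sqinter>\<^sub>2 eta F 1 \<sqinter>\<^sub>1 etap F)
          + (cj (starP \<epsilon> X F K) \<sqinter>\<^sub>2 eta F 1 \<sqinter>\<^sub>1 etam F)
          + (\<i> \<cdot> starR X F K \<sqinter>\<^sub>2 etap F \<sqinter>\<^sub>1 etam F) = 0" (is "?L = 0")
proof (intro ext)
  fix p u v w
  \<comment> \<open>The block identity is -\<i> times the asserted one and is therefore multiplied
    by \<i>.\<close>
  show "?L p u v w = 0 p u v w"
    by (insert Bianchi_blocks[of "Up True" "Up False" p u v w],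
        simp add: DT_sort DT_star DT_star_conj wedge3_linear,
        simp add: star_unfold,
        simp add: expand_sums algebra_simps,
        drule arg_cong[where f = "\<lambda>z. \<i> * z"],
        simp add: expand_sums algebra_simps)
qed

lemma Bianchi_psi23: "(\<Sum>\<^sub>*\<beta> \<gamma> \<mu>. (4 * \<i> * pbd \<epsilon> \<mu> \<beta>) \<cdot> cj (starM \<epsilon> X F K \<mu> \<gamma>) \<sqinter>\<^sub>2 theta F \<beta> \<sqinter>\<^sub>1 thetab F \<gamma>)
          + (\<Sum>\<^sub>*\<mu> \<beta>. (4 * \<i> * pbd \<epsilon> \<mu> \<beta>) \<cdot> cj (starC \<epsilon> X F K \<mu>) \<sqinter>\<^sub>2 theta F \<beta> \<sqinter>\<^sub>1 eta F 1)
          - (\<Sum>\<^sub>*\<gamma>. 4 \<cdot> cj (starH \<epsilon> X F K \<gamma>) \<sqinter>\<^sub>2 thetab F \<gamma> \<sqinter>\<^sub>1 eta F 1)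
          - (\<Sum>\<^sub>*\<gamma>. 4 \<cdot> cj (starC \<epsilon> X F K \<gamma>) \<sqinter>\<^sub>2 thetab F \<gamma> \<sqinter>\<^sub>1 etap F)
          - (\<Sum>\<^sub>*\<mu> \<beta>. (4 * \<i> * pbd \<epsilon> \<mu> \<beta>) \<cdot> cj (starH \<epsilon> X F K \<mu>) \<sqinter>\<^sub>2 theta F \<beta> \<sqinter>\<^sub>1 etam F)
          - (\<i> \<cdot> starR X F K \<sqinter>\<^sub>2 eta F 1 \<sqinter>\<^sub>1 etap F)
          + (cj (starQ \<epsilon> X F K) \<sqinter>\<^sub>2 eta F 1 \<sqinter>\<^sub>1 etam F)
          - (cj (starP \<epsilon> X F K) \<sqinter>\<^sub>2 etap F \<sqinter>\<^sub>1 etam F) = 0" (is "?L = 0")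
proof (intro ext)
  fix p u v w
  show "?L p u v w = 0 p u v w"
    by (insert Bianchi_blocks[of "Up False" "Up False" p u v w],
        simp add: DT_sort DT_star DT_star_conj wedge3_linear,
        simp add: star_unfold,
        simp add: expand_sums algebra_simps)
qed

end

section \<open>Reality of the tautological forms\<close>

lemma Po_eta_real:
  assumes "qc_manifold \<epsilon> A H \<T>" "Po_bundle A \<T> B \<pi>\<^sub>o \<eta>"
  shows "\<eta> s q v \<in> \<real>"
proof -
  have "(\<Union>T\<in>\<T>. fst T) = UNIV"
    using assms(1) unfolding qc_manifold_def by (elim conjE)
  then obtain V \<eta>' where T: "(V, \<eta>') \<in> \<T>" "\<pi>\<^sub>o q \<in> V"
    by (metis UNIV_I UN_E prod.collapse)
  have "\<exists>(\<mu> :: _ \<Rightarrow> real) (a :: _ \<Rightarrow> real^3^3). \<forall>q\<in>\<pi>\<^sub>o -` V. \<forall>s v. \<eta> s q v =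
      of_real (\<mu> q * (\<Sum>\<^sub>*t. a q $ t $ s * pullback1 B A \<pi>\<^sub>o (\<eta>' t) q v))"
    using bspec[OF assms(2)[unfolded Po_bundle_def, THEN conjunct2, THEN conjunct2, THEN conjunct2, THEN conjunct2] T(1),
        unfolded prod.case]
    by (elim exE conjE) (intro exI ballI, drule (1) bspec, erule conjunct2)
  then obtain \<mu> :: "_ \<Rightarrow> real" and a :: "_ \<Rightarrow> real^3^3" where "\<eta> s q v =
      of_real (\<mu> q * (\<Sum>\<^sub>*t. a q $ t $ s * pullback1 B A \<pi>\<^sub>o (\<eta>' t) q v))"
    using T(2) by blast
  then show ?thesis by (simp only: Reals_of_real)
qed

lemma rsq_real:
  "cnj (rsq \<epsilon> r) = rsq \<epsilon> r"
  by (simp add: rsq_def gl_def if_distrib[of cnj] if_distrib[of "\<lambda>x. x * _"] cong: if_cong)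
    (simp add: mult_ac)

text \<open>The terms added by a change of coframing are real multiples of the \<open>eta\<close>
  forms or come in conjugate pairs.\<close>

lemma transform_real:
  assumes "\<And>s. cnj (eta E s p v) = eta E s p v" "cnj (varphi0 E p v) = varphi0 E p v"
    "\<And>s. cnj (varphi E s p v) = varphi E s p v"
  shows "cnj (varphi0 (transform \<epsilon> U r l E) p v) = varphi0 (transform \<epsilon> U r l E) p v"
    and "cnj (varphi (transform \<epsilon> U r l E) s p v) = varphi (transform \<epsilon> U r l E) s p v"
  using assms
  by (simp_all add: transform_def fscale_def sum_fun_apply fun_minus_apply cj_def rsq_real sum_negf)

text \<open>Every point of the bundle lies over the domain of an admissible coframing, and there the
  tautological forms are a transform of its pullback; reality is a pointwise statement, so one such
  coframing for each point suffices.\<close>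

lemma P1_forms_real:
  assumes qc: "qc_manifold \<epsilon> A H \<T>" and Po: "Po_bundle A \<T> B \<pi>\<^sub>o \<eta>"
    and P1: "P1_bundle \<epsilon> A B \<pi>\<^sub>o \<eta> C \<pi>\<^sub>1 F"
  shows "real_form UNIV (eta F s)" "real_form UNIV (varphi0 F)" "real_form UNIV (varphi F s)"
proof -
  have "eta F s e v \<in> \<real> \<and> varphi0 F e v \<in> \<real> \<and> varphi F s e v \<in> \<real>" for s e v
  proof -
    note P1' = P1[unfolded P1_bundle_def, THEN conjunct2, THEN conjunct2, THEN conjunct2, THEN conjunct2,
        THEN conjunct2, THEN conjunct2, THEN conjunct2]
    obtain W E where e: "\<pi>\<^sub>1 e \<in> W" and E: "admissible_coframing \<epsilon> A B \<pi>\<^sub>o \<eta> W E"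
      using P1'[THEN conjunct1] by blast
    have "\<exists>U r l. \<forall>e\<in>\<pi>\<^sub>1 -` W.
        (let E' = transform \<epsilon> U r l (pullback_adapted C B \<pi>\<^sub>1 E) in
                 (\<forall>s. eta F s e = eta E' s e) \<and> (\<forall>\<alpha>. theta F \<alpha> e = theta E' \<alpha> e) \<and>
                 varphi0 F e = varphi0 E' e \<and> (\<forall>s. varphi F s e = varphi E' s e))"
      using P1'[THEN conjunct2, THEN conjunct1, rule_format, OF E]
      by (elim exE conjE) (intro exI ballI, drule (1) bspec, erule conjunct2)
    then obtain U r l where eq: "\<forall>e\<in>\<pi>\<^sub>1 -` W.
        (let E' = transform \<epsilon> U r l (pullback_adapted C B \<pi>\<^sub>1 E) in
                 (\<forall>s. eta F s e = eta E' s e) \<and> (\<forall>\<alpha>. theta F \<alpha> e = theta E' \<alpha> e) \<and>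
                 varphi0 F e = varphi0 E' e \<and> (\<forall>s. varphi F s e = varphi E' s e))"
      by (elim exE)
    let ?E = "pullback_adapted C B \<pi>\<^sub>1 E"
    have "eta E = \<eta>" "real_form W (varphi0 E)" "real_form W (varphi E s)" for s
      using E by (simp_all add: admissible_coframing_def)
    then have real: "cnj (eta ?E s e v) = eta ?E s e v" "cnj (varphi0 ?E e v) = varphi0 ?E e v"
      "cnj (varphi ?E s e v) = varphi ?E s e v" for s v
      using e Po_eta_real[OF qc Po]
      by (simp_all add: pullback_adapted_def pullback1_def real_form_def Reals_cnj_iff)
    have "eta F s e = eta ?E s e" "varphi0 F e = varphi0 (transform \<epsilon> U r l ?E) e"
      "varphi F s e = varphi (transform \<epsilon> U r l ?E) s e"
      using bspec[OF eq, of e] e by (simp_all add: Let_def transform_def)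
    then show ?thesis
      using transform_real[of ?E e v] real by (simp add: Reals_cnj_iff)
  qed
  then show "real_form UNIV (eta F s)" "real_form UNIV (varphi0 F)" "real_form UNIV (varphi F s)"
    by (simp_all add: real_form_def)
qed

theorem proposition4p2:
  fixes \<epsilon> :: "'n::finite + 'n \<Rightarrow> real"
    and A :: "('m::{t2_space, second_countable_topology}, 'e::euclidean_space) chart set"
    and H :: "'m \<Rightarrow> 'e set"
    and \<T> :: "('m set \<times> (3 \<Rightarrow> 'm \<Rightarrow> 'e \<Rightarrow> real)) set"
    and B :: "('p::{t2_space, second_countable_topology}, 'f::euclidean_space) chart set"
    and \<pi>\<^sub>o :: "'p \<Rightarrow> 'm"
    and \<eta> :: "3 \<Rightarrow> ('p, 'f) form1"
    and C :: "('q::{t2_space, second_countable_topology}, 'h::euclidean_space) chart set"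
    and \<pi>\<^sub>1 :: "'q \<Rightarrow> 'p"
    and F :: "('q, 'h, 'n + 'n) canonical"
    and K :: "('q, 'n + 'n) curvature"
  assumes "sign_constants \<epsilon>"
    and "qc_manifold \<epsilon> A H \<T>"
    and "Po_bundle A \<T> B \<pi>\<^sub>o \<eta>"
    and "P1_bundle \<epsilon> A B \<pi>\<^sub>o \<eta> C \<pi>\<^sub>1 F"
    and "canonical_coframing \<epsilon> C F"
    and "curvature_functions \<epsilon> C F K"
  shows
    "(\<forall>\<alpha> \<beta>.
        d2 C (d1 C (Gam F \<alpha> \<beta>)) =
          (\<Sum>\<^sub>*\<gamma> \<delta> \<sigma>. pub \<epsilon> \<sigma> \<delta> \<cdot> starS \<epsilon> C F K \<alpha> \<beta> \<gamma> \<sigma> \<sqinter>\<^sub>2 theta F \<gamma> \<sqinter>\<^sub>1 thetab F \<delta>)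
          + (\<Sum>\<^sub>*\<gamma>. starV \<epsilon> C F K \<alpha> \<beta> \<gamma> \<sqinter>\<^sub>2 theta F \<gamma> \<sqinter>\<^sub>1 eta F 1)
          + (\<Sum>\<^sub>*\<mu> \<nu> \<gamma>. (pbd \<epsilon> \<mu> \<alpha> * pbd \<epsilon> \<nu> \<beta>) \<cdot> cj (starV \<epsilon> C F K \<mu> \<nu> \<gamma>)
                \<sqinter>\<^sub>2 thetab F \<gamma> \<sqinter>\<^sub>1 eta F 1)
          - (\<Sum>\<^sub>*\<sigma> \<gamma>. (\<i> * pub \<epsilon> \<sigma> \<gamma>) \<cdot> starV \<epsilon> C F K \<alpha> \<beta> \<sigma> \<sqinter>\<^sub>2 thetab F \<gamma> \<sqinter>\<^sub>1 etap F)
          + (\<Sum>\<^sub>*\<mu> \<nu> \<xi> \<gamma>. (\<i> * pbd \<epsilon> \<mu> \<alpha> * pbd \<epsilon> \<nu> \<beta> * pbd \<epsilon> \<xi> \<gamma>) \<cdot> cj (starV \<epsilon> C F K \<mu> \<nu> \<xi>)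
                \<sqinter>\<^sub>2 theta F \<gamma> \<sqinter>\<^sub>1 etam F)
          - (\<i> \<cdot> starL \<epsilon> C F K \<alpha> \<beta> \<sqinter>\<^sub>2 etap F \<sqinter>\<^sub>1 etam F)
          + (starM \<epsilon> C F K \<alpha> \<beta> \<sqinter>\<^sub>2 eta F 1 \<sqinter>\<^sub>1 etap F)
          + (\<Sum>\<^sub>*\<mu> \<nu>. (pbd \<epsilon> \<mu> \<alpha> * pbd \<epsilon> \<nu> \<beta>) \<cdot> cj (starM \<epsilon> C F K \<mu> \<nu>)
                \<sqinter>\<^sub>2 eta F 1 \<sqinter>\<^sub>1 etam F)
        \<and> d2 C (d1 C (Gam F \<alpha> \<beta>)) = 0)
     \<and> (\<forall>\<alpha>.
        d2 C (d1 C (phil \<epsilon> F \<alpha>)) =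
          - (\<Sum>\<^sub>*\<beta> \<gamma> \<nu>. (\<i> * pub \<epsilon> \<nu> \<gamma>) \<cdot> starV \<epsilon> C F K \<alpha> \<beta> \<nu> \<sqinter>\<^sub>2 theta F \<beta> \<sqinter>\<^sub>1 thetab F \<gamma>)
          + (\<Sum>\<^sub>*\<mu> \<beta>. pbd \<epsilon> \<mu> \<alpha> \<cdot> cj (starL \<epsilon> C F K \<mu> \<beta>) \<sqinter>\<^sub>2 thetab F \<beta> \<sqinter>\<^sub>1 eta F 1)
          + (\<Sum>\<^sub>*\<beta>. starM \<epsilon> C F K \<alpha> \<beta> \<sqinter>\<^sub>2 theta F \<beta> \<sqinter>\<^sub>1 eta F 1)
          - (\<Sum>\<^sub>*\<nu> \<beta>. (\<i> * pub \<epsilon> \<nu> \<beta>) \<cdot> starM \<epsilon> C F K \<alpha> \<nu> \<sqinter>\<^sub>2 thetab F \<beta> \<sqinter>\<^sub>1 etap F)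
          + (\<Sum>\<^sub>*\<beta>. \<i> \<cdot> starL \<epsilon> C F K \<alpha> \<beta> \<sqinter>\<^sub>2 theta F \<beta> \<sqinter>\<^sub>1 etam F)
          - (starC \<epsilon> C F K \<alpha> \<sqinter>\<^sub>2 etap F \<sqinter>\<^sub>1 etam F)
          + (\<Sum>\<^sub>*\<mu>. (\<i> * pbd \<epsilon> \<mu> \<alpha>) \<cdot> cj (starC \<epsilon> C F K \<mu>) \<sqinter>\<^sub>2 eta F 1 \<sqinter>\<^sub>1 etam F)
          + (starH \<epsilon> C F K \<alpha> \<sqinter>\<^sub>2 eta F 1 \<sqinter>\<^sub>1 etap F)
        \<and> d2 C (d1 C (phil \<epsilon> F \<alpha>)) = 0)
     \<and> (d2 C (d1 C (psi F 1)) =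
          (\<Sum>\<^sub>*\<beta> \<gamma> \<mu>. (4 * pub \<epsilon> \<mu> \<gamma>) \<cdot> starL \<epsilon> C F K \<beta> \<mu> \<sqinter>\<^sub>2 theta F \<beta> \<sqinter>\<^sub>1 thetab F \<gamma>)
          + (\<Sum>\<^sub>*\<beta>. 4 \<cdot> starC \<epsilon> C F K \<beta> \<sqinter>\<^sub>2 theta F \<beta> \<sqinter>\<^sub>1 eta F 1)
          + (\<Sum>\<^sub>*\<gamma>. 4 \<cdot> cj (starC \<epsilon> C F K \<gamma>) \<sqinter>\<^sub>2 thetab F \<gamma> \<sqinter>\<^sub>1 eta F 1)
          + (\<Sum>\<^sub>*\<mu> \<beta>. (4 * \<i> * pbd \<epsilon> \<mu> \<beta>) \<cdot> cj (starC \<epsilon> C F K \<mu>) \<sqinter>\<^sub>2 theta F \<beta> \<sqinter>\<^sub>1 etam F)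
          - (\<Sum>\<^sub>*\<mu> \<gamma>. (4 * \<i> * pub \<epsilon> \<mu> \<gamma>) \<cdot> starC \<epsilon> C F K \<mu> \<sqinter>\<^sub>2 thetab F \<gamma> \<sqinter>\<^sub>1 etap F)
          + (starP \<epsilon> C F K \<sqinter>\<^sub>2 eta F 1 \<sqinter>\<^sub>1 etap F)
          + (cj (starP \<epsilon> C F K) \<sqinter>\<^sub>2 eta F 1 \<sqinter>\<^sub>1 etam F)
          + (\<i> \<cdot> starR C F K \<sqinter>\<^sub>2 etap F \<sqinter>\<^sub>1 etam F)
        \<and> d2 C (d1 C (psi F 1)) = 0)
     \<and> (d2 C (d1 C (psi F 2 + \<i> \<cdot> psi F 3)) =
          (\<Sum>\<^sub>*\<beta> \<gamma> \<mu>. (4 * \<i> * pbd \<epsilon> \<mu> \<beta>) \<cdot> cj (starM \<epsilon> C F K \<mu> \<gamma>) \<sqinter>\<^sub>2 theta F \<beta> \<sqinter>\<^sub>1 thetab F \<gamma>)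
          + (\<Sum>\<^sub>*\<mu> \<beta>. (4 * \<i> * pbd \<epsilon> \<mu> \<beta>) \<cdot> cj (starC \<epsilon> C F K \<mu>) \<sqinter>\<^sub>2 theta F \<beta> \<sqinter>\<^sub>1 eta F 1)
          - (\<Sum>\<^sub>*\<gamma>. 4 \<cdot> cj (starH \<epsilon> C F K \<gamma>) \<sqinter>\<^sub>2 thetab F \<gamma> \<sqinter>\<^sub>1 eta F 1)
          - (\<Sum>\<^sub>*\<gamma>. 4 \<cdot> cj (starC \<epsilon> C F K \<gamma>) \<sqinter>\<^sub>2 thetab F \<gamma> \<sqinter>\<^sub>1 etap F)
          - (\<Sum>\<^sub>*\<mu> \<beta>. (4 * \<i> * pbd \<epsilon> \<mu> \<beta>) \<cdot> cj (starH \<epsilon> C F K \<mu>) \<sqinter>\<^sub>2 theta F \<beta> \<sqinter>\<^sub>1 etam F)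
          - (\<i> \<cdot> starR C F K \<sqinter>\<^sub>2 eta F 1 \<sqinter>\<^sub>1 etap F)
          + (cj (starQ \<epsilon> C F K) \<sqinter>\<^sub>2 eta F 1 \<sqinter>\<^sub>1 etam F)
          - (cj (starP \<epsilon> C F K) \<sqinter>\<^sub>2 etap F \<sqinter>\<^sub>1 etam F)
        \<and> d2 C (d1 C (psi F 2 + \<i> \<cdot> psi F 3)) = 0)"
proof -
  interpret qc_coframing C \<epsilon> F K
  proof
    show "smooth_manifold C" "smooth_form1 C UNIV (eta F s)" "smooth_form1 C UNIV (theta F \<alpha>)"
      "smooth_form1 C UNIV (varphi0 F)" "smooth_form1 C UNIV (varphi F s)" "SE \<epsilon> C UNIV F" for s \<alpha>
      using assms(4) by (simp_all add: P1_bundle_def)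
  qed (rule assms P1_forms_real[OF assms(2-4)])+
  have "smooth_form1 C UNIV (phil \<epsilon> F \<alpha>)" for \<alpha>
    by (simp add: phil_eq smooth_form1_cscale smooth_form1_cj canonical_smooth)
  moreover have "smooth_form1 C UNIV (psi F 2 + \<i> \<cdot> psi F 3)"
    by (simp add: smooth_form1_plus smooth_form1_cscale canonical_smooth)
  \<comment> \<open>Both sides of each equation vanish: the right-hand sides by the component
    identities, the left-hand sides by \<open>d2_d1\<close>.\<close>
  ultimately show ?thesis
    unfolding Bianchi_Gam Bianchi_phil Bianchi_psi1 Bianchi_psi23
    by (simp only: d2_d1 canonical_smooth simp_thms)
qed

end
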